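(* Let $\kappa>0$ and let $(P^{\mathrm{snob}}_t)_{t\ge0}:\mathscr{C}_0(\mathbb{G})\to\mathscr{C}_0(\mathbb{G})$ be the semigroup of the snapping out Brownian motion with parameter $\kappa$. Then, for any $f\in\mathscr{C}_0(\mathbb{G})$, the function $\rho(t,u)=P^{\mathrm{snob}}_tf(u)$ is the solution of the partial differential equation $$\begin{cases}\partial_t\rho(t,u)=\frac12\Delta\rho(t,u), & u\ne0,\\ \partial_u\rho(t,0^+)=\partial_u\rho(t,0^-)=\frac{\kappa}{2}\big[\rho(t,0^+)-\rho(t,0^-)\big], & t>0,\\ \rho(0,u)=f(u), & u\in\mathbb{G}.\end{cases}$$ Moreover, the semigroup $(P^{\mathrm{snob}}_t)_{t\ge0}:\mathscr{C}_0(\mathbb{G})\to\mathscr{C}_0(\mathbb{G})$ is given by $$P^{\mathrm{snob}}_tf(u)=\frac1{\sqrt{2\pi t}}\Big\{\int_{\mathbb{R}}e^{-\frac{(u-y)^2}{2t}}f_{\mathrm{even}}(y)\,dy+e^{\kappa u}\int_u^{+\infty}e^{-\kappa z}\int_0^{+\infty}\Big[\Big(\frac{z-y+\kappa t}{2t}\Big)e^{-\frac{(z-y)^2}{2t}}+\Big(\frac{z+y-\kappa t}{2t}\Big)e^{-\frac{(z+y)^2}{2t}}\Big]f_{\mathrm{odd}}(y)\,dy\,dz\Big\}$$ for $u>0$, and $$P^{\mathrm{snob}}_tf(u)=\frac1{\sqrt{2\pi t}}\Big\{\int_{\mathbb{R}}e^{-\frac{(u-y)^2}{2t}}f_{\mathrm{even}}(y)\,dy-e^{-\kappa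 u}\int_{-u}^{+\infty}e^{-\kappa z}\int_0^{+\infty}\Big[\Big(\frac{z-y+\kappa t}{2t}\Big)e^{-\frac{(z-y)^2}{2t}}+\Big(\frac{z+y-\kappa t}{2t}\Big)e^{-\frac{(z+y)^2}{2t}}\Big]f_{\mathrm{odd}}(y)\,dy\,dz\Big\}$$ for $u<0$, where $f_{\mathrm{even}}$ and $f_{\mathrm{odd}}$ are the even and odd parts of $f$, respectively.
   Context: $\mathbb{G}=(-\infty,0^-]\cup[0^+,\infty)$ is the disjoint union of two closed half-lines, where $0^-$ and $0^+$ are distinct points. $\mathscr{C}_0(\mathbb{G})$ is the set of bounded continuous functions $f:\mathbb{G}\to\mathbb{R}$ vanishing at infinity; such functions are identified with continuous functions on $\mathbb{R}\setminus\{0\}$ having side limits at $0$ (the values at $0^\pm$ being the side limits). $\operatorname{sgn}(u)=1$ for $u\in[0^+,\infty)$ and $\operatorname{sgn}(u)=-1$ for $u\in(-\infty,0^-]$. The even and odd parts are $f_{\mathrm{even}}(u)=\frac{f(u)+f(-u)}2$ and $f_{\mathrm{odd}}(u)=\frac{f(u)-f(-u)}2$. The snapping out Brownian motion with parameter $\kappa$ is the Feller process on $\mathbb{G}$ with semigroup $$P^{\mathrm{snob}}_tf(u)=\mathbb{E}_u\Big[\tfrac{1+e^{-\kappa L(0,t)}}{2}f(\operatorname{sgn}(u)|B_t|)\Big]+\mathbb{E}_u\Big[\tfrac{1-e^{-\kappa L(0,t)}}{2}f(-\operatorname{sgn}(u)|B_t|)\Big],\qquad u\in\mathbb{G},$$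 where $(B_t)_{t\ge0}$ is a standard Brownian motion started from $u$ and $L(0,t)=\lim_{\varepsilon\searrow0}\frac1{2\varepsilon}\int_0^t\mathbf{1}_{(-\varepsilon,\varepsilon)}(B_s)\,ds$ is its local time at zero.
   Formalization: In both explicit formulas the denominators 2t of the factors (z−y+κt)/(2t) and (z+y−κt)/(2t) are replaced by t; as printed, the odd part is too small by a factor 1/2 (as t→0 the odd term would tend to f_odd(u)/2). *)

theory Defs
  imports "HOL-Probability.Probability"
begin

section \<open>Brownian motion and its local time at zero\<close>

locale brownian_motion = prob_space M for M :: "'w measure" +
  fixes B :: "real \<Rightarrow> 'w \<Rightarrow> real" and x :: real
  assumes random_variable: "\<And>t. 0 \<le> t \<Longrightarrow> B t \<in> borel_measurable M"
    and start: "AE \<omega> in M. B 0 \<omega> = x"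
    and continuous_paths: "\<And>\<omega>. \<omega> \<in> space M \<Longrightarrow> continuous_on {0..} (\<lambda>t. B t \<omega>)"
    and gaussian_increments: "\<And>s t. 0 \<le> s \<Longrightarrow> s < t \<Longrightarrow>
      distributed M lborel (\<lambda>\<omega>. B t \<omega> - B s \<omega>) (normal_density 0 (sqrt (t - s)))"
    and independent_increments: "\<And>(n::nat) \<tau> :: nat \<Rightarrow> real.
      0 \<le> \<tau> 0 \<Longrightarrow> (\<And>i. i < n \<Longrightarrow> \<tau> i < \<tau> (Suc i)) \<Longrightarrow>
      indep_vars (\<lambda>_. borel) (\<lambda>i \<omega>. B (\<tau> (Suc i)) \<omega> - B (\<tau> i) \<omega>) {..<n}"

text \<open>For Brownian motion the limit exists almost surely; on the exceptional null set the value
  is immaterial.\<close>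

definition local_time :: "(real \<Rightarrow> 'w \<Rightarrow> real) \<Rightarrow> real \<Rightarrow> 'w \<Rightarrow> real" where
  "local_time B t \<omega> =
     Lim (at_right 0)
       (\<lambda>\<epsilon>. 1 / (2 * \<epsilon>) * (LINT s:{0..t}|lborel. indicator {-\<epsilon><..<\<epsilon>} (B s \<omega>)))"


section \<open>The state space\<close>

text \<open>A point of the disjoint union of the two closed half-lines is a pair \<open>(s, u)\<close>; the tag
  \<open>s\<close> is the sign (\<open>True\<close> for the right half-line). Thus \<open>(True, 0)\<close> is \<open>0\<^sup>+\<close> and
  \<open>(False, 0)\<close> is \<open>0\<^sup>-\<close>. As \<open>bool\<close> carries the discrete topology, the topology inherited from
  \<open>bool \<times> real\<close> is that of the disjoint union.\<close>

definition GG :: "(bool \<times> real) set" where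
  "GG = {True} \<times> {0..} \<union> {False} \<times> {..0}"

text \<open>The point with the given sign and absolute value \<open>r \<ge> 0\<close>.\<close>

definition signed :: "bool \<Rightarrow> real \<Rightarrow> bool \<times> real" where
  "signed s r = (s, if s then r else - r)"

text \<open>The identification of the nonzero reals with the points of \<open>GG\<close> other than \<open>0\<^sup>+\<close> and
  \<open>0\<^sup>-\<close>. Its value at \<open>0\<close> is a convention which is irrelevant inside integrals.\<close>

definition of_nonzero :: "real \<Rightarrow> bool \<times> real" where
  "of_nonzero u = (0 < u, u)"

definition C0G :: "(bool \<times> real \<Rightarrow> real) set" where
  "C0G = {f. continuous_on GG f \<and> bounded (f ` GG) \<and>
     ((\<lambda>u. f (True, u)) \<longlongrightarrow> 0) at_top \<and> ((\<lambda>u. f (False, u)) \<longlongrightarrow> 0) at_bot}"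

text \<open>Reflection exchanges \<open>0\<^sup>+\<close> and \<open>0\<^sup>-\<close>.\<close>

definition reflect :: "bool \<times> real \<Rightarrow> bool \<times> real" where
  "reflect p = (\<not> fst p, - snd p)"

definition even_part :: "(bool \<times> real \<Rightarrow> real) \<Rightarrow> bool \<times> real \<Rightarrow> real" where
  "even_part f p = (f p + f (reflect p)) / 2"

definition odd_part :: "(bool \<times> real \<Rightarrow> real) \<Rightarrow> bool \<times> real \<Rightarrow> real" where
  "odd_part f p = (f p - f (reflect p)) / 2"


section \<open>The snapping out Brownian motion\<close>

text \<open>\<open>M x\<close> and \<open>B x\<close> are the probability space and the Brownian motion used for the
  expectation with starting point \<open>x\<close>. Started from \<open>0\<^sup>+\<close> or from \<open>0\<^sup>-\<close>, the Brownian motion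
  is the one started from \<open>0\<close>; the sign of the starting point enters only through \<open>fst p\<close>.\<close>

definition snob_semigroup ::
  "real \<Rightarrow> (real \<Rightarrow> 'w measure) \<Rightarrow> (real \<Rightarrow> real \<Rightarrow> 'w \<Rightarrow> real) \<Rightarrow>
   real \<Rightarrow> (bool \<times> real \<Rightarrow> real) \<Rightarrow> bool \<times> real \<Rightarrow> real" where
  "snob_semigroup \<kappa> M B t f p =
     (LINT \<omega>|M (snd p). (1 + exp (- \<kappa> * local_time (B (snd p)) t \<omega>)) / 2
         * f (signed (fst p) \<bar>B (snd p) t \<omega>\<bar>)) +
     (LINT \<omega>|M (snd p). (1 - exp (- \<kappa> * local_time (B (snd p)) t \<omega>)) / 2
         * f (signed (\<not> fst p) \<bar>B (snd p) t \<omega>\<bar>))"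

text \<open>Classical solutions which are continuous up to time \<open>0\<close> and bounded on bounded time
  intervals. The derivatives at \<open>0\<^sup>+\<close> and \<open>0\<^sup>-\<close> are one-sided derivatives along the respective
  half-line.\<close>

definition snob_solution ::
  "real \<Rightarrow> (bool \<times> real \<Rightarrow> real) \<Rightarrow> (real \<Rightarrow> bool \<times> real \<Rightarrow> real) \<Rightarrow> bool" where
  "snob_solution \<kappa> f \<rho> \<longleftrightarrow>
     continuous_on ({0..} \<times> GG) (\<lambda>(t, p). \<rho> t p) \<and>
     (\<forall>T\<ge>0. bounded ((\<lambda>(t, p). \<rho> t p) ` ({0..T} \<times> GG))) \<and>
     (\<forall>t>0. \<forall>s u. (s, u) \<in> GG \<and> u \<noteq> 0 \<longrightarrow>
        (\<lambda>v. \<rho> t (s, v)) differentiable (at u) \<and>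
        deriv (\<lambda>v. \<rho> t (s, v)) differentiable (at u) \<and>
        ((\<lambda>r. \<rho> r (s, u)) has_real_derivative
           1 / 2 * deriv (deriv (\<lambda>v. \<rho> t (s, v))) u) (at t)) \<and>
     (\<forall>t>0.
        ((\<lambda>v. \<rho> t (True, v)) has_real_derivative
           \<kappa> / 2 * (\<rho> t (True, 0) - \<rho> t (False, 0))) (at_right 0) \<and>
        ((\<lambda>v. \<rho> t (False, v)) has_real_derivative
           \<kappa> / 2 * (\<rho> t (True, 0) - \<rho> t (False, 0))) (at_left 0)) \<and>
     (\<forall>p\<in>GG. \<rho> 0 p = f p)"

end

theory Submission
  imports Defs
begin

text \<open>The heat flow preserves oddness, so \<open>\<kappa> v - v'\<close> vanishes at 0 for all
  times once \<open>\<kappa> G - G'\<close> is odd. Read as a linear differential equation for G on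
  the negative half-line, this condition produces the integral term of the extension. As h is merely
  continuous, \<open>G'\<close> need not exist, and the oddness enters only through an integration
  by parts against the kernel. On the probabilistic side only the Markov property at deterministic
  times is used, without stopping times or stochastic calculus. The local time is therefore reached
  through additive functionals with bounded densities, and the singularity of the Gaussian at time 0
  has to stay integrable in every estimate. The kernels of the explicit formula in the formal
  statement carry 1 / t, which is the factor produced by differentiating exp (- z^2 / (2 t)); with 1
  / (2 t) the odd contribution would be halved and the initial value missed.\<close>

text \<open>The even part of \<open>f\<close> evolves by the heat semigroup on the line and the odd part \<open>h\<close> by the
  heat equation on the half-line with the Robin condition \<open>\<partial>\<^sub>u v = \<kappa> v\<close> at \<open>0\<close>. The Robin problem is
  reduced to the line by extending \<open>h\<close> to a function \<open>G\<close> with \<open>\<kappa> G - G'\<close> odd; the explicit formula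
  is then the integrated form of \<open>\<kappa> v - v'\<close>. To identify the Robin solution with
  \<open>E (exp (- \<kappa> L) h \<bar>B\<^sub>t\<bar>)\<close>, the local time \<open>L\<close> is approximated by occupation functionals of narrow
  bumps. These converge almost surely along a sequence by an \<open>L\<^sup>2\<close> estimate for the Gaussian kernel,
  and for a bump the killed expectation satisfies a Duhamel equation, which is compared with the
  Duhamel equation of the Robin solution; the latter follows from the decomposition of the heat
  kernel at the last visit to \<open>0\<close>. Uniqueness is a maximum principle.\<close>

section \<open>The heat semigroup on the line\<close>

text \<open>In a first countable space limits are tested along sequences, and for these the claim is
  dominated convergence.\<close>

lemma tendsto_lebesgue_integral:
  fixes f :: "'a::first_countable_topology \<Rightarrow> 'b \<Rightarrow> real"
  assumes meas: "\<And>t. t \<in> S \<Longrightarrow> f t \<in> borel_measurable M" "g \<in> borel_measurable M"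
    and w: "integrable M w"
    and bound: "\<And>t y. t \<in> S \<Longrightarrow> y \<in> space M \<Longrightarrow> \<bar>f t y\<bar> \<le> w y"
    and lim: "AE y in M. ((\<lambda>t. f t y) \<longlongrightarrow> g y) (at x within S)"
  shows "((\<lambda>t. \<integral>y. f t y \<partial>M) \<longlongrightarrow> (\<integral>y. g y \<partial>M)) (at x within S)"
  unfolding tendsto_at_iff_sequentially comp_def
proof (intro allI impI)
  fix X assume X: "\<forall>i. X i \<in> S - {x}" "X \<longlonglongrightarrow> x"
  show "(\<lambda>i. \<integral>y. f (X i) y \<partial>M) \<longlonglongrightarrow> (\<integral>y. g y \<partial>M)"
  proof (rule integral_dominated_convergence[where w = w])
    show "AE y in M. (\<lambda>i. f (X i) y) \<longlonglongrightarrow> g y"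
      using lim
    proof eventually_elim
      fix y assume "((\<lambda>t. f t y) \<longlongrightarrow> g y) (at x within S)"
      then show "(\<lambda>i. f (X i) y) \<longlonglongrightarrow> g y"
        using X unfolding tendsto_at_iff_sequentially comp_def by blast
    qed
    show "\<And>i. f (X i) \<in> borel_measurable M" using meas X by blast
    show "\<And>i. AE y in M. norm (f (X i) y) \<le> w y" using bound X by (intro AE_I2) auto
  qed (use meas w in auto)
qed

lemma continuous_on_lebesgue_integral:
  fixes f :: "'a::first_countable_topology \<Rightarrow> 'b \<Rightarrow> real"
  assumes meas: "\<And>t. t \<in> S \<Longrightarrow> f t \<in> borel_measurable M"
    and w: "integrable M w"
    and bound: "\<And>t y. t \<in> S \<Longrightarrow> y \<in> space M \<Longrightarrow> \<bar>f t y\<bar> \<le> w y"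
    and cont: "AE y in M. continuous_on S (\<lambda>t. f t y)"
  shows "continuous_on S (\<lambda>t. \<integral>y. f t y \<partial>M)"
  unfolding continuous_on
proof
  fix x assume x: "x \<in> S"
  show "((\<lambda>t. \<integral>y. f t y \<partial>M) \<longlongrightarrow> (\<integral>y. f x y \<partial>M)) (at x within S)"
  proof (rule tendsto_lebesgue_integral[OF meas meas[OF x] w bound])
    show "AE y in M. ((\<lambda>t. f t y) \<longlongrightarrow> f x y) (at x within S)"
      using cont by eventually_elim (use x in \<open>auto simp: continuous_on\<close>)
  qed auto
qed

text \<open>By the mean value inequality w also dominates the difference quotients, so the limit
  passes under the integral.\<close>

lemma has_real_derivative_lebesgue_integral:
  fixes f f' :: "real \<Rightarrow> 'b \<Rightarrow> real"
  assumes r: "r > 0"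
    and int: "\<And>x. \<bar>x - x0\<bar> < r \<Longrightarrow> integrable M (f x)"
    and meas: "f' x0 \<in> borel_measurable M"
    and w: "integrable M w"
    and bound: "\<And>x y. \<bar>x - x0\<bar> < r \<Longrightarrow> \<bar>f' x y\<bar> \<le> w y"
    and deriv: "\<And>x y. \<bar>x - x0\<bar> < r \<Longrightarrow> ((\<lambda>x. f x y) has_real_derivative f' x y) (at x)"
  shows "((\<lambda>x. \<integral>y. f x y \<partial>M) has_real_derivative (\<integral>y. f' x0 y \<partial>M)) (at x0)"
proof -
  have "((\<lambda>x. \<integral>y. (f x y - f x0 y) / (x - x0) \<partial>M) \<longlongrightarrow> (\<integral>y. f' x0 y \<partial>M))
          (at x0 within {x. \<bar>x - x0\<bar> < r} - {x0})"
  proof (rule tendsto_lebesgue_integral[OF _ meas w])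
    fix x y assume x: "x \<in> {x. \<bar>x - x0\<bar> < r} - {x0}"
    show "(\<lambda>y. (f x y - f x0 y) / (x - x0)) \<in> borel_measurable M"
      using int[of x] int[of x0] x r by auto
    have "\<bar>f x y - f x0 y\<bar> \<le> w y * \<bar>x - x0\<bar>"
      using field_differentiable_bound[of "{x0 - r<..<x0 + r}" "\<lambda>x. f x y" "\<lambda>x. f' x y" "w y" x x0]
        deriv bound x r
      by (auto simp: abs_less_iff has_field_derivative_at_within)
    then show "\<bar>(f x y - f x0 y) / (x - x0)\<bar> \<le> w y"
      using x by (simp add: field_simps)
  next
    show "AE y in M. ((\<lambda>x. (f x y - f x0 y) / (x - x0)) \<longlongrightarrow> f' x0 y)
            (at x0 within {x. \<bar>x - x0\<bar> < r} - {x0})"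
      using deriv[of x0] r
      by (intro AE_I2) (auto simp: has_field_derivative_iff intro: tendsto_within_subset)
  qed
  moreover have "at x0 within {x. \<bar>x - x0\<bar> < r} - {x0} = at x0"
  proof -
    have "open {x. \<bar>x - x0\<bar> < r}"
      using open_ball[of x0 r] by (simp add: ball_def dist_real_def abs_minus_commute)
    then show ?thesis
    proof -
      assume "open {x. \<bar>x - x0\<bar> < r}"
      then have "at x0 within {x. \<bar>x - x0\<bar> < r} = at x0" using r by (intro at_within_open) auto
      then show ?thesis unfolding at_within_def by simp
    qed
  qed
  moreover have "\<forall>\<^sub>F x in at x0. (\<integral>y. (f x y - f x0 y) / (x - x0) \<partial>M) =
      ((\<integral>y. f x y \<partial>M) - (\<integral>y. f x0 y \<partial>M)) / (x - x0)"
    unfolding eventually_at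
    using r int[of x0] by (intro exI[of _ r]) (auto simp: dist_real_def int)
  ultimately show ?thesis
    unfolding has_field_derivative_iff by (simp only: tendsto_cong)
qed

definition gauss :: "real \<Rightarrow> real \<Rightarrow> real" where
  "gauss t z = exp (- z\<^sup>2 / (2 * t)) / sqrt (2 * pi * t)"

lemma gauss_eq_normal_density: "t > 0 \<Longrightarrow> gauss t (y - x) = normal_density x (sqrt t) y"
  by (simp add: gauss_def normal_density_def)

lemma gauss_minus [simp]: "gauss t (- z) = gauss t z"
  by (simp add: gauss_def)

lemma gauss_commute: "gauss t (x - y) = gauss t (y - x)"
  by (metis gauss_minus minus_diff_eq)

lemma gauss_nonneg [simp]: "t \<ge> 0 \<Longrightarrow> gauss t z \<ge> 0"
  by (simp add: gauss_def)

lemma gauss_measurable [measurable]: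
  assumes [measurable]: "f \<in> borel_measurable M" "g \<in> borel_measurable M"
  shows "(\<lambda>x. gauss (f x) (g x)) \<in> borel_measurable M"
  unfolding gauss_def by measurable

lemma gauss_le: "t > 0 \<Longrightarrow> gauss t z \<le> 1 / sqrt t"
proof -
  assume t: "t > 0"
  have "exp (- z\<^sup>2 / (2 * t)) \<le> 1" using t by simp
  moreover have "sqrt t \<le> sqrt (2 * pi * t)"
    using t pi_ge_two by (intro real_sqrt_le_mono) (simp add: mult_le_cancel_right1)
  ultimately show ?thesis
    unfolding gauss_def using t by (intro frac_le) auto
qed

lemma integrable_gauss: "t > 0 \<Longrightarrow> integrable lborel (\<lambda>y. gauss t (x - y))"
  by (simp add: gauss_eq_normal_density gauss_commute[of t x] cong: Bochner_Integration.integrable_cong)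

lemma integral_gauss: "t > 0 \<Longrightarrow> (\<integral>y. gauss t (x - y) \<partial>lborel) = 1"
  by (simp add: gauss_eq_normal_density gauss_commute[of t x] cong: Bochner_Integration.integral_cong)

lemma integrable_bounded_mult:
  fixes f g :: "'a \<Rightarrow> real"
  assumes "integrable M g" "f \<in> borel_measurable M" "\<And>y. y \<in> space M \<Longrightarrow> \<bar>f y\<bar> \<le> C"
  shows "integrable M (\<lambda>y. f y * g y)"
proof (rule Bochner_Integration.integrable_bound[of M "\<lambda>y. C * \<bar>g y\<bar>"])
  show "AE y in M. norm (f y * g y) \<le> norm (C * \<bar>g y\<bar>)"
  proof (intro AE_I2)
    fix y assume "y \<in> space M"
    then have "\<bar>f y\<bar> \<le> \<bar>C\<bar>" using assms(3) by fastforce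
    then show "norm (f y * g y) \<le> norm (C * \<bar>g y\<bar>)" by (simp add: abs_mult mult_right_mono)
  qed
qed (use assms in auto)

text \<open>The scaling form makes sense at time \<open>0\<close>, so that continuity up to the initial time is
  plain dominated convergence.\<close>

definition heat :: "real \<Rightarrow> (real \<Rightarrow> real) \<Rightarrow> real \<Rightarrow> real" where
  "heat t F x = (\<integral>y. F (x + sqrt t * y) * std_normal_density y \<partial>lborel)"

lemma heat_0 [simp]: "heat 0 F x = F x"
  by (simp add: heat_def)

lemma heat_eq_gauss:
  assumes "t > 0"
  shows "heat t F x = (\<integral>y. F y * gauss t (x - y) \<partial>lborel)"
proof -
  have "(\<integral>y. F y * gauss t (x - y) \<partial>lborel) =
      (\<integral>y. sqrt t * (F (x + sqrt t * y) * gauss t (x - (x + sqrt t * y))) \<partial>lborel)"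
    using assms lborel_integral_real_affine[of "sqrt t" "\<lambda>y. F y * gauss t (x - y)" x] by simp
  also have "\<dots> = heat t F x"
    unfolding heat_def
    using assms
    by (intro Bochner_Integration.integral_cong)
       (auto simp: gauss_def std_normal_density_def power_mult_distrib real_sqrt_mult)
  finally show ?thesis ..
qed

lemma heat_integrable:
  assumes "t > 0" "F \<in> borel_measurable borel" "\<And>y. \<bar>F y\<bar> \<le> C"
  shows "integrable lborel (\<lambda>y. F y * gauss t (x - y))"
  using integrable_gauss[of t x] assms by (intro integrable_bounded_mult[where C = C]) auto

lemma heat_bound:
  assumes "F \<in> borel_measurable borel" "\<And>y. \<bar>F y\<bar> \<le> C"
  shows "\<bar>heat t F x\<bar> \<le> C"
proof -
  have "integrable lborel (\<lambda>y. F (x + sqrt t * y) * std_normal_density y)"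
    using assms by (intro integrable_bounded_mult[where C = C]) auto
  then have "\<bar>heat t F x\<bar> \<le> (\<integral>y. C * std_normal_density y \<partial>lborel)"
    unfolding heat_def
    by (rule order_trans[OF integral_abs_bound integral_mono, OF integrable_abs])
       (auto simp: abs_mult assms intro!: mult_right_mono)
  then show ?thesis by simp
qed

lemma heat_measurable [measurable]:
  assumes [measurable]: "F \<in> borel_measurable borel" "f \<in> borel_measurable M" "g \<in> borel_measurable M"
  shows "(\<lambda>x. heat (f x) F (g x)) \<in> borel_measurable M"
  unfolding heat_def by measurable

lemma heat_continuous:
  assumes F: "continuous_on UNIV F" and bound: "\<And>y. \<bar>F y\<bar> \<le> C"
  shows "continuous_on UNIV (\<lambda>(t, x). heat t F x)"
  unfolding heat_def case_prod_beta
proof (rule continuous_on_lebesgue_integral[where w = "\<lambda>y. C * std_normal_density y"])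
  have [measurable]: "F \<in> borel_measurable borel"
    using F by (rule borel_measurable_continuous_onI)
  show "(\<lambda>y. F (snd t + sqrt (fst t) * y) * std_normal_density y) \<in> borel_measurable lborel" for t
    by measurable
  show "AE y in lborel. continuous_on UNIV (\<lambda>t. F (snd t + sqrt (fst t) * y) * std_normal_density y)"
    by (intro AE_I2 continuous_intros continuous_on_compose2[OF F]) auto
qed (auto simp: abs_mult bound intro!: mult_right_mono)

lemma heat_tendsto_0:
  assumes F: "continuous_on UNIV F" and bound: "\<And>y. \<bar>F y\<bar> \<le> C"
    and lim: "(F \<longlongrightarrow> 0) at_top"
  shows "(heat t F \<longlongrightarrow> 0) at_top"
proof -
  have [measurable]: "F \<in> borel_measurable borel"
    using F by (rule borel_measurable_continuous_onI)
  have "(\<lambda>n. \<integral>y. F (X n + sqrt t * y) * std_normal_density y \<partial>lborel) \<longlonglongrightarrow> (\<integral>y. 0 \<partial>(lborel :: real measure))"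
    if X: "filterlim X at_top sequentially" for X :: "nat \<Rightarrow> real"
  proof (rule integral_dominated_convergence[where w = "\<lambda>y. C * std_normal_density y"])
    show "AE y in lborel. (\<lambda>n. F (X n + sqrt t * y) * std_normal_density y) \<longlonglongrightarrow> 0"
    proof (intro AE_I2)
      fix y :: real
      have "filterlim (\<lambda>n. sqrt t * y + X n) at_top sequentially"
        by (rule filterlim_tendsto_add_at_top[OF tendsto_const X])
      from filterlim_compose[OF lim this]
      show "(\<lambda>n. F (X n + sqrt t * y) * std_normal_density y) \<longlonglongrightarrow> 0"
        by (intro tendsto_mult_left_zero) (simp add: add.commute)
    qed
    show "AE y in lborel. norm (F (X n + sqrt t * y) * std_normal_density y) \<le> C * std_normal_density y" for n
      by (auto simp: abs_mult bound intro!: mult_right_mono)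
  qed auto
  then show ?thesis unfolding heat_def[abs_def] by (intro tendsto_at_topI_sequentially) simp
qed

section \<open>Smoothness of the heat semigroup for positive times\<close>

text \<open>Unnormalised moments: differentiation in x or t only shifts the order j, so all
  derivatives of the heat semigroup are combinations of these integrals.\<close>

definition heat_moment :: "real \<Rightarrow> (real \<Rightarrow> real) \<Rightarrow> nat \<Rightarrow> real \<Rightarrow> real" where
  "heat_moment t F j x = (\<integral>y. F y * ((x - y) ^ j * exp (- (x - y)\<^sup>2 / (2 * t))) \<partial>lborel)"

text \<open>One integrable envelope for all t <= T and all x near x0, as needed for domination. Half
  of the exponent is given up to absorb the power (2 T becomes 4 T), and another half to move the
  centre from x to x0 (4 T becomes 8 T).\<close>

lemma power_gaussian_envelope:
  fixes T x0 :: real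
  assumes T: "T > 0"
  shows "\<exists>C>0. \<forall>t x y. 0 < t \<longrightarrow> t \<le> T \<longrightarrow> \<bar>x - x0\<bar> \<le> 1 \<longrightarrow>
     \<bar>(x - y) ^ j * exp (- (x - y)\<^sup>2 / (2 * t))\<bar> \<le> C * exp (- (x0 - y)\<^sup>2 / (8 * T))"
proof -
  define c where "c = 1 + (4 * T) ^ j * (1 + real j ^ j)"
  have c: "c > 0" unfolding c_def using T by (intro add_pos_nonneg) auto
  have pow: "a ^ j \<le> (1 + real j ^ j) * exp a" if "a \<ge> 0" for a :: real
  proof (cases "j = 0")
    case False
    have "a / j \<le> exp (a / j)" using exp_ge_add_one_self[of "a / j"] by linarith
    then have "(a / j) ^ j \<le> exp (a / j) ^ j"
      using that by (intro power_mono) auto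
    also have "\<dots> = exp a" using False by (simp flip: exp_of_nat_mult)
    finally have "a ^ j \<le> real j ^ j * exp a" using False by (simp add: field_simps power_divide)
    then show ?thesis by (simp add: distrib_right add_increasing)
  next
    case True
    have "1 \<le> 2 * exp a" using exp_ge_add_one_self[of a] that by linarith
    then show ?thesis using True by simp
  qed
  have main: "\<bar>z ^ j * exp (- z\<^sup>2 / (2 * t))\<bar> \<le> c * exp (- z\<^sup>2 / (4 * T))" if t: "0 < t" "t \<le> T" for z t
  proof -
    define a where "a = z\<^sup>2 / (4 * T)"
    have a: "a \<ge> 0" using T by (simp add: a_def)
    have "\<bar>z\<bar> ^ j \<le> 1 + (\<bar>z\<bar> ^ j)\<^sup>2"
      using zero_le_power2[of "\<bar>z\<bar> ^ j - 1/2"] by (simp add: power2_eq_square algebra_simps)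
    also have "(\<bar>z\<bar> ^ j)\<^sup>2 = (4 * T) ^ j * a ^ j"
    proof -
      have "(\<bar>z\<bar> ^ j)\<^sup>2 = (z\<^sup>2) ^ j" by (metis power2_abs power_mult mult.commute)
      also have "z\<^sup>2 = 4 * T * a" using T by (simp add: a_def)
      finally show ?thesis by (simp only: power_mult_distrib)
    qed
    also have "1 + (4 * T) ^ j * a ^ j \<le> exp a + (4 * T) ^ j * ((1 + real j ^ j) * exp a)"
      using pow[OF a] a T by (intro add_mono mult_left_mono) auto
    finally have 1: "\<bar>z\<bar> ^ j \<le> c * exp a" by (simp add: c_def algebra_simps)
    have "- z\<^sup>2 / (2 * t) \<le> - z\<^sup>2 / (2 * T)"
      using t by (simp add: divide_left_mono)
    also have "\<dots> = - 2 * a" using T by (simp add: a_def field_simps)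
    finally have 2: "exp (- z\<^sup>2 / (2 * t)) \<le> exp (- 2 * a)" by simp
    have "\<bar>z ^ j * exp (- z\<^sup>2 / (2 * t))\<bar> \<le> (c * exp a) * exp (- 2 * a)"
      unfolding abs_mult power_abs abs_exp_cancel using 1 2 c by (intro mult_mono) auto
    also have "\<dots> = c * exp (- a)" by (simp flip: exp_add)
    finally show ?thesis by (simp add: a_def)
  qed
  have "\<bar>(x - y) ^ j * exp (- (x - y)\<^sup>2 / (2 * t))\<bar> \<le> (c * exp (1 / (4 * T))) * exp (- (x0 - y)\<^sup>2 / (8 * T))"
    if t: "0 < t" "t \<le> T" and x: "\<bar>x - x0\<bar> \<le> 1" for t x y
  proof -
    have "(x0 - y)\<^sup>2 \<le> 2 * (x - y)\<^sup>2 + 2 * (x - x0)\<^sup>2"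
      using zero_le_power2[of "(x - y) + (x - x0)"] by (simp add: power2_eq_square algebra_simps)
    moreover have "(x - x0)\<^sup>2 \<le> 1" using x by (simp add: abs_square_le_1)
    ultimately have "(x0 - y)\<^sup>2 / 2 - 1 \<le> (x - y)\<^sup>2" by simp
    then have "- (x - y)\<^sup>2 / (4 * T) \<le> (1 - (x0 - y)\<^sup>2 / 2) / (4 * T)"
      using T by (intro divide_right_mono) auto
    also have "\<dots> = 1 / (4 * T) + - (x0 - y)\<^sup>2 / (8 * T)" using T by (simp add: field_simps)
    finally have "exp (- (x - y)\<^sup>2 / (4 * T)) \<le> exp (1 / (4 * T)) * exp (- (x0 - y)\<^sup>2 / (8 * T))"
      by (simp flip: exp_add)
    then show ?thesis using main[OF t, of "x - y"] c
      by (smt (verit, best) mult.assoc mult_left_mono)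
  qed
  then show ?thesis using c by (intro exI[of _ "c * exp (1 / (4 * T))"]) auto
qed

lemma integrable_gaussian: "a > 0 \<Longrightarrow> integrable lborel (\<lambda>y::real. exp (- (x - y)\<^sup>2 / a))"
proof -
  assume a: "a > 0"
  have "integrable lborel (\<lambda>y. sqrt (2 * pi * (a / 2)) * gauss (a / 2) (x - y))"
    using integrable_gauss[of "a / 2" x] a by (intro integrable_mult_right) auto
  then show ?thesis
    using a by (simp add: gauss_def)
qed

context
  fixes F :: "real \<Rightarrow> real" and C :: real
  assumes F [measurable]: "F \<in> borel_measurable borel" and bound: "\<And>y. \<bar>F y\<bar> \<le> C"
begin

lemma heat_moment_integrable:
  assumes t: "t > 0"
  shows "integrable lborel (\<lambda>y. F y * ((x - y) ^ j * exp (- (x - y)\<^sup>2 / (2 * t))))"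
proof (rule integrable_bounded_mult[OF _ _ bound])
  obtain K where K: "\<And>y. \<bar>(x - y) ^ j * exp (- (x - y)\<^sup>2 / (2 * t))\<bar> \<le> K * exp (- (x - y)\<^sup>2 / (8 * t))"
  proof -
    obtain K where K: "\<forall>s x' y. 0 < s \<longrightarrow> s \<le> t \<longrightarrow> \<bar>x' - x\<bar> \<le> 1 \<longrightarrow>
       \<bar>(x' - y) ^ j * exp (- (x' - y)\<^sup>2 / (2 * s))\<bar> \<le> K * exp (- (x - y)\<^sup>2 / (8 * t))"
      using power_gaussian_envelope[OF t, of x j] by blast
    have "\<bar>(x - y) ^ j * exp (- (x - y)\<^sup>2 / (2 * t))\<bar> \<le> K * exp (- (x - y)\<^sup>2 / (8 * t))" for y
      using K[rule_format, of t x y] t by simp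
    then show thesis by (rule that)
  qed
  show "integrable lborel (\<lambda>y. (x - y) ^ j * exp (- (x - y)\<^sup>2 / (2 * t)))"
  proof (rule Bochner_Integration.integrable_bound)
    show "integrable lborel (\<lambda>y. K * exp (- (x - y)\<^sup>2 / (8 * t)))"
      using t by (intro integrable_mult_right integrable_gaussian) auto
    show "AE y in lborel. norm ((x - y) ^ j * exp (- (x - y)\<^sup>2 / (2 * t)))
        \<le> norm (K * exp (- (x - y)\<^sup>2 / (8 * t)))"
      using K by (intro AE_I2) (smt (verit) real_norm_def)
  qed simp
qed simp

text \<open>The power contributes order j - 1 and the exponential order j + 1. For j = 0 the
  truncated index j - 1 is harmless, as its term is multiplied by 0.\<close>

lemma DERIV_heat_moment_x:
  assumes t: "t > 0"
  shows "(heat_moment t F j has_real_derivative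
     real j * heat_moment t F (j - 1) x0 - heat_moment t F (Suc j) x0 / t) (at x0)"
proof -
  let ?e = "\<lambda>j x y. (x - y) ^ j * exp (- (x - y)\<^sup>2 / (2 * t))"
  obtain K where K: "\<And>x y. \<bar>x - x0\<bar> \<le> 1 \<Longrightarrow> \<bar>?e (j - 1) x y\<bar> \<le> K * exp (- (x0 - y)\<^sup>2 / (8 * t))"
    using power_gaussian_envelope[OF t, of x0 "j - 1"] t by fastforce
  obtain L where L: "\<And>x y. \<bar>x - x0\<bar> \<le> 1 \<Longrightarrow> \<bar>?e (Suc j) x y\<bar> \<le> L * exp (- (x0 - y)\<^sup>2 / (8 * t))"
    using power_gaussian_envelope[OF t, of x0 "Suc j"] t by fastforce
  have C: "C \<ge> 0" using bound[of 0] by simp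
  have "((\<lambda>x. \<integral>y. F y * ?e j x y \<partial>lborel) has_real_derivative
      (\<integral>y. F y * (real j * ?e (j - 1) x0 y - ?e (Suc j) x0 y / t) \<partial>lborel)) (at x0)"
  proof (rule has_real_derivative_lebesgue_integral[where r = 1 and
        w = "\<lambda>y. C * ((real j * K + L / t) * exp (- (x0 - y)\<^sup>2 / (8 * t)))"])
    fix x y :: real assume x: "\<bar>x - x0\<bar> < 1"
    show "integrable lborel (\<lambda>y. F y * ?e j x y)" by (rule heat_moment_integrable[OF t])
    show "((\<lambda>x. F y * ?e j x y) has_real_derivative
        F y * (real j * ?e (j - 1) x y - ?e (Suc j) x y / t)) (at x)"
      using t by (auto intro!: derivative_eq_intros simp: field_simps power2_eq_square)
    have "\<bar>real j * ?e (j - 1) x y - ?e (Suc j) x y / t\<bar> \<le> real j * \<bar>?e (j - 1) x y\<bar> + \<bar>?e (Suc j) x y\<bar> / t"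
      using t abs_triangle_ineq4[of "real j * ?e (j - 1) x y" "?e (Suc j) x y / t"]
      by (simp only: abs_mult abs_divide) simp
    also have "\<dots> \<le> real j * (K * exp (- (x0 - y)\<^sup>2 / (8 * t))) + (L * exp (- (x0 - y)\<^sup>2 / (8 * t))) / t"
      using t x by (intro add_mono mult_left_mono divide_right_mono K L) auto
    also have "\<dots> = (real j * K + L / t) * exp (- (x0 - y)\<^sup>2 / (8 * t))" by (simp add: algebra_simps)
    finally show "\<bar>F y * (real j * ?e (j - 1) x y - ?e (Suc j) x y / t)\<bar> \<le>
        C * ((real j * K + L / t) * exp (- (x0 - y)\<^sup>2 / (8 * t)))"
      unfolding abs_mult[of "F y"] using bound[of y] C by (intro mult_mono) auto
  next
    show "integrable lborel (\<lambda>y. C * ((real j * K + L / t) * exp (- (x0 - y)\<^sup>2 / (8 * t))))"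
      using t by (intro integrable_mult_right integrable_gaussian) auto
  qed auto
  also have "(\<lambda>x. \<integral>y. F y * ?e j x y \<partial>lborel) = heat_moment t F j"
    by (simp add: heat_moment_def[abs_def])
  also have "(\<integral>y. F y * (real j * ?e (j - 1) x0 y - ?e (Suc j) x0 y / t) \<partial>lborel) =
     (\<integral>y. real j * (F y * ?e (j - 1) x0 y) - F y * ?e (Suc j) x0 y / t \<partial>lborel)"
    by (simp add: algebra_simps)
  also have "\<dots> = real j * heat_moment t F (j - 1) x0 - heat_moment t F (Suc j) x0 / t"
    unfolding heat_moment_def
    using Bochner_Integration.integral_diff[OF
      integrable_mult_right[OF heat_moment_integrable[OF t, of x0 "j - 1"], of "real j"]
      integrable_divide[OF heat_moment_integrable[OF t, of x0 "Suc j"], of t]]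
    by (simp only: integral_mult_right_zero integral_divide_zero)
  finally show ?thesis .
qed

lemma DERIV_heat_moment_t:
  assumes t0: "t0 > 0"
  shows "((\<lambda>t. heat_moment t F j x) has_real_derivative
     heat_moment t0 F (j + 2) x / (2 * t0\<^sup>2)) (at t0)"
proof -
  let ?e = "\<lambda>j t y. (x - y) ^ j * exp (- (x - y)\<^sup>2 / (2 * t))"
  obtain K where K: "\<And>t y. 0 < t \<Longrightarrow> t \<le> 2 * t0 \<Longrightarrow> \<bar>?e (j + 2) t y\<bar> \<le> K * exp (- (x - y)\<^sup>2 / (16 * t0))"
  proof -
    obtain K where K: "\<forall>s x' y. 0 < s \<longrightarrow> s \<le> 2 * t0 \<longrightarrow> \<bar>x' - x\<bar> \<le> 1 \<longrightarrow>
       \<bar>(x' - y) ^ (j + 2) * exp (- (x' - y)\<^sup>2 / (2 * s))\<bar> \<le> K * exp (- (x - y)\<^sup>2 / (8 * (2 * t0)))"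
      using power_gaussian_envelope[of "2 * t0" x "j + 2"] t0 by auto
    have "\<bar>?e (j + 2) s y\<bar> \<le> K * exp (- (x - y)\<^sup>2 / (16 * t0))" if "0 < s" "s \<le> 2 * t0" for s y
      using K[rule_format, of s x y] that by simp
    then show thesis by (rule that)
  qed
  have C: "C \<ge> 0" using bound[of 0] by simp
  have "((\<lambda>t. \<integral>y. F y * ?e j t y \<partial>lborel) has_real_derivative
      (\<integral>y. F y * (?e (j + 2) t0 y / (2 * t0\<^sup>2)) \<partial>lborel)) (at t0)"
  \<comment> \<open>With radius t0 / 2 the time stays between t0 / 2 and 2 * t0: the factor 1 / t^2
    is bounded and one envelope serves.\<close>
  proof (rule has_real_derivative_lebesgue_integral[where r = "t0 / 2" and
        w = "\<lambda>y. C * (K * exp (- (x - y)\<^sup>2 / (16 * t0)) / (2 * (t0 / 2)\<^sup>2))"])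
    fix t y :: real assume t: "\<bar>t - t0\<bar> < t0 / 2"
    then have tb: "t0 / 2 \<le> t" "0 < t" "t \<le> 2 * t0" using t0 by linarith+
    show "integrable lborel (\<lambda>y. F y * ?e j t y)" by (rule heat_moment_integrable[OF tb(2)])
    show "((\<lambda>t. F y * ?e j t y) has_real_derivative F y * (?e (j + 2) t y / (2 * t\<^sup>2))) (at t)"
      using tb by (auto intro!: derivative_eq_intros simp: field_simps power2_eq_square)
    have "(t0 / 2)\<^sup>2 \<le> t\<^sup>2" using tb t0 by (intro power_mono) auto
    then have "\<bar>?e (j + 2) t y\<bar> / (2 * t\<^sup>2) \<le> K * exp (- (x - y)\<^sup>2 / (16 * t0)) / (2 * (t0 / 2)\<^sup>2)"
      using tb t0 order_trans[OF abs_ge_zero K[OF tb(2,3)]] by (intro frac_le K) auto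
    then have "\<bar>?e (j + 2) t y / (2 * t\<^sup>2)\<bar> \<le> K * exp (- (x - y)\<^sup>2 / (16 * t0)) / (2 * (t0 / 2)\<^sup>2)"
      by (simp only: abs_divide) simp
    then show "\<bar>F y * (?e (j + 2) t y / (2 * t\<^sup>2))\<bar> \<le>
        C * (K * exp (- (x - y)\<^sup>2 / (16 * t0)) / (2 * (t0 / 2)\<^sup>2))"
      unfolding abs_mult[of "F y"] using bound[of y] C by (intro mult_mono) auto
  next
    show "integrable lborel (\<lambda>y. C * (K * exp (- (x - y)\<^sup>2 / (16 * t0)) / (2 * (t0 / 2)\<^sup>2)))"
      using t0 by (intro integrable_mult_right integrable_divide integrable_gaussian) auto
  qed (use t0 in auto)
  also have "(\<integral>y. F y * (?e (j + 2) t0 y / (2 * t0\<^sup>2)) \<partial>lborel) = heat_moment t0 F (j + 2) x / (2 * t0\<^sup>2)"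
    unfolding heat_moment_def by simp
  finally show ?thesis by (simp add: heat_moment_def)
qed

lemma heat_eq_moment: "t > 0 \<Longrightarrow> heat t F x = heat_moment t F 0 x / sqrt (2 * pi * t)"
  by (simp add: heat_eq_gauss heat_moment_def gauss_def)

lemma DERIV_heat_x:
  assumes t: "t > 0"
  shows "(heat t F has_real_derivative (- heat_moment t F 1 x / (t * sqrt (2 * pi * t)))) (at x)"
proof -
  have "((\<lambda>x. heat_moment t F 0 x / sqrt (2 * pi * t)) has_real_derivative
      (- heat_moment t F 1 x / t) / sqrt (2 * pi * t)) (at x)"
    using DERIV_heat_moment_x[OF t, of 0 x] by (intro DERIV_cdivide) simp
  moreover have "heat t F = (\<lambda>x. heat_moment t F 0 x / sqrt (2 * pi * t))"
    using heat_eq_moment[OF t] by auto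
  ultimately show ?thesis by simp
qed

lemma DERIV_heat_xx:
  assumes t: "t > 0"
  shows "((\<lambda>x. - heat_moment t F 1 x / (t * sqrt (2 * pi * t))) has_real_derivative
    (heat_moment t F 2 x / t - heat_moment t F 0 x) / (t * sqrt (2 * pi * t))) (at x)"
proof -
  have "((\<lambda>x. (- heat_moment t F 1 x) / (t * sqrt (2 * pi * t))) has_real_derivative
      (- (heat_moment t F 0 x - heat_moment t F 2 x / t)) / (t * sqrt (2 * pi * t))) (at x)"
    using DERIV_heat_moment_x[OF t, of 1 x]
    by (intro DERIV_cdivide DERIV_minus) (simp add: numeral_2_eq_2)
  then show ?thesis by simp
qed

text \<open>The value is written as one half of the one in \<open>DERIV_heat_xx\<close>, so that the
  heat equation can be read off.\<close>

lemma DERIV_heat_t: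
  assumes t: "t > 0"
  shows "((\<lambda>t. heat t F x) has_real_derivative
    1 / 2 * ((heat_moment t F 2 x / t - heat_moment t F 0 x) / (t * sqrt (2 * pi * t)))) (at t)"
proof -
  have "((\<lambda>t. heat_moment t F 0 x / sqrt (2 * pi * t)) has_real_derivative
     ((heat_moment t F (0 + 2) x / (2 * t\<^sup>2)) * sqrt (2 * pi * t)
       - heat_moment t F 0 x * ((2 * pi) * (inverse (sqrt (2 * pi * t)) / 2))) / (sqrt (2 * pi * t) * sqrt (2 * pi * t)))
     (at t)"
    using t by (intro DERIV_divide DERIV_heat_moment_t)
      (auto intro!: derivative_eq_intros simp: mult_less_0_iff)
  moreover have "((heat_moment t F (0 + 2) x / (2 * t\<^sup>2)) * sqrt (2 * pi * t)
       - heat_moment t F 0 x * ((2 * pi) * (inverse (sqrt (2 * pi * t)) / 2))) / (sqrt (2 * pi * t) * sqrt (2 * pi * t))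
     = 1 / 2 * ((heat_moment t F 2 x / t - heat_moment t F 0 x) / (t * sqrt (2 * pi * t)))"
  proof -
    \<comment> \<open>Replacing 2 * pi by q^2 / t makes the identity rational in q and t.\<close>
    define q where "q = sqrt (2 * pi * t)"
    have q: "q > 0" "2 * pi = q * q / t" using t by (auto simp: q_def)
    show ?thesis unfolding q_def[symmetric] using t q(1)
      by (simp add: q(2)) (simp add: field_simps power2_eq_square, simp only: numeral_2_eq_2)
  qed
  moreover have "\<forall>\<^sub>F s in nhds t. heat s F x = heat_moment s F 0 x / sqrt (2 * pi * s)"
    using eventually_nhds_in_open[of "{0<..}" t] t by (auto elim!: eventually_mono simp: heat_eq_moment)
  ultimately show ?thesis by (subst DERIV_cong_ev[OF refl _ refl]) auto
qed

end

section \<open>The Robin problem on the half-line\<close>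

lemma set_integrable_Ici_iff_Ioi:
  fixes f :: "real \<Rightarrow> real"
  shows "set_integrable lborel {a..} f \<longleftrightarrow> set_integrable lborel {a<..} f"
  by (rule set_integrable_discrete_difference[where X = "{a}"]) auto

lemma set_integral_Ici_eq_Ioi:
  fixes f :: "real \<Rightarrow> real"
  shows "(LINT x:{a..}|lborel. f x) = (LINT x:{a<..}|lborel. f x)"
  by (rule set_integral_discrete_difference[where X = "{a}"]) auto

text \<open>The value at a enters as a one-sided limit, because \<open>robin_int\<close> has a kink
  at 0 when h 0 is nonzero.\<close>

lemma set_integral_FTC_Ici:
  fixes f F :: "real \<Rightarrow> real"
  assumes "\<And>x. a < x \<Longrightarrow> (F has_real_derivative f x) (at x)"
    and "\<And>x. a < x \<Longrightarrow> isCont f x"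
    and "set_integrable lborel {a..} f"
    and "(F \<longlongrightarrow> A) (at_right a)" "(F \<longlongrightarrow> B) at_top"
  shows "(LINT x:{a..}|lborel. f x) = B - A"
proof -
  have "(LBINT x=ereal a..\<infinity>. f x) = B - A"
    using assms unfolding set_integrable_Ici_iff_Ioi
    by (intro interval_integral_FTC_integrable[where F = F])
       (auto simp: ereal_tendsto_simps has_real_derivative_iff_has_vector_derivative)
  then show ?thesis
    by (simp add: interval_lebesgue_integral_def set_integral_Ici_eq_Ioi)
qed

lemma set_integrable_FTC_Ici:
  fixes f F :: "real \<Rightarrow> real"
  assumes "\<And>x. a < x \<Longrightarrow> (F has_real_derivative f x) (at x)"
    and "\<And>x. a < x \<Longrightarrow> isCont f x"
    and "\<And>x. a < x \<Longrightarrow> 0 \<le> f x"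
    and "(F \<longlongrightarrow> A) (at_right a)" "(F \<longlongrightarrow> B) at_top"
  shows "set_integrable lborel {a..} f"
proof -
  have "set_integrable lborel (einterval (ereal a) \<infinity>) f"
    using assms by (intro interval_integral_FTC_nonneg(1)[where F = F])
       (auto simp: ereal_tendsto_simps)
  then show ?thesis by (simp add: set_integrable_Ici_iff_Ioi)
qed

lemma set_integrable_exp_Ici:
  fixes \<kappa> :: real
  assumes "\<kappa> > 0"
  shows "set_integrable lborel {a..} (\<lambda>z. exp (- \<kappa> * z))"
proof (rule set_integrable_FTC_Ici[where F = "\<lambda>z. - exp (- \<kappa> * z) / \<kappa>"])
  show "((\<lambda>z. - exp (- \<kappa> * z) / \<kappa>) \<longlongrightarrow> - exp (- \<kappa> * a) / \<kappa>) (at_right a)"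
    using assms by (intro tendsto_intros) auto
  have "filterlim (\<lambda>z. - \<kappa> * z) at_bot at_top"
    using assms by (intro filterlim_tendsto_neg_mult_at_bot[OF tendsto_const _ filterlim_ident]) auto
  then have "((\<lambda>z. - exp (- \<kappa> * z) / \<kappa>) \<longlongrightarrow> - 0 / \<kappa>) at_top"
    using assms by (intro tendsto_intros filterlim_compose[OF exp_at_bot]) auto
  then show "((\<lambda>z. - exp (- \<kappa> * z) / \<kappa>) \<longlongrightarrow> 0) at_top" by simp
qed (use assms in \<open>auto intro!: derivative_eq_intros\<close>)

lemma set_integral_Ici_uminus:
  fixes f :: "real \<Rightarrow> real"
  shows "(LINT r:{..0}|lborel. f r) = (LINT r:{0..}|lborel. f (- r))"
  unfolding set_lebesgue_integral_def
  by (subst lborel_integral_real_affine[of "-1" _ 0])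
     (auto intro!: Bochner_Integration.integral_cong split: split_indicator)

lemma integral_half_lines:
  fixes f :: "real \<Rightarrow> real"
  assumes "integrable lborel f"
  shows "(\<integral>y. f y \<partial>lborel) = (LINT y:{0..}|lborel. f y) + (LINT r:{0..}|lborel. f (- r))"
proof -
  have "(\<integral>y. f y \<partial>lborel) = (LINT y:{0..} \<union> {..0}|lborel. f y)"
    by (subst set_integral_space[symmetric, OF assms]) (auto intro!: arg_cong[where f = "\<lambda>A. set_lebesgue_integral lborel A f"])
  also have "\<dots> = (LINT y:{0..}|lborel. f y) + (LINT y:{..0}|lborel. f y)"
  proof (rule set_integral_Un_AE)
    show "AE x in lborel. \<not> (x \<in> {0..} \<and> x \<in> {..0::real})"
      using AE_lborel_singleton[of 0] by eventually_elim auto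
  qed (use assms in \<open>auto simp: set_integrable_def intro!: integrable_mult_indicator[of _ lborel f, simplified]\<close>)
  finally show ?thesis by (simp add: set_integral_Ici_uminus)
qed

text \<open>The solution of the Robin problem on the half-line is the restriction of the heat semigroup
  on the line applied to an extension \<open>G\<close> of the datum \<open>h\<close>, chosen so that \<open>\<kappa> G - G'\<close> is odd.\<close>

definition robin_int :: "real \<Rightarrow> (real \<Rightarrow> real) \<Rightarrow> real \<Rightarrow> real" where
  "robin_int \<kappa> h r = exp (- \<kappa> * r) * integral {0..r} (\<lambda>s. exp (\<kappa> * s) * h s)"

definition robin_ext :: "real \<Rightarrow> (real \<Rightarrow> real) \<Rightarrow> real \<Rightarrow> real" where
  "robin_ext \<kappa> h y = (if 0 \<le> y then h y else h (- y) - 2 * \<kappa> * robin_int \<kappa> h (- y))"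

locale robin =
  fixes \<kappa> :: real and h :: "real \<Rightarrow> real" and C :: real
  assumes \<kappa>: "\<kappa> > 0"
    and h_cont: "continuous_on UNIV h"
    and h_bound: "\<And>y. \<bar>h y\<bar> \<le> C"
    and h_lim: "(h \<longlongrightarrow> 0) at_top"
begin

lemma h_measurable [measurable]: "h \<in> borel_measurable borel"
  using h_cont by (rule borel_measurable_continuous_onI)

lemma C_nonneg: "C \<ge> 0"
  using h_bound[of 0] by simp

lemma robin_int_nonpos [simp]: "r \<le> 0 \<Longrightarrow> robin_int \<kappa> h r = 0"
  by (cases "r = 0") (auto simp: robin_int_def)

lemma integrand_cont: "continuous_on A (\<lambda>s. exp (\<kappa> * s) * h s)"
  using h_cont by (intro continuous_intros) (auto intro: continuous_on_subset)

lemma DERIV_integral: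
  assumes "0 < r"
  shows "((\<lambda>r. integral {0..r} (\<lambda>s. exp (\<kappa> * s) * h s)) has_real_derivative exp (\<kappa> * r) * h r) (at r)"
proof -
  have "((\<lambda>r. integral {0..r} (\<lambda>s. exp (\<kappa> * s) * h s)) has_real_derivative exp (\<kappa> * r) * h r)
      (at r within {0..r + 1})"
    using assms by (intro integral_has_real_derivative integrand_cont) auto
  then have "((\<lambda>r. integral {0..r} (\<lambda>s. exp (\<kappa> * s) * h s)) has_real_derivative exp (\<kappa> * r) * h r)
      (at r within {0<..<r + 1})"
    by (rule DERIV_subset) auto
  then show ?thesis using assms by (subst (asm) at_within_open) auto
qed

text \<open>This equation is the origin of \<open>robin_int\<close>: for smooth h and G (- r) = h r
  - 2 * \<kappa> * \<open>robin_int\<close> \<kappa> h r it says exactly that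
  \<open>\<kappa> G - G'\<close> is odd.\<close>

lemma DERIV_robin_int:
  assumes "0 < r"
  shows "(robin_int \<kappa> h has_real_derivative h r - \<kappa> * robin_int \<kappa> h r) (at r)"
  unfolding robin_int_def[abs_def]
  by (rule derivative_eq_intros DERIV_integral assms refl | simp)+
     (simp add: algebra_simps exp_minus)

lemma robin_int_cont: "continuous_on UNIV (robin_int \<kappa> h)"
proof -
  have "continuous_on {0..} (robin_int \<kappa> h)"
    unfolding continuous_on_eq_continuous_within
  proof
    fix x :: real assume x: "x \<in> {0..}"
    have "continuous_on {0..x + 1} (robin_int \<kappa> h)"
      unfolding robin_int_def[abs_def]
      by (intro continuous_intros indefinite_integral_continuous_1 integrable_continuous_interval integrand_cont)
    then have "continuous (at x within {0..x + 1}) (robin_int \<kappa> h)"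
      using x by (auto simp: continuous_on_eq_continuous_within)
    moreover have "at x within {0..x + 1} = at x within {0..}"
      using x by (intro at_within_nhd[of _ "{..<x + 1}"]) auto
    ultimately show "continuous (at x within {0..}) (robin_int \<kappa> h)"
      by (simp add: continuous_within)
  qed
  then have "continuous_on ({0..} \<union> {..0}) (robin_int \<kappa> h)"
    by (intro continuous_on_closed_Un) (auto intro!: continuous_on_eq[OF continuous_on_const[of _ 0]])
  moreover have "{0..} \<union> {..0} = (UNIV :: real set)" by auto
  ultimately show ?thesis by simp
qed

lemma robin_int_bound: "\<bar>robin_int \<kappa> h r\<bar> \<le> C / \<kappa>"
proof (cases "r > 0")
  case True
  have I: "((\<lambda>s. C * exp (\<kappa> * s)) has_integral C * exp (\<kappa> * r) / \<kappa> - C * exp (\<kappa> * 0) / \<kappa>) {0..r}"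
    using True \<kappa>
    by (intro fundamental_theorem_of_calculus)
       (auto intro!: derivative_eq_intros simp flip: has_real_derivative_iff_has_vector_derivative)
  have "\<bar>integral {0..r} (\<lambda>s. exp (\<kappa> * s) * h s)\<bar> \<le> integral {0..r} (\<lambda>s. C * exp (\<kappa> * s))"
    using integral_norm_bound_integral[of "\<lambda>s. exp (\<kappa> * s) * h s" "{0..r}" "\<lambda>s. C * exp (\<kappa> * s)"]
      h_bound has_integral_integrable[OF I]
    by (auto simp: abs_mult mult.commute[of C] intro!: integrable_continuous_interval integrand_cont)
  also have "\<dots> \<le> C * exp (\<kappa> * r) / \<kappa>"
    unfolding integral_unique[OF I] using C_nonneg \<kappa> by (simp add: field_simps)
  finally have "exp (- \<kappa> * r) * \<bar>integral {0..r} (\<lambda>s. exp (\<kappa> * s) * h s)\<bar> \<le> exp (- \<kappa> * r) * (C * exp (\<kappa> * r) / \<kappa>)"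
    by (intro mult_left_mono) auto
  also have "\<dots> = C / \<kappa>" by (simp add: exp_minus)
  finally show ?thesis by (simp add: robin_int_def abs_mult)
qed (use C_nonneg \<kappa> in auto)

text \<open>By l'Hospital's rule: the derivatives of the integral and of exp (\<kappa> * r) have
  quotient h r / \<kappa>.\<close>

lemma robin_int_lim: "(robin_int \<kappa> h \<longlongrightarrow> 0) at_top"
proof -
  have "((\<lambda>r. integral {0..r} (\<lambda>s. exp (\<kappa> * s) * h s) / exp (\<kappa> * r)) \<longlongrightarrow> 0 / \<kappa>) at_top"
  proof (rule lhospital_at_top_at_top)
    show "filterlim (\<lambda>r. exp (\<kappa> * r)) at_top at_top"
      using \<kappa> by (intro filterlim_compose[OF exp_at_top]
          filterlim_tendsto_pos_mult_at_top[OF tendsto_const _ filterlim_ident]) auto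
    show "\<forall>\<^sub>F r in at_top. \<kappa> * exp (\<kappa> * r) \<noteq> 0"
      using \<kappa> by auto
    show "\<forall>\<^sub>F r in at_top. ((\<lambda>r. integral {0..r} (\<lambda>s. exp (\<kappa> * s) * h s)) has_real_derivative
        exp (\<kappa> * r) * h r) (at r)"
      using eventually_gt_at_top[of 0] by eventually_elim (rule DERIV_integral)
    show "\<forall>\<^sub>F r in at_top. ((\<lambda>r. exp (\<kappa> * r)) has_real_derivative \<kappa> * exp (\<kappa> * r)) (at r)"
      by (auto intro!: always_eventually derivative_eq_intros)
    have "((\<lambda>r. h r / \<kappa>) \<longlongrightarrow> 0 / \<kappa>) at_top"
      using \<kappa> by (intro tendsto_intros h_lim) auto
    then show "((\<lambda>r. exp (\<kappa> * r) * h r / (\<kappa> * exp (\<kappa> * r))) \<longlongrightarrow> 0 / \<kappa>) at_top"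
      by simp
  qed
  then show ?thesis by (simp add: robin_int_def[abs_def] exp_minus field_simps)
qed

lemma robin_ext_nonneg [simp]: "0 \<le> y \<Longrightarrow> robin_ext \<kappa> h y = h y"
  by (simp add: robin_ext_def)

lemma robin_ext_minus: "0 \<le> r \<Longrightarrow> robin_ext \<kappa> h (- r) = h r - 2 * \<kappa> * robin_int \<kappa> h r"
  by (auto simp: robin_ext_def)

lemma robin_ext_cont: "continuous_on UNIV (robin_ext \<kappa> h)"
proof -
  have "continuous_on ({0..} \<union> {..0}) (\<lambda>y. if 0 \<le> y then h y else h (- y) - 2 * \<kappa> * robin_int \<kappa> h (- y))"
    by (rule continuous_on_cases)
       (auto intro!: continuous_intros continuous_on_compose2[OF h_cont] continuous_on_compose2[OF robin_int_cont])
  moreover have "{0..} \<union> {..0} = (UNIV :: real set)" by auto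
  ultimately show ?thesis by (simp add: robin_ext_def[abs_def])
qed

text \<open>The bound is independent of \<kappa>: C comes from h, and 2 * \<kappa> times the bound C
  / \<kappa> of \<open>robin_int\<close> gives 2 * C.\<close>

lemma robin_ext_bound: "\<bar>robin_ext \<kappa> h y\<bar> \<le> 3 * C"
proof (cases "0 \<le> y")
  case True
  then show ?thesis using h_bound[of y] by simp
next
  case False
  have "\<bar>2 * \<kappa> * robin_int \<kappa> h (- y)\<bar> \<le> 2 * \<kappa> * (C / \<kappa>)"
    using \<kappa> robin_int_bound[of "- y"] by (simp add: abs_mult field_simps)
  then show ?thesis
    using False h_bound[of "- y"] \<kappa> by (simp add: robin_ext_def)
qed

lemma robin_ext_measurable [measurable]: "robin_ext \<kappa> h \<in> borel_measurable borel"
  using robin_ext_cont by (rule borel_measurable_continuous_onI)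

lemma robin_int_measurable [measurable]: "robin_int \<kappa> h \<in> borel_measurable borel"
  using robin_int_cont by (rule borel_measurable_continuous_onI)

lemma robin_ext_lim: "(robin_ext \<kappa> h \<longlongrightarrow> 0) at_top"
  by (rule Lim_transform_eventually[OF h_lim])
     (auto intro!: eventually_mono[OF eventually_ge_at_top[of 0]])

end

section \<open>The boundary condition and the explicit formula\<close>

lemma heat_dx_integrable:
  assumes "t > 0" "F \<in> borel_measurable borel" "\<And>y. \<bar>F y\<bar> \<le> C"
  shows "integrable lborel (\<lambda>y. F y * ((x - y) / t * gauss t (x - y)))"
  using integrable_mult_right[OF heat_moment_integrable[OF assms(2,3,1), of x 1], of "1 / (t * sqrt (2 * pi * t))"]
  by (simp add: gauss_def field_simps)

lemma DERIV_heat: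
  assumes "t > 0" "F \<in> borel_measurable borel" "\<And>y. \<bar>F y\<bar> \<le> C"
  shows "(heat t F has_real_derivative - (\<integral>y. F y * ((x - y) / t * gauss t (x - y)) \<partial>lborel)) (at x)"
proof -
  have "(\<integral>y. F y * ((x - y) / t * gauss t (x - y)) \<partial>lborel) =
    (\<integral>y. F y * ((x - y) ^ 1 * exp (- (x - y)\<^sup>2 / (2 * t))) / (t * sqrt (2 * pi * t)) \<partial>lborel)"
    by (intro Bochner_Integration.integral_cong) (simp_all add: gauss_def)
  also have "\<dots> = heat_moment t F 1 x / (t * sqrt (2 * pi * t))"
    unfolding heat_moment_def by (rule integral_divide_zero)
  finally show ?thesis
    using DERIV_heat_x[OF assms(2,3,1), of x] by simp
qed

text \<open>Translation invariance makes the bound uniform in x; this gives integrability against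
  exp (- \<kappa> * z) in \<open>robin_formula\<close>.\<close>

lemma heat_dx_bound:
  assumes t: "t > 0" and F: "F \<in> borel_measurable borel" and bound: "\<And>y. \<bar>F y\<bar> \<le> C"
  shows "\<exists>K. \<forall>x. \<bar>\<integral>y. F y * ((x - y) / t * gauss t (x - y)) \<partial>lborel\<bar> \<le> K"
proof -
  have i1: "integrable lborel (\<lambda>y. 1 * ((x - y) / t * gauss t (x - y)))" for x
    by (rule heat_dx_integrable[OF t, of _ 1]) auto
  have "\<bar>\<integral>y. F y * ((x - y) / t * gauss t (x - y)) \<partial>lborel\<bar> \<le>
      C * (\<integral>y. \<bar>y / t * gauss t y\<bar> \<partial>lborel)" for x
  proof -
    have "\<bar>\<integral>y. F y * ((x - y) / t * gauss t (x - y)) \<partial>lborel\<bar> \<le>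
        (\<integral>y. C * \<bar>(x - y) / t * gauss t (x - y)\<bar> \<partial>lborel)"
      using i1[of x]
      by (intro order_trans[OF integral_abs_bound integral_mono] integrable_abs heat_dx_integrable[OF assms] integrable_mult_right)
         (simp_all only: abs_mult[of "F _"] mult_right_mono bound abs_ge_zero abs_abs, simp)
    also have "\<dots> = C * (\<integral>y. \<bar>(x - y) / t * gauss t (x - y)\<bar> \<partial>lborel)" by simp
    also have "(\<integral>y. \<bar>(x - y) / t * gauss t (x - y)\<bar> \<partial>lborel) = (\<integral>y. \<bar>y / t * gauss t y\<bar> \<partial>lborel)"
      using t lborel_integral_real_affine[of "-1" "\<lambda>y. \<bar>y / t * gauss t y\<bar>" x] by simp
    finally show ?thesis .
  qed
  then show ?thesis by blast
qed

lemma gauss_plus_integrable: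
  assumes t: "t > 0" and F: "F \<in> borel_measurable borel" and bound: "\<And>y. \<bar>F y\<bar> \<le> C"
  shows "integrable lborel (\<lambda>r. F r * gauss t (z + r))"
    and "integrable lborel (\<lambda>r. F r * ((z + r) / t * gauss t (z + r)))"
proof -
  have *: "gauss t (z + r) = gauss t (- z - r)" for r
    by (metis gauss_minus minus_add_distrib uminus_add_conv_diff diff_conv_add_uminus)
  have **: "(z + r) / t = - ((- z - r) / t)" for r
    by (simp add: minus_divide_left add.commute)
  show "integrable lborel (\<lambda>r. F r * gauss t (z + r))"
    unfolding * by (rule heat_integrable[OF t F bound])
  have "integrable lborel (\<lambda>r. - (F r * ((- z - r) / t * gauss t (- z - r))))"
    by (intro integrable_minus heat_dx_integrable[OF t F bound])
  then show "integrable lborel (\<lambda>r. F r * ((z + r) / t * gauss t (z + r)))"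
    unfolding * ** by simp
qed

lemma gauss_tendsto_0: "t > 0 \<Longrightarrow> (gauss t \<longlongrightarrow> 0) at_top"
proof -
  assume t: "t > 0"
  have "filterlim (\<lambda>z::real. z\<^sup>2) at_top at_top"
    by (rule filterlim_pow_at_top[OF _ filterlim_ident]) simp
  then have "filterlim (\<lambda>z. (1 / (2 * t)) * z\<^sup>2) at_top at_top"
    using t by (intro filterlim_tendsto_pos_mult_at_top[OF tendsto_const]) auto
  then have "filterlim (\<lambda>z. - ((1 / (2 * t)) * z\<^sup>2)) at_bot at_top"
    by (rule filterlim_compose[OF filterlim_uminus_at_bot_at_top])
  then have "((\<lambda>z. exp (- ((1 / (2 * t)) * z\<^sup>2)) / sqrt (2 * pi * t)) \<longlongrightarrow> 0 / sqrt (2 * pi * t)) at_top"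
    using t by (intro tendsto_intros filterlim_compose[OF exp_at_bot]) auto
  then show ?thesis by (simp add: gauss_def[abs_def])
qed

lemma set_integrable_Ici:
  fixes f :: "real \<Rightarrow> real"
  assumes "integrable lborel f"
  shows "set_integrable lborel {a..} f"
  unfolding set_integrable_def using integrable_mult_indicator[OF _ assms, of "{a..}"] by simp

context robin
begin

lemmas robin_int_gauss_integrable = gauss_plus_integrable[OF _ robin_int_measurable robin_int_bound]
  and h_gauss_integrable = gauss_plus_integrable[OF _ h_measurable h_bound]

text \<open>The derivative of \<open>robin_int\<close> times the kernel is integrated over the
  half-line; the boundary term at 0 vanishes because \<open>robin_int\<close> does there. This
  stands in for the derivative of h, which may not exist.\<close>

lemma robin_int_by_parts:
  assumes t: "t > 0"
  shows "(LINT r:{0..}|lborel. h r * gauss t (z + r)) - \<kappa> * (LINT r:{0..}|lborel. robin_int \<kappa> h r * gauss t (z + r))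
    = (LINT r:{0..}|lborel. robin_int \<kappa> h r * ((z + r) / t * gauss t (z + r)))"
proof -
  note ints = set_integrable_Ici[OF h_gauss_integrable(1)[OF t], of 0 z]
    set_integrable_Ici[OF robin_int_gauss_integrable(1)[OF t], of 0 z]
    set_integrable_Ici[OF robin_int_gauss_integrable(2)[OF t], of 0 z]
  let ?f = "\<lambda>r. h r * gauss t (z + r) - \<kappa> * (robin_int \<kappa> h r * gauss t (z + r))
      - robin_int \<kappa> h r * ((z + r) / t * gauss t (z + r))"
  have "(LINT r:{0..}|lborel. ?f r) = 0 - 0"
  proof (rule set_integral_FTC_Ici[where F = "\<lambda>r. robin_int \<kappa> h r * gauss t (z + r)"])
    fix r :: real assume r: "0 < r"
    show "((\<lambda>r. robin_int \<kappa> h r * gauss t (z + r)) has_real_derivative ?f r) (at r)"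
      unfolding gauss_def using t r
      by (auto intro!: derivative_eq_intros DERIV_robin_int simp: field_simps)
    show "isCont ?f r"
      unfolding gauss_def using t
      by (intro continuous_intros continuous_on_interior[OF h_cont] continuous_on_interior[OF robin_int_cont]) auto
  next
    show "set_integrable lborel {0..} ?f"
      using ints by (intro set_integral_diff set_integrable_mult_right)
    have "isCont (\<lambda>r. robin_int \<kappa> h r * gauss t (z + r)) 0"
      unfolding gauss_def using t by (intro continuous_intros continuous_on_interior[OF robin_int_cont]) auto
    then show "((\<lambda>r. robin_int \<kappa> h r * gauss t (z + r)) \<longlongrightarrow> 0) (at_right 0)"
      by (auto simp: isCont_def intro: tendsto_within_subset)
    have "((\<lambda>r. robin_int \<kappa> h r * gauss t (z + r)) \<longlongrightarrow> 0 * 0) at_top"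
      by (intro tendsto_intros robin_int_lim filterlim_compose[OF gauss_tendsto_0[OF t]]
          filterlim_tendsto_add_at_top[OF tendsto_const filterlim_ident])
    then show "((\<lambda>r. robin_int \<kappa> h r * gauss t (z + r)) \<longlongrightarrow> 0) at_top" by simp
  qed
  moreover have "(LINT r:{0..}|lborel. ?f r) = (LINT r:{0..}|lborel. h r * gauss t (z + r))
      - \<kappa> * (LINT r:{0..}|lborel. robin_int \<kappa> h r * gauss t (z + r))
      - (LINT r:{0..}|lborel. robin_int \<kappa> h r * ((z + r) / t * gauss t (z + r)))"
    using ints by (simp only: set_integral_diff set_integrable_mult_right set_integral_mult_right)
  ultimately show ?thesis by simp
qed

text \<open>The left side is \<open>\<kappa> v - v'\<close> for v = heat t G. Integration by parts
  removes every \<open>robin_int\<close> term and leaves h against a kernel that is odd in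
  z.\<close>

lemma robin_derivative:
  assumes t: "t > 0"
  defines "G \<equiv> robin_ext \<kappa> h"
  shows "\<kappa> * heat t G z + (\<integral>y. G y * ((z - y) / t * gauss t (z - y)) \<partial>lborel) =
    (LINT y:{0..}|lborel. ((z - y + \<kappa> * t) / t * gauss t (z - y) + (z + y - \<kappa> * t) / t * gauss t (z + y)) * h y)"
proof -
  have G: "G \<in> borel_measurable borel" "\<And>y. \<bar>G y\<bar> \<le> 3 * C"
    unfolding G_def by (auto intro: robin_ext_bound)
  note int1 = set_integrable_Ici[OF h_gauss_integrable(1)[OF t], of 0 z]
    set_integrable_Ici[OF h_gauss_integrable(2)[OF t], of 0 z]
    set_integrable_Ici[OF robin_int_gauss_integrable(1)[OF t], of 0 z]
    set_integrable_Ici[OF robin_int_gauss_integrable(2)[OF t], of 0 z]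
  note int2 = set_integrable_Ici[OF heat_integrable[OF t h_measurable h_bound], of 0 z]
    set_integrable_Ici[OF heat_dx_integrable[OF t h_measurable h_bound], of 0 z]
  have "\<kappa> * heat t G z + (\<integral>y. G y * ((z - y) / t * gauss t (z - y)) \<partial>lborel) =
      (\<integral>y. \<kappa> * (G y * gauss t (z - y)) + G y * ((z - y) / t * gauss t (z - y)) \<partial>lborel)"
    using heat_integrable[OF t G, of z] heat_dx_integrable[OF t G, of z]
    by (simp add: heat_eq_gauss[OF t])
  also have "\<dots> = (LINT y:{0..}|lborel. \<kappa> * (G y * gauss t (z - y)) + G y * ((z - y) / t * gauss t (z - y)))
      + (LINT r:{0..}|lborel. \<kappa> * (G (- r) * gauss t (z + r)) + G (- r) * ((z + r) / t * gauss t (z + r)))"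
    using heat_integrable[OF t G, of z] heat_dx_integrable[OF t G, of z]
    by (subst integral_half_lines) simp_all
  also have "(LINT y:{0..}|lborel. \<kappa> * (G y * gauss t (z - y)) + G y * ((z - y) / t * gauss t (z - y))) =
      (LINT y:{0..}|lborel. \<kappa> * (h y * gauss t (z - y)) + h y * ((z - y) / t * gauss t (z - y)))"
    by (intro set_lebesgue_integral_cong) (auto simp: G_def)
  also have "(LINT r:{0..}|lborel. \<kappa> * (G (- r) * gauss t (z + r)) + G (- r) * ((z + r) / t * gauss t (z + r))) =
      (LINT r:{0..}|lborel. \<kappa> * (h r * gauss t (z + r)) + h r * ((z + r) / t * gauss t (z + r))
        - 2 * \<kappa> * (\<kappa> * (robin_int \<kappa> h r * gauss t (z + r)))
        - 2 * \<kappa> * (robin_int \<kappa> h r * ((z + r) / t * gauss t (z + r))))"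
    using t by (intro set_lebesgue_integral_cong) (auto simp: G_def robin_ext_minus field_simps)
  also have "\<dots> = \<kappa> * (LINT r:{0..}|lborel. h r * gauss t (z + r)) + (LINT r:{0..}|lborel. h r * ((z + r) / t * gauss t (z + r)))
        - 2 * \<kappa> * (\<kappa> * (LINT r:{0..}|lborel. robin_int \<kappa> h r * gauss t (z + r)))
        - 2 * \<kappa> * (LINT r:{0..}|lborel. robin_int \<kappa> h r * ((z + r) / t * gauss t (z + r)))"
    using int1 by (simp only: set_integral_add set_integral_diff set_integrable_mult_right set_integral_mult_right)
  also have "\<dots> = (LINT r:{0..}|lborel. h r * ((z + r) / t * gauss t (z + r))) - \<kappa> * (LINT r:{0..}|lborel. h r * gauss t (z + r))"
    unfolding robin_int_by_parts[OF t, symmetric] by (simp add: algebra_simps)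
  also have "\<dots> = (LINT r:{0..}|lborel. h r * ((z + r) / t * gauss t (z + r)) - \<kappa> * (h r * gauss t (z + r)))"
    using int1 by (simp only: set_integral_diff set_integrable_mult_right set_integral_mult_right)
  also have "(LINT y:{0..}|lborel. \<kappa> * (h y * gauss t (z - y)) + h y * ((z - y) / t * gauss t (z - y))) + \<dots> =
      (LINT y:{0..}|lborel. (\<kappa> * (h y * gauss t (z - y)) + h y * ((z - y) / t * gauss t (z - y))) +
         (h y * ((z + y) / t * gauss t (z + y)) - \<kappa> * (h y * gauss t (z + y))))"
    using int1 int2
    by (simp only: set_integral_add set_integral_diff set_integrable_mult_right)
  also have "\<dots> = (LINT y:{0..}|lborel. ((z - y + \<kappa> * t) / t * gauss t (z - y) + (z + y - \<kappa> * t) / t * gauss t (z + y)) * h y)"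
    using t by (intro set_lebesgue_integral_cong) (auto simp: field_simps)
  finally show ?thesis .
qed

text \<open>At z = 0 the two summands of the kernel in \<open>robin_derivative\<close> cancel
  pointwise, since the Gaussian is even.\<close>

lemma robin_boundary:
  assumes t: "t > 0"
  shows "(heat t (robin_ext \<kappa> h) has_real_derivative \<kappa> * heat t (robin_ext \<kappa> h) 0) (at 0)"
proof -
  have "(LINT y:{0..}|lborel. ((0 - y + \<kappa> * t) / t * gauss t (0 - y) + (0 + y - \<kappa> * t) / t * gauss t (0 + y)) * h y) = (LINT y:{0..}|(lborel :: real measure). 0)"
    using t by (intro set_lebesgue_integral_cong) (auto simp: field_simps)
  then show ?thesis
    using robin_derivative[OF t, of 0] DERIV_heat[OF t robin_ext_measurable robin_ext_bound, of 0]
    by (simp add: eq_neg_iff_add_eq_0)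
qed

text \<open>With W the right side of \<open>robin_derivative\<close>, the equation
  \<open>\<kappa> v - v' = W\<close> is solved with the integrating factor exp (- \<kappa> * z),
  starting from infinity, where exp (- \<kappa> * z) * v z vanishes.\<close>

lemma robin_formula:
  assumes t: "t > 0"
  shows "heat t (robin_ext \<kappa> h) u = exp (\<kappa> * u) * (LINT z:{u..}|lborel. exp (- \<kappa> * z) *
    (LINT y:{0..}|lborel. ((z - y + \<kappa> * t) / t * gauss t (z - y) + (z + y - \<kappa> * t) / t * gauss t (z + y)) * h y))"
proof -
  let ?G = "robin_ext \<kappa> h"
  let ?d = "\<lambda>z. \<integral>y. ?G y * ((z - y) / t * gauss t (z - y)) \<partial>lborel"
  let ?W = "\<lambda>z. \<kappa> * heat t ?G z + ?d z"
  have dH: "(heat t ?G has_real_derivative - ?d z) (at z)" for z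
    by (rule DERIV_heat[OF t robin_ext_measurable robin_ext_bound])
  \<comment> \<open>The moment form of the derivative is itself differentiable, hence continuous;
    uniqueness of derivatives carries this over to the integral form.\<close>
  have "isCont (\<lambda>z. - heat_moment t ?G 1 z / (t * sqrt (2 * pi * t))) z" for z
    using DERIV_heat_xx[OF robin_ext_measurable robin_ext_bound t] DERIV_isCont by blast
  moreover have "(\<lambda>z. - heat_moment t ?G 1 z / (t * sqrt (2 * pi * t))) = (\<lambda>z. - ?d z)"
    using DERIV_unique[OF dH DERIV_heat_x[OF robin_ext_measurable robin_ext_bound t]] by auto
  ultimately have cd: "isCont ?d z" for z
    using isCont_minus[of z "\<lambda>z. - ?d z"] by simp
  have cW: "isCont ?W z" for z
    by (intro continuous_intros cd DERIV_isCont[OF dH])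
  obtain K where K: "\<And>z. \<bar>?d z\<bar> \<le> K"
    using heat_dx_bound[OF t robin_ext_measurable robin_ext_bound] by blast
  have Wb: "\<bar>?W z\<bar> \<le> \<kappa> * (3 * C) + K" for z
  proof -
    have "\<bar>\<kappa> * heat t ?G z\<bar> \<le> \<kappa> * (3 * C)"
      using \<kappa> heat_bound[OF robin_ext_measurable robin_ext_bound, of t z] by (simp add: abs_mult)
    then show ?thesis using K[of z] by linarith
  qed
  have "(LINT z:{u..}|lborel. exp (- \<kappa> * z) * ?W z) = 0 - (- exp (- \<kappa> * u) * heat t ?G u)"
  proof (rule set_integral_FTC_Ici[where F = "\<lambda>z. - exp (- \<kappa> * z) * heat t ?G z"])
    fix z
    show "((\<lambda>z. - exp (- \<kappa> * z) * heat t ?G z) has_real_derivative exp (- \<kappa> * z) * ?W z) (at z)"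
      by (auto intro!: derivative_eq_intros dH simp: algebra_simps)
    show "isCont (\<lambda>z. exp (- \<kappa> * z) * ?W z) z"
      by (intro continuous_intros cd DERIV_isCont[OF dH])
  next
    have "integrable lborel (\<lambda>z. ?W z * (indicator {u..} z * exp (- \<kappa> * z)))"
    proof (rule integrable_bounded_mult[OF _ _ Wb])
      show "integrable lborel (\<lambda>z. indicator {u..} z * exp (- \<kappa> * z))"
        using set_integrable_exp_Ici[OF \<kappa>, of u] by (simp add: set_integrable_def)
      have "?W \<in> borel_measurable borel"
        by (intro borel_measurable_continuous_onI continuous_at_imp_continuous_on ballI cW)
      then show "?W \<in> borel_measurable lborel" by simp
    qed
    then show "set_integrable lborel {u..} (\<lambda>z. exp (- \<kappa> * z) * ?W z)"
      by (simp add: set_integrable_def mult_ac)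
    have "isCont (\<lambda>z. - exp (- \<kappa> * z) * heat t ?G z) u"
      by (intro continuous_intros DERIV_isCont[OF dH])
    then show "((\<lambda>z. - exp (- \<kappa> * z) * heat t ?G z) \<longlongrightarrow> - exp (- \<kappa> * u) * heat t ?G u) (at_right u)"
      by (auto simp: isCont_def intro: tendsto_within_subset)
    have "filterlim (\<lambda>z. - \<kappa> * z) at_bot at_top"
      using \<kappa> by (intro filterlim_tendsto_neg_mult_at_bot[OF tendsto_const _ filterlim_ident]) auto
    then have "((\<lambda>z. - exp (- \<kappa> * z) * heat t ?G z) \<longlongrightarrow> - 0 * 0) at_top"
      by (intro tendsto_intros filterlim_compose[OF exp_at_bot] heat_tendsto_0[OF robin_ext_cont robin_ext_bound robin_ext_lim])
    then show "((\<lambda>z. - exp (- \<kappa> * z) * heat t ?G z) \<longlongrightarrow> 0) at_top" by simp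
  qed
  then have W: "(LINT z:{u..}|lborel. exp (- \<kappa> * z) *
      (LINT y:{0..}|lborel. ((z - y + \<kappa> * t) / t * gauss t (z - y) + (z + y - \<kappa> * t) / t * gauss t (z + y)) * h y))
      = exp (- \<kappa> * u) * heat t ?G u"
    unfolding robin_derivative[OF t] by simp
  show ?thesis
    unfolding W by (simp add: exp_minus)
qed

end

section \<open>Last exit decomposition and Duhamel formula\<close>

definition gauss_cdf :: "real \<Rightarrow> real \<Rightarrow> real" where
  "gauss_cdf t x = (LINT y:{..x}|lborel. gauss t y)"

lemma integrable_gauss': "t > 0 \<Longrightarrow> integrable lborel (gauss t)"
  using integrable_gauss[of t 0] by simp

lemma integral_gauss': "t > 0 \<Longrightarrow> (\<integral>y. gauss t y \<partial>lborel) = 1"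
  using integral_gauss[of t 0] by simp

lemma set_integrable_of_integrable:
  fixes f :: "'a \<Rightarrow> real"
  assumes "integrable M f" "A \<in> sets M"
  shows "set_integrable M A f"
  unfolding set_integrable_def using integrable_mult_indicator[OF assms(2,1)] by simp

lemma DERIV_gauss_cdf:
  assumes t: "t > 0"
  shows "(gauss_cdf t has_real_derivative gauss t x) (at x)"
proof -
  have cont: "continuous_on A (gauss t)" for A
    unfolding gauss_def[abs_def] using t by (intro continuous_intros) auto
  have *: "gauss_cdf t z = gauss_cdf t (x - 1) + integral {x - 1..z} (gauss t)" if "z \<in> {x - 1<..<x + 1}" for z
  proof -
    have "gauss_cdf t z = (LINT y:{..x - 1} \<union> {x - 1<..z}|lborel. gauss t y)"
      unfolding gauss_cdf_def using that
      by (intro arg_cong[where f = "\<lambda>A. set_lebesgue_integral lborel A _"]) auto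
    also have "\<dots> = gauss_cdf t (x - 1) + (LINT y:{x - 1<..z}|lborel. gauss t y)"
      unfolding gauss_cdf_def using integrable_gauss'[OF t]
      by (intro set_integral_Un set_integrable_of_integrable) auto
    also have "(LINT y:{x - 1<..z}|lborel. gauss t y) = (LINT y:{x - 1..z}|lborel. gauss t y)"
      by (rule set_integral_discrete_difference[where X = "{x - 1}"]) auto
    also have "\<dots> = integral {x - 1..z} (gauss t)"
      using integrable_gauss'[OF t] by (intro set_borel_integral_eq_integral set_integrable_of_integrable) auto
    finally show ?thesis .
  qed
  have "((\<lambda>z. gauss_cdf t (x - 1) + integral {x - 1..z} (gauss t)) has_real_derivative 0 + gauss t x)
      (at x within {x - 1..x + 1})"
    by (intro DERIV_add DERIV_const integral_has_real_derivative cont) auto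
  then have "((\<lambda>z. gauss_cdf t (x - 1) + integral {x - 1..z} (gauss t)) has_real_derivative 0 + gauss t x)
      (at x within {x - 1<..<x + 1})"
    by (rule DERIV_subset) auto
  then have "(gauss_cdf t has_real_derivative 0 + gauss t x) (at x within {x - 1<..<x + 1})"
    by (rule has_field_derivative_transform_within[where d = 1]) (simp_all add: *)
  then show ?thesis by (simp add: at_within_open[OF _ open_greaterThanLessThan])
qed

lemma gauss_cdf_minus:
  assumes t: "t > 0"
  shows "gauss_cdf t (- x) = 1 - gauss_cdf t x"
proof -
  have "gauss_cdf t (- x) = (LINT y:{x..}|lborel. gauss t y)"
    unfolding gauss_cdf_def set_lebesgue_integral_def
    by (subst lborel_integral_real_affine[of "-1" _ 0])
       (auto intro!: Bochner_Integration.integral_cong split: split_indicator)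
  also have "\<dots> = (LINT y:{x<..}|lborel. gauss t y)"
    by (rule set_integral_Ici_eq_Ioi)
  also have "gauss_cdf t x + \<dots> = (LINT y:{..x} \<union> {x<..}|lborel. gauss t y)"
    unfolding gauss_cdf_def using integrable_gauss'[OF t]
    by (intro set_integral_Un[symmetric] set_integrable_of_integrable) auto
  also have "{..x} \<union> {x<..} = UNIV" by auto
  also have "(LINT y:UNIV|lborel. gauss t y) = 1"
    using integral_gauss'[OF t] by (simp add: set_lebesgue_integral_def)
  finally show ?thesis by simp
qed

lemma gauss_cdf_at_top:
  assumes t: "t > 0"
  shows "(gauss_cdf t \<longlongrightarrow> 1) at_top"
  using tendsto_integral_at_top[OF _ integrable_gauss'[OF t]] integral_gauss'[OF t]
  by (simp add: gauss_cdf_def[abs_def] set_lebesgue_integral_def)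

lemma gauss_cdf_at_bot:
  assumes t: "t > 0"
  shows "(gauss_cdf t \<longlongrightarrow> 0) at_bot"
proof -
  have "((\<lambda>x. 1 - gauss_cdf t (- x)) \<longlongrightarrow> 1 - 1) at_bot"
    by (intro tendsto_intros filterlim_compose[OF gauss_cdf_at_top[OF t]] filterlim_uminus_at_top_at_bot)
  then show ?thesis by (simp add: gauss_cdf_minus[OF t])
qed

text \<open>Decomposing a Brownian path from \<open>-y\<close> to \<open>r\<close> at its last visit to \<open>0\<close>. In the variable
  \<open>w = sqrt (\<sigma> / (t - \<sigma>))\<close> the exponent becomes a complete square, which gives an explicit
  antiderivative.\<close>

lemma gauss_last_exit:
  fixes t y r :: real
  assumes t: "t > 0" and y: "y \<ge> 0" and r: "r > 0"
  defines "k \<equiv> \<lambda>\<sigma>. gauss \<sigma> y * (r / (t - \<sigma>) * gauss (t - \<sigma>) r)"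
  shows "set_integrable lborel {0<..<t} k"
    and "(LINT \<sigma>:{0<..<t}|lborel. k \<sigma>) = gauss t (y + r)"
proof -
  define w where "w \<sigma> = sqrt (\<sigma> / (t - \<sigma>))" for \<sigma>
  \<comment> \<open>The Gaussians at r * w - y / w and r * w + y / w differ by the factor exp (2 * r
    * y / t). Adding the second term thus cancels the contributions of y / w^2 to the derivative and
    leaves 2 * r times the derivative of w.\<close>
  define A where "A \<sigma> = gauss t (y + r) *
      (gauss_cdf t (r * w \<sigma> - y / w \<sigma>) + exp (2 * r * y / t) * gauss_cdf t (r * w \<sigma> + y / w \<sigma>))" for \<sigma>
  \<comment> \<open>The limit of the bracket in A at time 0. For y = 0 both distribution functions
    tend to 1/2; for y > 0 the first tends to 0 and the second to 1. The number is the same, but the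
    arguments of the limits are not.\<close>
  define l where "l = (if y = 0 then 1 else exp (2 * r * y / t))"
  have dA: "(A has_real_derivative k \<sigma>) (at \<sigma>)" if s: "0 < \<sigma>" "\<sigma> < t" for \<sigma>
  proof -
    define W where "W = w \<sigma>"
    have W: "W > 0" using s by (simp add: W_def w_def)
    have W2: "W * W = \<sigma> / (t - \<sigma>)" using s by (simp add: W_def w_def)
    define w' where "w' = t / (t - \<sigma>)\<^sup>2 / (2 * W)"
    have dw: "(w has_real_derivative w') (at \<sigma>)"
    proof -
      have a: "((\<lambda>\<sigma>. \<sigma> / (t - \<sigma>)) has_real_derivative t / (t - \<sigma>)\<^sup>2) (at \<sigma>)"
        using s by (auto intro!: derivative_eq_intros simp: field_simps power2_eq_square)
      have b: "(sqrt has_real_derivative inverse (sqrt (\<sigma> / (t - \<sigma>))) / 2) (at (\<sigma> / (t - \<sigma>)))"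
        using s by (intro DERIV_real_sqrt) auto
      show ?thesis
        using DERIV_chain2[OF b a] unfolding w_def[abs_def] w'_def W_def by (simp add: field_simps)
    qed
    have gd1: "((\<lambda>\<sigma>. r * w \<sigma> - y / w \<sigma>) has_real_derivative (r + y / (W * W)) * w') (at \<sigma>)"
      using W by (auto intro!: derivative_eq_intros dw simp: W_def[symmetric] field_simps)
    have d1: "((\<lambda>\<sigma>. gauss_cdf t (r * w \<sigma> - y / w \<sigma>)) has_real_derivative
        gauss t (r * W - y / W) * ((r + y / (W * W)) * w')) (at \<sigma>)"
      using DERIV_chain2[OF DERIV_gauss_cdf[OF t] gd1] by (simp add: W_def)
    have gd2: "((\<lambda>\<sigma>. r * w \<sigma> + y / w \<sigma>) has_real_derivative (r - y / (W * W)) * w') (at \<sigma>)"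
      using W by (auto intro!: derivative_eq_intros dw simp: W_def[symmetric] field_simps)
    have d2: "((\<lambda>\<sigma>. gauss_cdf t (r * w \<sigma> + y / w \<sigma>)) has_real_derivative
        gauss t (r * W + y / W) * ((r - y / (W * W)) * w')) (at \<sigma>)"
      using DERIV_chain2[OF DERIV_gauss_cdf[OF t] gd2] by (simp add: W_def)
    have e: "exp (2 * r * y / t) * gauss t (r * W + y / W) = gauss t (r * W - y / W)"
    proof -
      have "2 * r * y / t + - (r * W + y / W)\<^sup>2 / (2 * t) = - (r * W - y / W)\<^sup>2 / (2 * t)"
        using t W by (simp add: field_simps power2_eq_square)
      then show ?thesis by (simp add: gauss_def flip: exp_add)
    qed
    have "(A has_real_derivative gauss t (y + r) * (gauss t (r * W - y / W) * ((r + y / (W * W)) * w') +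
        exp (2 * r * y / t) * (gauss t (r * W + y / W) * ((r - y / (W * W)) * w')))) (at \<sigma>)"
      unfolding A_def[abs_def] by (intro DERIV_cmult DERIV_add d1 d2)
    also have "gauss t (y + r) * (gauss t (r * W - y / W) * ((r + y / (W * W)) * w') +
        exp (2 * r * y / t) * (gauss t (r * W + y / W) * ((r - y / (W * W)) * w'))) =
        gauss t (y + r) * gauss t (r * W - y / W) * (2 * r * w')"
      unfolding e[symmetric] by (simp add: algebra_simps)
    also have "\<dots> = k \<sigma>"
    proof -
      have "- (y + r)\<^sup>2 / (2 * t) + - (r * W - y / W)\<^sup>2 / (2 * t) = - y\<^sup>2 / (2 * \<sigma>) + - r\<^sup>2 / (2 * (t - \<sigma>))"
      proof -
        \<comment> \<open>The mixed terms 2 * y * r cancel, and 1 + 1 / W^2 = t / \<sigma>, 1 + W^2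
          = t / (t - \<sigma>).\<close>
        have "(y + r)\<^sup>2 + (r * W - y / W)\<^sup>2 = y\<^sup>2 * (1 + 1 / (W * W)) + r\<^sup>2 * (1 + W * W)"
          using W by (simp add: field_simps power2_eq_square)
        also have "\<dots> = y\<^sup>2 * (t / \<sigma>) + r\<^sup>2 * (t / (t - \<sigma>))"
          using s unfolding W2 by (simp add: field_simps)
        finally have q: "(r * W - y / W)\<^sup>2 = y\<^sup>2 * (t / \<sigma>) + r\<^sup>2 * (t / (t - \<sigma>)) - (y + r)\<^sup>2" by simp
        show ?thesis unfolding q using s t by (simp add: field_simps)
      qed
      then have E: "exp (- (y + r)\<^sup>2 / (2 * t)) * exp (- (r * W - y / W)\<^sup>2 / (2 * t)) =
          exp (- y\<^sup>2 / (2 * \<sigma>)) * exp (- r\<^sup>2 / (2 * (t - \<sigma>)))"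
        by (simp flip: exp_add)
      have S: "sqrt (2 * pi * t) * sqrt (2 * pi * t) = 2 * pi * t"
        using t by simp
      have S': "sqrt (2 * pi * \<sigma>) * sqrt (2 * pi * (t - \<sigma>)) = 2 * pi * (W * (t - \<sigma>))"
      proof -
        have "W * (t - \<sigma>) = sqrt (W * W * ((t - \<sigma>) * (t - \<sigma>)))"
          using W s by (simp add: real_sqrt_mult)
        also have "\<dots> = sqrt \<sigma> * sqrt (t - \<sigma>)"
          using s unfolding W2 by (simp add: real_sqrt_mult[symmetric])
        finally have "W * (t - \<sigma>) = sqrt \<sigma> * sqrt (t - \<sigma>)" .
        moreover have "sqrt (2 * pi * \<sigma>) * sqrt (2 * pi * (t - \<sigma>)) =
            (sqrt (2 * pi) * sqrt (2 * pi)) * (sqrt \<sigma> * sqrt (t - \<sigma>))"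
          by (simp only: real_sqrt_mult mult_ac)
        ultimately show ?thesis by (simp only: real_sqrt_mult_self) simp
      qed
      have "gauss t (y + r) * gauss t (r * W - y / W) =
          exp (- y\<^sup>2 / (2 * \<sigma>)) * exp (- r\<^sup>2 / (2 * (t - \<sigma>))) / (2 * pi * t)"
        unfolding gauss_def times_divide_times_eq E S ..
      moreover have "k \<sigma> = exp (- y\<^sup>2 / (2 * \<sigma>)) * exp (- r\<^sup>2 / (2 * (t - \<sigma>))) / (2 * pi * (W * (t - \<sigma>))) * (r / (t - \<sigma>))"
        unfolding k_def gauss_def S'[symmetric] by (simp add: mult_ac)
      ultimately show ?thesis
        unfolding w'_def
      proof -
        define d X where "d = t - \<sigma>" and "X = exp (- y\<^sup>2 / (2 * \<sigma>)) * exp (- r\<^sup>2 / (2 * (t - \<sigma>)))"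
        have d: "d > 0" using s by (simp add: d_def)
        assume P: "gauss t (y + r) * gauss t (r * W - y / W) =
            exp (- y\<^sup>2 / (2 * \<sigma>)) * exp (- r\<^sup>2 / (2 * (t - \<sigma>))) / (2 * pi * t)"
          and k: "k \<sigma> = exp (- y\<^sup>2 / (2 * \<sigma>)) * exp (- r\<^sup>2 / (2 * (t - \<sigma>))) / (2 * pi * (W * (t - \<sigma>))) * (r / (t - \<sigma>))"
        show "gauss t (y + r) * gauss t (r * W - y / W) * (2 * r * (t / (t - \<sigma>)\<^sup>2 / (2 * W))) = k \<sigma>"
          unfolding P k unfolding X_def[symmetric] unfolding d_def[symmetric]
          using d t W by (simp add: field_simps power2_eq_square)
      qed
    qed
    finally show ?thesis .
  qed
  have cw: "isCont w \<sigma>" if "\<sigma> < t" for \<sigma>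
    unfolding w_def[abs_def] using that by (intro continuous_intros) auto
  have w0: "filterlim w (at_right 0) (at_right 0)"
  proof (rule tendsto_imp_filterlim_at_right)
    show "(w \<longlongrightarrow> 0) (at_right 0)"
      using cw[of 0] t by (auto simp: isCont_def w_def intro: tendsto_within_subset)
    show "\<forall>\<^sub>F \<sigma> in at_right 0. 0 < w \<sigma>"
      using eventually_at_right_less[of 0] eventually_at_right_real[OF t]
      by eventually_elim (simp add: w_def)
  qed
  have wt: "filterlim w at_top (at_left t)"
  proof -
    have "filterlim (\<lambda>\<sigma>. t - \<sigma>) (at_right 0) (at_left t)"
    proof (rule tendsto_imp_filterlim_at_right)
      show "((\<lambda>\<sigma>. t - \<sigma>) \<longlongrightarrow> 0) (at_left t)"
        by (auto intro!: tendsto_eq_intros)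
      show "\<forall>\<^sub>F \<sigma> in at_left t. 0 < t - \<sigma>"
        by (rule eventually_mono[OF eventually_at_left_real[OF t]]) auto
    qed
    then have "filterlim (\<lambda>\<sigma>. inverse (t - \<sigma>)) at_top (at_left t)"
      by (rule filterlim_compose[OF filterlim_inverse_at_top_right])
    then have "filterlim (\<lambda>\<sigma>. \<sigma> * inverse (t - \<sigma>)) at_top (at_left t)"
      by (rule filterlim_tendsto_pos_mult_at_top[OF tendsto_ident_at t])
    then show ?thesis
      unfolding w_def[abs_def] divide_inverse by (rule filterlim_compose[OF sqrt_at_top])
  qed
  have c: "isCont (gauss_cdf t) x" for x by (rule DERIV_isCont[OF DERIV_gauss_cdf[OF t]])
  have A0: "(A \<longlongrightarrow> gauss t (y + r) * l) (at_right 0)"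
  proof (cases "y = 0")
    case True
    have half: "gauss_cdf t 0 = 1 / 2" using gauss_cdf_minus[OF t, of 0] by simp
    have "((\<lambda>\<sigma>. gauss_cdf t (r * w \<sigma>)) \<longlongrightarrow> gauss_cdf t (r * 0)) (at_right 0)"
      using w0 by (intro isCont_tendsto_compose[OF c] tendsto_intros) (auto simp: filterlim_at)
    then have lim: "((\<lambda>\<sigma>. gauss_cdf t (r * w \<sigma>)) \<longlongrightarrow> 1 / 2) (at_right 0)" using half by simp
    have "((\<lambda>\<sigma>. gauss t (y + r) * (gauss_cdf t (r * w \<sigma>) + 1 * gauss_cdf t (r * w \<sigma>)))
        \<longlongrightarrow> gauss t (y + r) * (1 / 2 + 1 * (1 / 2))) (at_right 0)"
      by (intro tendsto_intros lim)
    then show ?thesis using True by (simp add: l_def A_def[abs_def])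
  next
    case False
    have wi: "filterlim (\<lambda>\<sigma>. y / w \<sigma>) at_top (at_right 0)"
      unfolding divide_inverse using False y
      by (intro filterlim_tendsto_pos_mult_at_top[OF tendsto_const]
          filterlim_compose[OF filterlim_inverse_at_top_right w0]) auto
    have rw: "((\<lambda>\<sigma>. r * w \<sigma>) \<longlongrightarrow> r * 0) (at_right 0)"
      using w0 by (intro tendsto_intros) (auto simp: filterlim_at)
    have "filterlim (\<lambda>\<sigma>. r * w \<sigma> + y / w \<sigma>) at_top (at_right 0)"
      by (rule filterlim_tendsto_add_at_top[OF rw wi])
    moreover have "filterlim (\<lambda>\<sigma>. r * w \<sigma> - y / w \<sigma>) at_bot (at_right 0)"
      using filterlim_tendsto_add_at_top[OF tendsto_minus[OF rw] wi]
      by (simp add: filterlim_uminus_at_bot)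
    ultimately have "(A \<longlongrightarrow> gauss t (y + r) * (0 + exp (2 * r * y / t) * 1)) (at_right 0)"
      unfolding A_def[abs_def]
      by (intro tendsto_intros filterlim_compose[OF gauss_cdf_at_top[OF t]]
          filterlim_compose[OF gauss_cdf_at_bot[OF t]])
    then show ?thesis using False by (simp add: l_def)
  qed
  have At: "(A \<longlongrightarrow> gauss t (y + r) * (1 + exp (2 * r * y / t) * 1)) (at_left t)"
  proof -
    have wi: "((\<lambda>\<sigma>. y / w \<sigma>) \<longlongrightarrow> 0) (at_left t)"
      by (rule tendsto_divide_0[OF tendsto_const]) (rule filterlim_at_top_imp_at_infinity[OF wt])
    have rw: "filterlim (\<lambda>\<sigma>. r * w \<sigma>) at_top (at_left t)"
      using r by (intro filterlim_tendsto_pos_mult_at_top[OF tendsto_const _ wt])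
    have "filterlim (\<lambda>\<sigma>. r * w \<sigma> + y / w \<sigma>) at_top (at_left t)"
      using filterlim_tendsto_add_at_top[OF wi rw] by (simp add: add.commute)
    moreover have "filterlim (\<lambda>\<sigma>. r * w \<sigma> - y / w \<sigma>) at_top (at_left t)"
      using filterlim_tendsto_add_at_top[OF tendsto_minus[OF wi] rw] by (simp add: add.commute)
    ultimately show ?thesis
      unfolding A_def[abs_def]
      by (intro tendsto_intros filterlim_compose[OF gauss_cdf_at_top[OF t]])
  qed
  have l: "(1 + exp (2 * r * y / t) * 1) - l = 1" by (simp add: l_def)
  have FTC: "set_integrable lborel (einterval (ereal 0) (ereal t)) k"
      "(LBINT \<sigma>=ereal 0..ereal t. k \<sigma>) = gauss t (y + r) * (1 + exp (2 * r * y / t) * 1) - gauss t (y + r) * l"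
  proof -
    have 1: "(A has_real_derivative k \<sigma>) (at \<sigma>)" "isCont k \<sigma>"
      if "ereal 0 < ereal \<sigma>" "ereal \<sigma> < ereal t" for \<sigma>
    proof -
      have s: "0 < \<sigma>" "\<sigma> < t" using that by auto
      show "(A has_real_derivative k \<sigma>) (at \<sigma>)" by (rule dA[OF s])
      show "isCont k \<sigma>" unfolding k_def gauss_def using s by (intro continuous_intros) auto
    qed
    have "0 \<le> k \<sigma>" if "0 < \<sigma>" "\<sigma> < t" for \<sigma>
      using that r by (simp add: k_def)
    then have 2: "AE \<sigma> in lborel. ereal 0 < ereal \<sigma> \<longrightarrow> ereal \<sigma> < ereal t \<longrightarrow> 0 \<le> k \<sigma>" by auto
    have 3: "((A \<circ> real_of_ereal) \<longlongrightarrow> gauss t (y + r) * l) (at_right (ereal 0))"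
      "((A \<circ> real_of_ereal) \<longlongrightarrow> gauss t (y + r) * (1 + exp (2 * r * y / t) * 1)) (at_left (ereal t))"
      using A0 At by (simp_all only: ereal_tendsto_simps)
    have 4: "ereal 0 < ereal t" using t by simp
    show "set_integrable lborel (einterval (ereal 0) (ereal t)) k"
      "(LBINT \<sigma>=ereal 0..ereal t. k \<sigma>) = gauss t (y + r) * (1 + exp (2 * r * y / t) * 1) - gauss t (y + r) * l"
      using interval_integral_FTC_nonneg[OF 4 1 2 3] by blast+
  qed
  show "set_integrable lborel {0<..<t} k" using FTC(1) by simp
  show "(LINT \<sigma>:{0<..<t}|lborel. k \<sigma>) = gauss t (y + r)"
    using FTC(2) t l by (simp add: interval_lebesgue_integral_def flip: right_diff_distrib)
qed

context robin
begin

text \<open>Integration by parts turns the boundary value into an average of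
  \<open>robin_int\<close> against r / t * gauss t r. As a function of t this is the density of the
  hitting time of 0 from r, the same factor as in \<open>gauss_last_exit\<close>.\<close>

lemma heat_robin_ext_0:
  assumes t: "t > 0"
  shows "heat t (robin_ext \<kappa> h) 0 = 2 * (LINT r:{0..}|lborel. robin_int \<kappa> h r * (r / t * gauss t r))"
proof -
  note ints = set_integrable_Ici[OF h_gauss_integrable(1)[OF t], of 0 0]
    set_integrable_Ici[OF robin_int_gauss_integrable(1)[OF t], of 0 0]
  have "heat t (robin_ext \<kappa> h) 0 = (LINT y:{0..}|lborel. robin_ext \<kappa> h y * gauss t (0 - y))
      + (LINT r:{0..}|lborel. robin_ext \<kappa> h (- r) * gauss t (0 - (- r)))"
    unfolding heat_eq_gauss[OF t]
    by (rule integral_half_lines[OF heat_integrable[OF t robin_ext_measurable robin_ext_bound]])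
  also have "(LINT y:{0..}|lborel. robin_ext \<kappa> h y * gauss t (0 - y)) = (LINT r:{0..}|lborel. h r * gauss t (0 + r))"
    by (intro set_lebesgue_integral_cong) auto
  also have "(LINT r:{0..}|lborel. robin_ext \<kappa> h (- r) * gauss t (0 - (- r))) =
      (LINT r:{0..}|lborel. h r * gauss t (0 + r) - 2 * \<kappa> * (robin_int \<kappa> h r * gauss t (0 + r)))"
    by (intro set_lebesgue_integral_cong) (auto simp: robin_ext_minus algebra_simps)
  also have "\<dots> = (LINT r:{0..}|lborel. h r * gauss t (0 + r)) - 2 * \<kappa> * (LINT r:{0..}|lborel. robin_int \<kappa> h r * gauss t (0 + r))"
    using ints by (simp only: set_integral_diff set_integrable_mult_right set_integral_mult_right)
  finally show ?thesis
    using robin_int_by_parts[OF t, of 0] by simp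
qed

text \<open>The even extension of h belongs to reflected Brownian motion, the case without killing;
  what remains is the integral term of \<open>robin_ext\<close>.\<close>

lemma heat_robin_ext_diff:
  assumes t: "t > 0" and y: "y \<ge> 0"
  shows "heat t (robin_ext \<kappa> h) y =
    heat t (\<lambda>z. h \<bar>z\<bar>) y - 2 * \<kappa> * (LINT r:{0..}|lborel. robin_int \<kappa> h r * gauss t (y + r))"
proof -
  have m: "(\<lambda>z. h \<bar>z\<bar>) \<in> borel_measurable borel" by measurable
  have habs: "integrable lborel (\<lambda>z. h \<bar>z\<bar> * gauss t (y - z))"
    by (rule heat_integrable[OF t m h_bound])
  note ints = set_integrable_Ici[OF h_gauss_integrable(1)[OF t], of 0 y]
    set_integrable_Ici[OF robin_int_gauss_integrable(1)[OF t], of 0 y]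
  have "heat t (robin_ext \<kappa> h) y = (LINT z:{0..}|lborel. robin_ext \<kappa> h z * gauss t (y - z))
      + (LINT r:{0..}|lborel. robin_ext \<kappa> h (- r) * gauss t (y - (- r)))"
    unfolding heat_eq_gauss[OF t]
    by (rule integral_half_lines[OF heat_integrable[OF t robin_ext_measurable robin_ext_bound]])
  also have "(LINT z:{0..}|lborel. robin_ext \<kappa> h z * gauss t (y - z)) = (LINT z:{0..}|lborel. h \<bar>z\<bar> * gauss t (y - z))"
    by (intro set_lebesgue_integral_cong) auto
  also have "(LINT r:{0..}|lborel. robin_ext \<kappa> h (- r) * gauss t (y - (- r))) =
      (LINT r:{0..}|lborel. h r * gauss t (y + r) - 2 * \<kappa> * (robin_int \<kappa> h r * gauss t (y + r)))"
    by (intro set_lebesgue_integral_cong) (auto simp: robin_ext_minus algebra_simps)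
  also have "\<dots> = (LINT r:{0..}|lborel. h r * gauss t (y + r)) - 2 * \<kappa> * (LINT r:{0..}|lborel. robin_int \<kappa> h r * gauss t (y + r))"
    using ints by (simp only: set_integral_diff set_integrable_mult_right set_integral_mult_right)
  also have "(LINT r:{0..}|lborel. h r * gauss t (y + r)) = (LINT r:{0..}|lborel. h \<bar>- r\<bar> * gauss t (y - (- r)))"
    by (intro set_lebesgue_integral_cong) auto
  finally show ?thesis
    unfolding heat_eq_gauss[OF t] integral_half_lines[OF habs] by simp
qed

text \<open>In the correction term of \<open>heat_robin_ext_diff\<close> the factor gauss t (y + r)
  is expanded by \<open>gauss_last_exit\<close>. After Fubini the integral over r is half of the
  boundary value, by \<open>heat_robin_ext_0\<close>.\<close>

lemma robin_duhamel_nonneg: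
  assumes t: "t > 0" and y: "y \<ge> 0"
  shows "heat t (robin_ext \<kappa> h) y = heat t (\<lambda>z. h \<bar>z\<bar>) y
    - \<kappa> * (LINT \<sigma>:{0<..<t}|lborel. heat (t - \<sigma>) (robin_ext \<kappa> h) 0 * gauss \<sigma> y)"
proof -
  define k where "k r \<sigma> = gauss \<sigma> y * (r / (t - \<sigma>) * gauss (t - \<sigma>) r)" for r \<sigma>
  define K where "K r \<sigma> = (indicator {0<..} r * robin_int \<kappa> h r) * (indicator {0<..<t} \<sigma> * k r \<sigma>)" for r \<sigma> :: real
  have k0: "k r \<sigma> \<ge> 0" if "0 < r" "0 < \<sigma>" "\<sigma> < t" for r \<sigma>
    using that by (simp add: k_def)
  have kint: "integrable lborel (\<lambda>\<sigma>. indicator {0<..<t} \<sigma> * k r \<sigma>)" "(\<integral>\<sigma>. indicator {0<..<t} \<sigma> * k r \<sigma> \<partial>lborel) = gauss t (y + r)"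
    if "0 < r" for r
    using gauss_last_exit[OF t y that] unfolding k_def by (simp_all add: set_integrable_def set_lebesgue_integral_def)
  have [measurable]: "case_prod K \<in> borel_measurable (lborel \<Otimes>\<^sub>M lborel)"
    unfolding K_def k_def by measurable
  \<comment> \<open>As k is nonnegative, the integral of the norm is given by the same
    decomposition; this is the absolute integrability for Fubini.\<close>
  have norm: "(\<integral>\<sigma>. norm (K r \<sigma>) \<partial>lborel) = norm (indicator {0<..} r * (robin_int \<kappa> h r * gauss t (y + r)))" for r
  proof (cases "0 < r")
    case True
    have "norm (K r \<sigma>) = \<bar>robin_int \<kappa> h r\<bar> * (indicator {0<..<t} \<sigma> * k r \<sigma>)" for \<sigma>
      using k0[OF True, of \<sigma>] True by (auto simp: K_def abs_mult split: split_indicator)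
    then show ?thesis using kint[OF True] True t by (simp add: abs_mult)
  qed (simp add: K_def)
  have I1: "integrable lborel (\<lambda>r. indicator {0<..} r * (robin_int \<kappa> h r * gauss t (y + r)))"
    using set_integrable_of_integrable[OF robin_int_gauss_integrable(1)[OF t, of y], of "{0<..}"]
    by (simp add: set_integrable_def)
  have int: "integrable (lborel \<Otimes>\<^sub>M lborel) (case_prod K)"
  proof (rule lborel_pair.Fubini_integrable)
    show "integrable lborel (\<lambda>r. \<integral>\<sigma>. norm (case_prod K (r, \<sigma>)) \<partial>lborel)"
      using integrable_norm[OF I1] by (simp only: prod.case norm)
    show "AE r in lborel. integrable lborel (\<lambda>\<sigma>. case_prod K (r, \<sigma>))"
    proof (intro AE_I2)
      fix r :: real
      show "integrable lborel (\<lambda>\<sigma>. case_prod K (r, \<sigma>))"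
        using kint(1)[of r] by (cases "0 < r") (auto simp: K_def)
    qed
  qed simp
  have "(LINT \<sigma>:{0<..<t}|lborel. heat (t - \<sigma>) (robin_ext \<kappa> h) 0 * gauss \<sigma> y) =
      (\<integral>\<sigma>. 2 * (\<integral>r. K r \<sigma> \<partial>lborel) \<partial>lborel)"
    unfolding set_lebesgue_integral_def
  proof (intro Bochner_Integration.integral_cong refl)
    fix \<sigma> :: real
    show "indicator {0<..<t} \<sigma> *\<^sub>R (heat (t - \<sigma>) (robin_ext \<kappa> h) 0 * gauss \<sigma> y) = 2 * (\<integral>r. K r \<sigma> \<partial>lborel)"
    proof (cases "\<sigma> \<in> {0<..<t}")
      case True
      have "(\<integral>r. K r \<sigma> \<partial>lborel) = (\<integral>r. gauss \<sigma> y * (indicator {0<..} r *\<^sub>R (robin_int \<kappa> h r * (r / (t - \<sigma>) * gauss (t - \<sigma>) r))) \<partial>lborel)"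
        using True by (intro Bochner_Integration.integral_cong) (auto simp: K_def k_def)
      then show ?thesis
        using True heat_robin_ext_0[of "t - \<sigma>"]
        by (simp add: set_integral_Ici_eq_Ioi) (simp add: set_lebesgue_integral_def)
    qed (simp add: K_def)
  qed
  also have "\<dots> = 2 * (\<integral>r. (\<integral>\<sigma>. K r \<sigma> \<partial>lborel) \<partial>lborel)"
    using lborel_pair.Fubini_integral[OF int] by simp
  also have "(\<integral>r. (\<integral>\<sigma>. K r \<sigma> \<partial>lborel) \<partial>lborel) = (LINT r:{0..}|lborel. robin_int \<kappa> h r * gauss t (y + r))"
    unfolding set_integral_Ici_eq_Ioi unfolding set_lebesgue_integral_def
  proof (intro Bochner_Integration.integral_cong refl)
    fix r :: real
    show "(\<integral>\<sigma>. K r \<sigma> \<partial>lborel) = indicator {0<..} r *\<^sub>R (robin_int \<kappa> h r * gauss t (y + r))"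
      using kint(2)[of r] by (cases "0 < r") (auto simp: K_def)
  qed
  finally show ?thesis
    using heat_robin_ext_diff[OF t y] by simp
qed

end

lemma heat_even:
  assumes "\<And>z. F (- z) = F z"
  shows "heat t F (- y) = heat t F y"
proof -
  have "heat t F (- y) = (\<integral>z. F (- y + sqrt t * - z) * std_normal_density (- z) \<partial>lborel)"
    unfolding heat_def using lborel_integral_real_affine[of "-1" "\<lambda>z. F (- y + sqrt t * z) * std_normal_density z" 0] by simp
  also have "\<dots> = heat t F y"
    unfolding heat_def
  proof (intro Bochner_Integration.integral_cong refl)
    fix z
    show "F (- y + sqrt t * - z) * std_normal_density (- z) = F (y + sqrt t * z) * std_normal_density z"
      using assms[of "y + sqrt t * z"] by (simp add: normal_density_def)
  qed
  finally show ?thesis .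
qed

lemma (in robin) robin_duhamel:
  assumes t: "t > 0"
  shows "heat t (robin_ext \<kappa> h) \<bar>y\<bar> = heat t (\<lambda>z. h \<bar>z\<bar>) y
    - \<kappa> * (LINT \<sigma>:{0<..<t}|lborel. heat (t - \<sigma>) (robin_ext \<kappa> h) 0 * gauss \<sigma> y)"
  using robin_duhamel_nonneg[OF t abs_ge_zero[of y]] heat_even[of "\<lambda>z. h \<bar>z\<bar>" t y]
  by (auto simp: abs_if split: if_splits)

section \<open>The Markov property of Brownian motion\<close>

lemma floor_dyadic_LIMSEQ:
  fixes x :: real
  shows "(\<lambda>n. \<lfloor>2 ^ n * x\<rfloor> / 2 ^ n) \<longlonglongrightarrow> x"
proof (rule tendsto_sandwich)
  have "(\<lambda>n. x - (1 / 2) ^ n) \<longlonglongrightarrow> x - 0"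
    by (intro tendsto_intros LIMSEQ_power_zero) auto
  then show "(\<lambda>n. x - (1 / 2) ^ n) \<longlonglongrightarrow> x" by simp
  show "\<forall>\<^sub>F n in sequentially. x - (1 / 2) ^ n \<le> \<lfloor>2 ^ n * x\<rfloor> / 2 ^ n"
  proof (intro always_eventually allI)
    fix n :: nat
    have "2 ^ n * x - 1 \<le> \<lfloor>2 ^ n * x\<rfloor>" by linarith
    then have "(2 ^ n * x - 1) / 2 ^ n \<le> \<lfloor>2 ^ n * x\<rfloor> / 2 ^ n" by (intro divide_right_mono) auto
    then show "x - (1 / 2) ^ n \<le> \<lfloor>2 ^ n * x\<rfloor> / 2 ^ n" by (simp add: diff_divide_distrib power_divide)
  qed
  show "\<forall>\<^sub>F n in sequentially. \<lfloor>2 ^ n * x\<rfloor> / 2 ^ n \<le> x"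
  proof (intro always_eventually allI)
    fix n :: nat
    show "\<lfloor>2 ^ n * x\<rfloor> / 2 ^ n \<le> x" by (simp add: pos_divide_le_eq mult.commute)
  qed
qed auto

context brownian_motion
begin

text \<open>A process with continuous paths is a pointwise limit of processes that only use
  countably many times. N is general so that the argument serves both \<open>M\<close> and
  \<open>past s\<close>.\<close>

lemma jointly_measurable:
  fixes k :: "nat \<Rightarrow> real \<Rightarrow> int" and q :: "real \<Rightarrow> real"
  assumes space: "space N = space M"
    and k: "\<And>n. k n \<in> measurable borel (count_space UNIV)"
    and e: "\<And>n i. 0 \<le> e n i" "\<And>n i. B (e n i) \<in> borel_measurable N"
    and q: "\<And>r. 0 \<le> q r" "\<And>r. (\<lambda>n. e n (k n r)) \<longlonglongrightarrow> q r"
  shows "(\<lambda>(r, \<omega>). B (q r) \<omega>) \<in> borel_measurable (borel \<Otimes>\<^sub>M N)"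
proof (rule borel_measurable_LIMSEQ_metric)
  fix n
  show "(\<lambda>(r, \<omega>). B (e n (k n r)) \<omega>) \<in> borel_measurable (borel \<Otimes>\<^sub>M N)"
    unfolding case_prod_beta
  proof (rule measurable_compose_countable'[where I = UNIV and f = "\<lambda>i x. B (e n i) (snd x)"])
    show "(\<lambda>x. B (e n i) (snd x)) \<in> borel_measurable (borel \<Otimes>\<^sub>M N)" for i
      by (rule measurable_compose[OF measurable_snd e(2)])
    show "(\<lambda>x. k n (fst x)) \<in> borel \<Otimes>\<^sub>M N \<rightarrow>\<^sub>M count_space UNIV"
      by (rule measurable_compose[OF measurable_fst k])
  qed simp
next
  fix x :: "real \<times> 'w" assume "x \<in> space (borel \<Otimes>\<^sub>M N)"
  then have \<omega>: "snd x \<in> space M" by (auto simp: space_pair_measure space)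
  have "(\<lambda>n. B (e n (k n (fst x))) (snd x)) \<longlonglongrightarrow> B (q (fst x)) (snd x)"
    by (rule continuous_on_tendsto_compose[OF continuous_paths[OF \<omega>] q(2)]) (use q(1) e(1) in auto)
  then show "(\<lambda>n. (\<lambda>(r, \<omega>). B (e n (k n r)) \<omega>) x) \<longlonglongrightarrow> (\<lambda>(r, \<omega>). B (q r) \<omega>) x"
    by (simp add: case_prod_beta)
qed

lemma measurable_max0 [measurable]:
  "(\<lambda>(r, \<omega>). B (max 0 r) \<omega>) \<in> borel_measurable (borel \<Otimes>\<^sub>M M)"
proof (rule jointly_measurable[where k = "\<lambda>n r. \<lfloor>2 ^ n * max 0 r\<rfloor>" and e = "\<lambda>n i. max 0 (real_of_int i) / 2 ^ n"])
  fix r :: real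
  have "(\<lambda>n. \<lfloor>2 ^ n * max 0 r\<rfloor> / 2 ^ n) \<longlonglongrightarrow> max 0 r" by (rule floor_dyadic_LIMSEQ)
  moreover have "max 0 (real_of_int \<lfloor>2 ^ n * max 0 r\<rfloor>) = \<lfloor>2 ^ n * max 0 r\<rfloor>" for n :: nat
    by (simp add: max_absorb2)
  ultimately show "(\<lambda>n. max 0 (real_of_int \<lfloor>2 ^ n * max 0 r\<rfloor>) / 2 ^ n) \<longlonglongrightarrow> max 0 r" by simp
qed (auto intro: random_variable)

text \<open>Dyadic grids are nested, so that the union over \<open>n\<close> of the \<open>\<sigma>\<close>-algebras below is
  intersection stable; by continuity of the paths it generates the whole past.\<close>

definition grid :: "real \<Rightarrow> nat \<Rightarrow> 'w \<Rightarrow> nat \<Rightarrow> real" where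
  "grid s n \<omega> = (\<lambda>i\<in>{..2 ^ n}. B (s * real i / 2 ^ n) \<omega>)"

definition past_gen :: "real \<Rightarrow> nat \<Rightarrow> 'w set set" where
  "past_gen s n = {grid s n -` A \<inter> space M | A. A \<in> sets (PiM {..2 ^ n} (\<lambda>_. borel))}"

definition past :: "real \<Rightarrow> 'w measure" where
  "past s = sigma (space M) (\<Union>n. past_gen s n)"

lemma grid_measurable [measurable]: "s \<ge> 0 \<Longrightarrow> grid s n \<in> measurable M (PiM {..2 ^ n} (\<lambda>_. borel))"
  unfolding grid_def by (intro measurable_restrict random_variable) auto

lemma past_gen_sets: "s \<ge> 0 \<Longrightarrow> past_gen s n \<subseteq> sets M"
  unfolding past_gen_def using measurable_sets[OF grid_measurable] by auto

lemma space_past [simp]: "space (past s) = space M"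
  unfolding past_def by (rule space_measure_of) (auto simp: past_gen_def)

lemma sets_past: "sets (past s) = sigma_sets (space M) (\<Union>n. past_gen s n)"
  unfolding past_def by (rule sets_measure_of) (auto simp: past_gen_def)

lemma sets_past_subset: "s \<ge> 0 \<Longrightarrow> sets (past s) \<subseteq> sets M"
  unfolding sets_past using past_gen_sets by (intro sets.sigma_sets_subset) auto

lemma past_measurableD: "s \<ge> 0 \<Longrightarrow> f \<in> measurable (past s) N \<Longrightarrow> f \<in> measurable M N"
  using sets_past_subset by (auto simp: measurable_def)

lemma past_gen_mono: "past_gen s n \<subseteq> past_gen s (Suc n)"
proof
  fix E assume "E \<in> past_gen s n"
  then obtain A where A: "A \<in> sets (PiM {..2 ^ n} (\<lambda>_. borel))" "E = grid s n -` A \<inter> space M"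
    by (auto simp: past_gen_def)
  \<comment> \<open>Every second point of the finer grid is a point of the coarser one.\<close>
  define \<phi> where "\<phi> v = (\<lambda>i\<in>{..2 ^ n}. v (2 * i))" for v :: "nat \<Rightarrow> real"
  have m: "\<phi> \<in> measurable (PiM {..2 ^ Suc n} (\<lambda>_. borel)) (PiM {..2 ^ n} (\<lambda>_. borel :: real measure))"
    unfolding \<phi>_def by (intro measurable_restrict measurable_component_singleton) auto
  have "grid s n \<omega> = \<phi> (grid s (Suc n) \<omega>)" for \<omega>
    by (auto simp: grid_def \<phi>_def restrict_def)
  then have "E = grid s (Suc n) -` (\<phi> -` A \<inter> space (PiM {..2 ^ Suc n} (\<lambda>_. borel))) \<inter> space M"
    using A(2) by (auto simp: grid_def space_PiM)
  then show "E \<in> past_gen s (Suc n)"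
    unfolding past_gen_def using measurable_sets[OF m A(1)] by blast
qed

lemma past_gen_Int: "E \<in> past_gen s n \<Longrightarrow> F \<in> past_gen s n \<Longrightarrow> E \<inter> F \<in> past_gen s n"
proof -
  assume "E \<in> past_gen s n" "F \<in> past_gen s n"
  then obtain A A' where "A \<in> sets (PiM {..2 ^ n} (\<lambda>_. borel))" "E = grid s n -` A \<inter> space M"
    "A' \<in> sets (PiM {..2 ^ n} (\<lambda>_. borel))" "F = grid s n -` A' \<inter> space M"
    by (auto simp: past_gen_def)
  then have "A \<inter> A' \<in> sets (PiM {..2 ^ n} (\<lambda>_. borel))" "E \<inter> F = grid s n -` (A \<inter> A') \<inter> space M"
    by auto
  then show ?thesis unfolding past_gen_def by blast
qed

lemma Int_stable_past_gen: "Int_stable (\<Union>n. past_gen s n)"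
proof (rule Int_stableI)
  fix E F assume "E \<in> (\<Union>n. past_gen s n)" "F \<in> (\<Union>n. past_gen s n)"
  then obtain n m where "E \<in> past_gen s n" "F \<in> past_gen s m" by blast
  moreover have "past_gen s n \<subseteq> past_gen s (max n m)" "past_gen s m \<subseteq> past_gen s (max n m)"
    by (rule lift_Suc_mono_le[of "past_gen s", OF past_gen_mono], simp)+
  ultimately have "E \<inter> F \<in> past_gen s (max n m)" by (intro past_gen_Int) (auto dest: subsetD)
  then show "E \<inter> F \<in> (\<Union>n. past_gen s n)" by auto
qed

lemma grid_past_measurable: "i \<le> 2 ^ n \<Longrightarrow> B (s * real i / 2 ^ n) \<in> borel_measurable (past s)"
proof (rule measurableI)
  fix A :: "real set" assume i: "i \<le> 2 ^ n" and A: "A \<in> sets borel"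
  have "B (s * real i / 2 ^ n) -` A \<inter> space M =
      grid s n -` ((\<lambda>v. v i) -` A \<inter> space (PiM {..2 ^ n} (\<lambda>_. borel))) \<inter> space M"
    using i by (auto simp: grid_def space_PiM)
  moreover have "(\<lambda>v. v i) -` A \<inter> space (PiM {..2 ^ n} (\<lambda>_. borel)) \<in> sets (PiM {..2 ^ n} (\<lambda>_. borel))"
    using i A by (intro measurable_sets[OF measurable_component_singleton]) auto
  ultimately have "B (s * real i / 2 ^ n) -` A \<inter> space M \<in> past_gen s n"
    unfolding past_gen_def by blast
  then show "B (s * real i / 2 ^ n) -` A \<inter> space (past s) \<in> sets (past s)"
    unfolding sets_past by auto
qed simp

lemma past_measurable_self: "B s \<in> borel_measurable (past s)"
  using grid_past_measurable[of 1 0 s] by simp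

text \<open>Grid indices are clamped to {0..2 ^ n}: measurability with respect to the past is
  demanded for every integer index, including those which the floor never attains.\<close>

lemma past_jointly_measurable:
  assumes s: "s > 0"
  shows "(\<lambda>(r, \<omega>). B (max 0 (min s r)) \<omega>) \<in> borel_measurable (borel \<Otimes>\<^sub>M past s)"
proof (rule jointly_measurable[where k = "\<lambda>n r. \<lfloor>2 ^ n * (max 0 (min s r) / s)\<rfloor>"
      and e = "\<lambda>n i. s * real (nat (min (2 ^ n) i)) / 2 ^ n"])
  fix n :: nat and i :: int
  have "nat (min (2 ^ n) i) \<le> 2 ^ n" by (simp add: nat_le_iff)
  then show "B (s * real (nat (min (2 ^ n) i)) / 2 ^ n) \<in> borel_measurable (past s)"
    by (rule grid_past_measurable)
next
  fix r
  define y where "y = max 0 (min s r) / s"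
  have y: "0 \<le> y" "y \<le> 1" using s by (auto simp: y_def)
  have "(\<lambda>n. s * (\<lfloor>2 ^ n * y\<rfloor> / 2 ^ n)) \<longlonglongrightarrow> s * y"
    by (intro tendsto_intros floor_dyadic_LIMSEQ)
  moreover have "real (nat (min (2 ^ n) \<lfloor>2 ^ n * y\<rfloor>)) = \<lfloor>2 ^ n * y\<rfloor>" for n :: nat
  proof -
    have "2 ^ n * y \<le> 2 ^ n" using y by simp
    then have "\<lfloor>2 ^ n * y\<rfloor> \<le> \<lfloor>2 ^ n :: real\<rfloor>" by (rule floor_mono)
    then have "\<lfloor>2 ^ n * y\<rfloor> \<le> 2 ^ n" using floor_of_int[of "2 ^ n", where ?'a = real] by simp
    then show ?thesis using y by simp
  qed
  ultimately show "(\<lambda>n. s * real (nat (min (2 ^ n) \<lfloor>2 ^ n * (max 0 (min s r) / s)\<rfloor>)) / 2 ^ n) \<longlonglongrightarrow> max 0 (min s r)"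
    using s by (simp add: y_def)
qed (use s in auto)

text \<open>Almost surely the grid values are x plus partial sums of the increments over the grid.
  The increment from s to t is appended to these as one more, and independence of increments applies
  to the whole list.\<close>

lemma increment_indep_past_gen:
  assumes s: "0 < s" and st: "s < t"
    and E: "E \<in> past_gen s n" and D: "D \<in> sets borel"
  defines "Z \<equiv> \<lambda>\<omega>. B t \<omega> - B s \<omega>"
  shows "prob (E \<inter> (Z -` D \<inter> space M)) = prob E * prob (Z -` D \<inter> space M)"
proof -
  define N :: nat where "N = 2 ^ n"
  have N: "N > 0" by (simp add: N_def)
  obtain A where A: "A \<in> sets (PiM {..N} (\<lambda>_. borel))" "E = grid s n -` A \<inter> space M"
    using E by (auto simp: past_gen_def N_def)
  \<comment> \<open>Here \<open>\<tau> N\<close> is s and \<open>\<tau> (Suc N)\<close> is t, so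
    increment number N is Z.\<close>
  define \<tau> where "\<tau> i = (if i \<le> N then s * real i / N else t)" for i
  define X where "X i \<omega> = B (\<tau> (Suc i)) \<omega> - B (\<tau> i) \<omega>" for i \<omega>
  have "indep_vars (\<lambda>_. borel) X {..<Suc N}"
    unfolding X_def
  proof (rule independent_increments)
    fix i assume "i < Suc N"
    then show "\<tau> i < \<tau> (Suc i)"
      using s st N by (auto simp: \<tau>_def divide_strict_right_mono less_Suc_eq)
  qed (simp add: \<tau>_def)
  then have ind: "indep_var (PiM {..<N} (\<lambda>_. borel)) (\<lambda>\<omega>. \<lambda>i\<in>{..<N}. X i \<omega>) (PiM {N} (\<lambda>_. borel)) (\<lambda>\<omega>. \<lambda>i\<in>{N}. X i \<omega>)"
    by (rule indep_var_restrict) auto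
  define \<phi> where "\<phi> d = (\<lambda>i\<in>{..N}. x + (\<Sum>j<i. d j))" for d :: "nat \<Rightarrow> real"
  have \<phi>: "\<phi> \<in> measurable (PiM {..<N} (\<lambda>_. borel)) (PiM {..N} (\<lambda>_. borel))"
    unfolding \<phi>_def
    by (intro measurable_restrict borel_measurable_add borel_measurable_sum measurable_component_singleton) auto
  have XN: "X N = Z" using N by (auto simp: X_def Z_def \<tau>_def fun_eq_iff)
  have D': "(\<lambda>v. v N) -` D \<inter> space (PiM {N} (\<lambda>_. borel)) \<in> sets (PiM {N} (\<lambda>_. borel))"
    using D by (intro measurable_sets[OF measurable_component_singleton]) auto
  define E' where "E' = (\<lambda>\<omega>. \<lambda>i\<in>{..<N}. X i \<omega>) -` (\<phi> -` A \<inter> space (PiM {..<N} (\<lambda>_. borel))) \<inter> space M"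
  have ZD: "(\<lambda>\<omega>. \<lambda>i\<in>{N}. X i \<omega>) -` ((\<lambda>v. v N) -` D \<inter> space (PiM {N} (\<lambda>_. borel))) \<inter> space M = Z -` D \<inter> space M"
    by (auto simp: space_PiM XN)
  \<comment> \<open>The events agree only up to a null set, since the starting point is x only
    almost surely.\<close>
  have AE: "AE \<omega> in M. \<omega> \<in> E \<longleftrightarrow> \<omega> \<in> E'"
    using start
  proof (eventually_elim)
    fix \<omega> assume \<omega>: "B 0 \<omega> = x"
    have "\<phi> (\<lambda>i\<in>{..<N}. X i \<omega>) = grid s n \<omega>"
    proof
      fix i
      show "\<phi> (\<lambda>i\<in>{..<N}. X i \<omega>) i = grid s n \<omega> i"
      proof (cases "i \<le> N")
        case True
        have "(\<Sum>j<i. (\<lambda>i\<in>{..<N}. X i \<omega>) j) = (\<Sum>j<i. B (\<tau> (Suc j)) \<omega> - B (\<tau> j) \<omega>)"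
          using True by (intro sum.cong) (auto simp: X_def)
        also have "\<dots> = B (\<tau> i) \<omega> - B (\<tau> 0) \<omega>" by (rule sum_lessThan_telescope)
        finally show ?thesis using True \<omega> by (simp add: \<phi>_def grid_def N_def[symmetric] \<tau>_def) (simp add: N_def)
      qed (simp add: \<phi>_def grid_def N_def)
    qed
    then show "\<omega> \<in> E \<longleftrightarrow> \<omega> \<in> E'"
      unfolding A(2) E'_def by (auto simp: space_PiM)
  qed
  have Xm: "X i \<in> borel_measurable M" for i
    unfolding X_def using s st by (intro borel_measurable_diff random_variable) (auto simp: \<tau>_def)
  have E'm: "E' \<in> sets M"
    unfolding E'_def by (intro measurable_sets[OF measurable_restrict measurable_sets[OF \<phi> A(1)]] Xm)
  have Em: "E \<in> sets M" using past_gen_sets[of s n] s E by auto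
  have Zm: "Z -` D \<inter> space M \<in> sets M"
    using D Xm[of N] unfolding XN by (rule measurable_sets[rotated])
  have "prob (E \<inter> (Z -` D \<inter> space M)) = prob (E' \<inter> (Z -` D \<inter> space M))"
    using AE Em E'm Zm by (intro finite_measure_eq_AE) auto
  also have "\<dots> = prob E' * prob (Z -` D \<inter> space M)"
  proof -
    have "E' \<inter> (Z -` D \<inter> space M) = (\<lambda>\<omega>. (\<lambda>i\<in>{..<N}. X i \<omega>, \<lambda>i\<in>{N}. X i \<omega>)) -`
        ((\<phi> -` A \<inter> space (PiM {..<N} (\<lambda>_. borel))) \<times> ((\<lambda>v. v N) -` D \<inter> space (PiM {N} (\<lambda>_. borel)))) \<inter> space M"
      unfolding E'_def ZD[symmetric] by auto
    then show ?thesis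
      using indep_varD[OF ind measurable_sets[OF \<phi> A(1)] D'] unfolding E'_def[symmetric] ZD by simp
  qed
  also have "prob E' = prob E"
    using AE Em E'm by (intro finite_measure_eq_AE) auto
  finally show ?thesis .
qed

text \<open>Independence passes from intersection stable generators to the generated
  \<sigma>-algebras, and from there to functions measurable with respect to them.\<close>

lemma indep_past_increment:
  assumes s: "0 < s" and st: "s < t" and X: "X \<in> measurable (past s) N" and Y: "Y \<in> measurable borel N"
  shows "indep_var N X N (\<lambda>\<omega>. Y (B t \<omega> - B s \<omega>))"
proof -
  let ?Z = "\<lambda>\<omega>. B t \<omega> - B s \<omega>"
  let ?A = "{?Z -` A \<inter> space M | A. A \<in> sets borel}"
  have Z: "?Z \<in> borel_measurable M"
    using s st by (intro borel_measurable_diff random_variable) auto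
  have "indep_set (\<Union>n. past_gen s n) ?A"
    unfolding indep_sets2_eq
    using past_gen_sets[of s] s measurable_sets[OF Z] increment_indep_past_gen[OF s st] by auto
  moreover have "Int_stable ?A"
  proof (rule Int_stableI, clarify)
    fix A A' :: "real set" assume "A \<in> sets borel" "A' \<in> sets borel"
    then have "A \<inter> A' \<in> sets borel" "(?Z -` A \<inter> space M) \<inter> (?Z -` A' \<inter> space M) = ?Z -` (A \<inter> A') \<inter> space M"
      by auto
    then show "\<exists>D. (?Z -` A \<inter> space M) \<inter> (?Z -` A' \<inter> space M) = ?Z -` D \<inter> space M \<and> D \<in> sets borel"
      by blast
  qed
  ultimately have "indep_set (sets (past s)) (sigma_sets (space M) ?A)"
    unfolding sets_past by (intro indep_set_sigma_sets Int_stable_past_gen)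
  moreover have "sigma_sets (space M) {X -` A \<inter> space M | A. A \<in> sets N} \<subseteq> sets (past s)"
    using measurable_sets[OF X] by (intro sets.sigma_sets_subset[of _ "past s", simplified]) auto
  moreover have "sigma_sets (space M) {(\<lambda>\<omega>. Y (?Z \<omega>)) -` A \<inter> space M | A. A \<in> sets N} \<subseteq> sigma_sets (space M) ?A"
  proof (rule sigma_sets_mono, clarify)
    fix A assume "A \<in> sets N"
    then have "Y -` A \<in> sets borel" using measurable_sets[OF Y] by simp
    moreover have "(\<lambda>\<omega>. Y (?Z \<omega>)) -` A \<inter> space M = ?Z -` (Y -` A) \<inter> space M" by auto
    ultimately show "(\<lambda>\<omega>. Y (?Z \<omega>)) -` A \<inter> space M \<in> sigma_sets (space M) ?A" by auto
  qed
  ultimately have "indep_set (sigma_sets (space M) {X -` A \<inter> space M | A. A \<in> sets N})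
      (sigma_sets (space M) {(\<lambda>\<omega>. Y (?Z \<omega>)) -` A \<inter> space M | A. A \<in> sets N})"
    unfolding indep_sets2_eq by (metis (no_types, lifting) subset_iff)
  then show ?thesis
    unfolding indep_var_eq using past_measurableD[OF _ X] s measurable_compose[OF Z Y] by auto
qed

lemma heat_increment:
  assumes s: "0 \<le> s" and st: "s < t" and F [measurable]: "F \<in> borel_measurable borel"
  shows "expectation (\<lambda>\<omega>. F (b + (B t \<omega> - B s \<omega>))) = heat (t - s) F b"
proof -
  have "expectation (\<lambda>\<omega>. F (b + (B t \<omega> - B s \<omega>))) = (\<integral>z. normal_density 0 (sqrt (t - s)) z * F (b + z) \<partial>lborel)"
    using distributed_integral[OF gaussian_increments[OF s st], of "\<lambda>z. F (b + z)"] by simp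
  also have "\<dots> = (\<integral>z. F (b + z) * gauss (t - s) (b - (b + z)) \<partial>lborel)"
    using st by (intro Bochner_Integration.integral_cong) (auto simp: gauss_eq_normal_density[of "t - s" _ 0, simplified])
  also have "\<dots> = (\<integral>z. F z * gauss (t - s) (b - z) \<partial>lborel)"
    using lborel_integral_real_affine[of 1 "\<lambda>z. F z * gauss (t - s) (b - z)" b] by simp
  finally show ?thesis using st by (simp add: heat_eq_gauss)
qed

lemma expectation_heat:
  assumes t: "0 < t" and F [measurable]: "F \<in> borel_measurable borel"
  shows "expectation (\<lambda>\<omega>. F (B t \<omega>)) = heat t F x"
proof -
  have [measurable]: "B t \<in> borel_measurable M" "B 0 \<in> borel_measurable M"
    using t by (auto intro: random_variable)
  have "expectation (\<lambda>\<omega>. F (B t \<omega>)) = expectation (\<lambda>\<omega>. F (x + (B t \<omega> - B 0 \<omega>)))"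
    using start by (intro integral_cong_AE) auto
  then show ?thesis using heat_increment[OF _ t F, of x] by simp
qed

text \<open>The pair (W, B s) is independent of the increment after s. Integrating the increment out
  first, with the past frozen, gives the heat semigroup by \<open>heat_increment\<close>.\<close>

lemma markov:
  assumes s: "0 < s" and st: "s < t"
    and F [measurable]: "F \<in> borel_measurable borel" and Fb: "\<And>y. \<bar>F y\<bar> \<le> C"
    and W: "W \<in> borel_measurable (past s)" and Wb: "\<And>\<omega>. \<omega> \<in> space M \<Longrightarrow> \<bar>W \<omega>\<bar> \<le> K"
  shows "expectation (\<lambda>\<omega>. W \<omega> * F (B t \<omega>)) = expectation (\<lambda>\<omega>. W \<omega> * heat (t - s) F (B s \<omega>))"
proof -
  \<comment> \<open>The increment is paired with a constant 0 so that both variables take values in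
    the same space, as \<open>indep_past_increment\<close> requires.\<close>
  let ?X = "\<lambda>\<omega>. (W \<omega>, B s \<omega>)" and ?Z = "\<lambda>\<omega>. (B t \<omega> - B s \<omega>, 0 :: real)"
  have [measurable]: "B t \<in> borel_measurable M" "B s \<in> borel_measurable M" "W \<in> borel_measurable M"
    using s st past_measurableD[OF _ W] by (auto intro: random_variable)
  have "?X \<in> measurable (past s) (borel \<Otimes>\<^sub>M borel)"
    using W past_measurable_self by simp
  from indep_past_increment[OF s st this, of "\<lambda>z. (z, 0)"]
  have eq: "distr M (borel \<Otimes>\<^sub>M borel) ?X \<Otimes>\<^sub>M distr M (borel \<Otimes>\<^sub>M borel) ?Z =
      distr M ((borel \<Otimes>\<^sub>M borel) \<Otimes>\<^sub>M (borel \<Otimes>\<^sub>M borel)) (\<lambda>\<omega>. (?X \<omega>, ?Z \<omega>))"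
    by (simp add: indep_var_distribution_eq)
  interpret X: prob_space "distr M (borel \<Otimes>\<^sub>M borel) ?X" by (rule prob_space_distr) simp
  interpret Z: prob_space "distr M (borel \<Otimes>\<^sub>M borel) ?Z" by (rule prob_space_distr) simp
  interpret XZ: pair_prob_space "distr M (borel \<Otimes>\<^sub>M borel) ?X" "distr M (borel \<Otimes>\<^sub>M borel) ?Z" ..
  define \<Phi> where "\<Phi> p z = fst p * F (snd p + fst z)" for p z :: "real \<times> real"
  have [measurable]: "case_prod \<Phi> \<in> borel_measurable ((borel \<Otimes>\<^sub>M borel) \<Otimes>\<^sub>M (borel \<Otimes>\<^sub>M borel))"
    unfolding \<Phi>_def[abs_def] by measurable
  have int: "integrable M (\<lambda>\<omega>. W \<omega> * F (B t \<omega>))"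
  proof (rule integrable_const_bound[of _ "K * C"])
    show "AE \<omega> in M. norm (W \<omega> * F (B t \<omega>)) \<le> K * C"
      using Wb Fb by (intro AE_I2) (auto simp: abs_mult intro!: mult_mono intro: order_trans[OF abs_ge_zero])
  qed simp
  have "expectation (\<lambda>\<omega>. W \<omega> * F (B t \<omega>)) = expectation (\<lambda>\<omega>. case_prod \<Phi> (?X \<omega>, ?Z \<omega>))"
    by (simp add: \<Phi>_def)
  also have "\<dots> = integral\<^sup>L (distr M ((borel \<Otimes>\<^sub>M borel) \<Otimes>\<^sub>M (borel \<Otimes>\<^sub>M borel)) (\<lambda>\<omega>. (?X \<omega>, ?Z \<omega>))) (case_prod \<Phi>)"
    by (intro integral_distr[symmetric]) auto
  also have "\<dots> = (\<integral>p. \<integral>z. \<Phi> p z \<partial>distr M (borel \<Otimes>\<^sub>M borel) ?Z \<partial>distr M (borel \<Otimes>\<^sub>M borel) ?X)"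
  proof -
    have "integrable (distr M ((borel \<Otimes>\<^sub>M borel) \<Otimes>\<^sub>M (borel \<Otimes>\<^sub>M borel)) (\<lambda>\<omega>. (?X \<omega>, ?Z \<omega>))) (case_prod \<Phi>)"
      using int by (subst integrable_distr_eq) (auto simp: \<Phi>_def)
    then show ?thesis
      unfolding eq[symmetric] by (rule XZ.integral_fst[symmetric])
  qed
  also have "\<dots> = (\<integral>p. fst p * heat (t - s) F (snd p) \<partial>distr M (borel \<Otimes>\<^sub>M borel) ?X)"
    using s st by (intro Bochner_Integration.integral_cong refl) (simp add: \<Phi>_def integral_distr heat_increment)
  also have "\<dots> = expectation (\<lambda>\<omega>. W \<omega> * heat (t - s) F (B s \<omega>))"
    by (subst integral_distr) auto
  finally show ?thesis .
qed

end

section \<open>Killing by an occupation functional\<close>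

lemma set_integral_borel_measurable:
  fixes f :: "'a \<Rightarrow> real \<Rightarrow> real"
  assumes "case_prod f \<in> borel_measurable (N \<Otimes>\<^sub>M borel)" "\<tau> \<in> borel_measurable N"
  shows "(\<lambda>x. LINT s:{0<..<\<tau> x}|lborel. f x s) \<in> borel_measurable N"
    and "(\<lambda>x. LINT s:{0..\<tau> x}|lborel. f x s) \<in> borel_measurable N"
proof -
  have [measurable]: "(\<lambda>p. f (fst p) (snd p)) \<in> borel_measurable (N \<Otimes>\<^sub>M lborel)" "\<tau> \<in> borel_measurable N"
    using assms by (simp_all add: case_prod_beta')
  have "(\<lambda>x. LINT s:{0<..<\<tau> x}|lborel. f x s) = (\<lambda>x. \<integral>s. (if 0 < s \<and> s < \<tau> x then f x s else 0) \<partial>lborel)"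
    unfolding set_lebesgue_integral_def by (intro ext Bochner_Integration.integral_cong) auto
  also have "\<dots> \<in> borel_measurable N"
    by (rule lborel.borel_measurable_lebesgue_integral) (simp add: case_prod_beta')
  finally show "(\<lambda>x. LINT s:{0<..<\<tau> x}|lborel. f x s) \<in> borel_measurable N" .
  have "(\<lambda>x. LINT s:{0..\<tau> x}|lborel. f x s) = (\<lambda>x. \<integral>s. (if 0 \<le> s \<and> s \<le> \<tau> x then f x s else 0) \<partial>lborel)"
    unfolding set_lebesgue_integral_def by (intro ext Bochner_Integration.integral_cong) auto
  also have "\<dots> \<in> borel_measurable N"
    by (rule lborel.borel_measurable_lebesgue_integral) (simp add: case_prod_beta')
  finally show "(\<lambda>x. LINT s:{0..\<tau> x}|lborel. f x s) \<in> borel_measurable N" .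
qed

lemma set_integrable_bounded:
  fixes f :: "'a \<Rightarrow> real"
  assumes A: "A \<in> sets M" "emeasure M A < \<infinity>" and f: "f \<in> borel_measurable M"
    and bound: "\<And>x. x \<in> A \<Longrightarrow> \<bar>f x\<bar> \<le> K"
  shows "set_integrable M A f"
  unfolding set_integrable_def
proof (rule Bochner_Integration.integrable_bound[of M "\<lambda>x. K * indicator A x"])
  show "AE x in M. norm (indicator A x *\<^sub>R f x) \<le> norm (K * indicator A x)"
    using order_trans[OF bound abs_ge_self] by (intro AE_I2) (auto split: split_indicator)
qed (use A f in auto)

lemma set_integral_Ioo_bound:
  fixes f :: "real \<Rightarrow> real"
  assumes ab: "a \<le> b" and f: "f \<in> borel_measurable lborel"
    and bound: "\<And>x. x \<in> {a<..<b} \<Longrightarrow> \<bar>f x\<bar> \<le> K"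
  shows "\<bar>LINT x:{a<..<b}|lborel. f x\<bar> \<le> (b - a) * K"
proof -
  have "set_integrable lborel {a<..<b} f" "set_integrable lborel {a<..<b} (\<lambda>_. \<bar>K\<bar>)"
    using ab f order_trans[OF bound abs_ge_self] by (auto intro!: set_integrable_bounded[where K = "\<bar>K\<bar>"])
  then have i: "integrable lborel (\<lambda>x. indicator {a<..<b} x * f x)" "integrable lborel (\<lambda>x. indicator {a<..<b} x * \<bar>K\<bar>)"
    by (simp_all add: set_integrable_def)
  have j: "integrable lborel (\<lambda>x. indicator {a<..<b} x * K)"
    using ab by (intro integrable_mult_left) auto
  have "\<bar>LINT x:{a<..<b}|lborel. f x\<bar> \<le> (LINT x:{a<..<b}|lborel. K)"
    unfolding set_lebesgue_integral_def real_scaleR_def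
    using bound by (intro order_trans[OF integral_abs_bound integral_mono] integrable_abs i j)
      (auto simp: abs_mult split: split_indicator)
  also have "\<dots> = (b - a) * K" using ab by (simp add: set_lebesgue_integral_def)
  finally show ?thesis .
qed

lemma Fubini_rectangle:
  fixes f :: "'a \<Rightarrow> 'b \<Rightarrow> real"
  assumes "sigma_finite_measure N1" "sigma_finite_measure N2"
    and A: "A \<in> sets N1" "emeasure N1 A < \<infinity>" and D: "D \<in> sets N2" "emeasure N2 D < \<infinity>"
    and f: "case_prod f \<in> borel_measurable (N1 \<Otimes>\<^sub>M N2)"
    and bound: "\<And>x y. x \<in> A \<Longrightarrow> y \<in> D \<Longrightarrow> \<bar>f x y\<bar> \<le> K"
  shows "(LINT x:A|N1. (LINT y:D|N2. f x y)) = (LINT y:D|N2. (LINT x:A|N1. f x y))"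
proof -
  interpret N1: sigma_finite_measure N1 by fact
  interpret N2: sigma_finite_measure N2 by fact
  interpret pair_sigma_finite N1 N2 ..
  have "emeasure (N1 \<Otimes>\<^sub>M N2) (A \<times> D) < \<infinity>"
    using A D by (simp add: N2.emeasure_pair_measure_Times ennreal_mult_less_top)
  then have "set_integrable (N1 \<Otimes>\<^sub>M N2) (A \<times> D) (case_prod f)"
    using A D f bound by (intro set_integrable_bounded[where K = K]) auto
  then have "integrable (N1 \<Otimes>\<^sub>M N2) (\<lambda>(x, y). indicator A x * (indicator D y * f x y))"
    unfolding set_integrable_def by (simp add: case_prod_beta' indicator_times mult.assoc)
  note Fubini = Fubini_integral[OF this]
  have "(LINT x:A|N1. (LINT y:D|N2. f x y)) = (\<integral>x. \<integral>y. indicator A x * (indicator D y * f x y) \<partial>N2 \<partial>N1)"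
    by (simp add: set_lebesgue_integral_def)
  moreover have "(LINT y:D|N2. (LINT x:A|N1. f x y)) = (\<integral>y. \<integral>x. indicator A x * (indicator D y * f x y) \<partial>N1 \<partial>N2)"
    by (simp add: set_lebesgue_integral_def mult.left_commute[of "indicator A _"])
  ultimately show ?thesis using Fubini by simp
qed

context brownian_motion
begin

text \<open>At negative times nothing is known about \<open>B\<close>, so the process is frozen there.\<close>

definition BB :: "real \<Rightarrow> 'w \<Rightarrow> real" where
  "BB s \<omega> = B (max 0 s) \<omega>"

lemma BB_eq [simp]: "0 \<le> s \<Longrightarrow> BB s = B s"
  by (simp add: BB_def fun_eq_iff)

lemma BB_measurable [measurable (raw)]:
  assumes "f \<in> borel_measurable N" "g \<in> measurable N M"
  shows "(\<lambda>y. BB (f y) (g y)) \<in> borel_measurable N"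
  using measurable_compose[OF measurable_Pair[OF assms] measurable_max0] by (simp add: BB_def)

definition occupation :: "(real \<Rightarrow> real) \<Rightarrow> real \<Rightarrow> 'w \<Rightarrow> real" where
  "occupation V s \<omega> = (LINT r:{0..s}|lborel. V (BB r \<omega>))"

lemma occupation_measurable [measurable (raw)]:
  assumes [measurable]: "V \<in> borel_measurable borel" "f \<in> borel_measurable N" "g \<in> measurable N M"
  shows "(\<lambda>y. occupation V (f y) (g y)) \<in> borel_measurable N"
  unfolding occupation_def by (rule set_integral_borel_measurable(2)) measurable

text \<open>Clamping the time to {0..s} does not change the integral and makes the integrand jointly
  measurable with respect to \<open>past s\<close>.\<close>

lemma occupation_past:
  assumes s: "s > 0" and [measurable]: "V \<in> borel_measurable borel"
  shows "occupation V s \<in> borel_measurable (past s)"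
proof -
  have [measurable]: "(\<lambda>p. B (max 0 (min s (snd p))) (fst p)) \<in> borel_measurable (past s \<Otimes>\<^sub>M borel)"
    using measurable_compose[OF measurable_Pair[OF measurable_snd measurable_fst] past_jointly_measurable[OF s]] by simp
  have "occupation V s = (\<lambda>\<omega>. LINT r:{0..s}|lborel. V (B (max 0 (min s r)) \<omega>))"
    unfolding occupation_def BB_def by (intro ext set_lebesgue_integral_cong) (auto simp: min_absorb2)
  also have "\<dots> \<in> borel_measurable (past s)"
    by (rule set_integral_borel_measurable(2)) measurable
  finally show ?thesis .
qed

lemma expectation_abs_le:
  fixes f :: "'w \<Rightarrow> real"
  assumes "f \<in> borel_measurable M" "\<And>\<omega>. \<omega> \<in> space M \<Longrightarrow> \<bar>f \<omega>\<bar> \<le> D"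
  shows "\<bar>expectation f\<bar> \<le> D"
proof -
  have "integrable M f"
    using assms by (intro integrable_const_bound[where B = D]) auto
  then have "\<bar>expectation f\<bar> \<le> expectation (\<lambda>\<omega>. D)"
    using assms by (intro order_trans[OF integral_abs_bound integral_mono]) auto
  then show ?thesis by (simp add: prob_space)
qed

end

locale killed_brownian_motion = brownian_motion M B x for M :: "'w measure" and B x +
  fixes V :: "real \<Rightarrow> real" and K :: real
  assumes V_cont: "continuous_on UNIV V" and V_nonneg: "\<And>y. 0 \<le> V y" and V_le: "\<And>y. V y \<le> K"
begin

lemma V_measurable [measurable]: "V \<in> borel_measurable borel"
  using V_cont by (rule borel_measurable_continuous_onI)

lemma occupation_nonneg: "0 \<le> occupation V s \<omega>"
  unfolding occupation_def set_lebesgue_integral_def using V_nonneg by (intro Bochner_Integration.integral_nonneg) auto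

text \<open>Times \<kappa>, this is the density at time s of the killing time, given the path, when
  the path is killed at rate \<kappa> * V.\<close>

definition killing_weight :: "real \<Rightarrow> real \<Rightarrow> 'w \<Rightarrow> real" where
  "killing_weight \<kappa> s \<omega> = exp (- \<kappa> * occupation V s \<omega>) * V (BB s \<omega>)"

lemma killing_weight_measurable [measurable (raw)]:
  assumes [measurable]: "f \<in> borel_measurable N" "g \<in> measurable N M"
  shows "(\<lambda>y. killing_weight \<kappa> (f y) (g y)) \<in> borel_measurable N"
  unfolding killing_weight_def by measurable

lemma V_abs: "\<bar>V y\<bar> \<le> K"
  using V_nonneg[of y] V_le[of y] by simp

lemma K_nonneg: "0 \<le> K"
  using V_nonneg[of 0] V_le[of 0] by simp

lemma exp_occupation_le_1: "\<kappa> \<ge> 0 \<Longrightarrow> exp (- \<kappa> * occupation V s \<omega>) \<le> 1"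
  using occupation_nonneg[of s \<omega>] by simp

lemma killing_weight_nonneg: "0 \<le> killing_weight \<kappa> s \<omega>"
  using V_nonneg by (simp add: killing_weight_def)

lemma killing_weight_le: "\<kappa> \<ge> 0 \<Longrightarrow> killing_weight \<kappa> s \<omega> \<le> V (BB s \<omega>)"
  using exp_occupation_le_1[of \<kappa> s \<omega>] V_nonneg[of "BB s \<omega>"]
  unfolding killing_weight_def by (intro mult_left_le_one_le) auto

lemma killing_weight_abs: "\<kappa> \<ge> 0 \<Longrightarrow> \<bar>killing_weight \<kappa> s \<omega>\<bar> \<le> K"
  using killing_weight_nonneg[of \<kappa> s \<omega>] killing_weight_le[of \<kappa> s \<omega>] V_le[of "BB s \<omega>"] by simp

lemma killing_weight_past:
  assumes s: "s > 0"
  shows "killing_weight \<kappa> s \<in> borel_measurable (past s)"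
proof -
  have [measurable]: "occupation V s \<in> borel_measurable (past s)" "B s \<in> borel_measurable (past s)"
    by (rule occupation_past[OF s V_measurable], rule past_measurable_self)
  show ?thesis unfolding killing_weight_def[abs_def] using s by simp
qed

text \<open>V and the path are continuous, so the occupation functional is differentiable in time
  and the identity is the fundamental theorem of calculus.\<close>

lemma exp_occupation_FTC:
  assumes t: "t \<ge> 0" and \<omega>: "\<omega> \<in> space M"
  shows "exp (- \<kappa> * occupation V t \<omega>) = 1 - \<kappa> * (LINT s:{0<..<t}|lborel. killing_weight \<kappa> s \<omega>)"
proof -
  let ?b = "\<lambda>r. V (B r \<omega>)"
  have c: "continuous_on {0..t} ?b"
    by (rule continuous_on_compose2[OF V_cont])
       (auto intro: continuous_on_subset[OF continuous_paths[OF \<omega>]])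
  have occ: "occupation V s \<omega> = integral {0..s} ?b" if "s \<in> {0..t}" for s
  proof -
    have "set_integrable lborel {0..s} ?b"
      using that by (intro borel_integrable_atLeastAtMost' continuous_on_subset[OF c]) auto
    then have "(LINT r:{0..s}|lborel. ?b r) = integral {0..s} ?b"
      by (rule set_borel_integral_eq_integral(2))
    moreover have "occupation V s \<omega> = (LINT r:{0..s}|lborel. ?b r)"
      unfolding occupation_def by (intro set_lebesgue_integral_cong) auto
    ultimately show ?thesis by simp
  qed
  let ?e = "\<lambda>s. exp (- \<kappa> * integral {0..s} ?b)"
  have d: "((\<lambda>s. integral {0..s} ?b) has_real_derivative ?b s) (at s within {0..t})" if "s \<in> {0..t}" for s
    using integral_has_real_derivative[OF c that] .
  have ci: "continuous_on {0..t} (\<lambda>s. integral {0..s} ?b)"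
    by (intro indefinite_integral_continuous_1 integrable_continuous_interval c)
  have "(\<integral>s. indicator {0..t} s *\<^sub>R (- \<kappa> * (?e s * ?b s)) \<partial>lborel) = ?e t - ?e 0"
  proof (rule integral_FTC_atLeastAtMost[OF t])
    fix s assume s: "0 \<le> s" "s \<le> t"
    have "(?e has_real_derivative - \<kappa> * (?e s * ?b s)) (at s within {0..t})"
      using s by (auto intro!: derivative_eq_intros d)
    then show "(?e has_vector_derivative - \<kappa> * (?e s * ?b s)) (at s within {0..t})"
      by (simp add: has_real_derivative_iff_has_vector_derivative)
  qed (intro continuous_intros c ci)
  also have "(\<integral>s. indicator {0..t} s *\<^sub>R (- \<kappa> * (?e s * ?b s)) \<partial>lborel) = (LINT s:{0..t}|lborel. - \<kappa> * killing_weight \<kappa> s \<omega>)"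
    unfolding set_lebesgue_integral_def
    by (intro Bochner_Integration.integral_cong) (auto simp: killing_weight_def occ split: split_indicator)
  also have "\<dots> = - \<kappa> * (LINT s:{0..t}|lborel. killing_weight \<kappa> s \<omega>)"
    by (rule set_integral_mult_right)
  also have "(LINT s:{0..t}|lborel. killing_weight \<kappa> s \<omega>) = (LINT s:{0<..<t}|lborel. killing_weight \<kappa> s \<omega>)"
    by (rule set_integral_discrete_difference[where X = "{0, t}"]) auto
  finally show ?thesis using t occ[of t] by simp
qed

lemma weight_abs_le:
  assumes "\<kappa> \<ge> 0" "\<And>y. \<bar>H y\<bar> \<le> D"
  shows "\<bar>killing_weight \<kappa> s \<omega> * H y\<bar> \<le> K * D"
  unfolding abs_mult using assms killing_weight_abs K_nonneg by (intro mult_mono) auto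

text \<open>The exponential is expanded over the killing time s by
  \<open>exp_occupation_FTC\<close>; \<open>markov\<close> at s replaces the rest of the path by
  heat (t - s) F.\<close>

lemma feynman_kac_duhamel:
  assumes \<kappa>: "\<kappa> \<ge> 0" and t: "t > 0" and F [measurable]: "F \<in> borel_measurable borel" and Fb: "\<And>y. \<bar>F y\<bar> \<le> C"
  shows "expectation (\<lambda>\<omega>. exp (- \<kappa> * occupation V t \<omega>) * F (B t \<omega>)) = heat t F x -
    \<kappa> * (LINT s:{0<..<t}|lborel. expectation (\<lambda>\<omega>. killing_weight \<kappa> s \<omega> * heat (t - s) F (BB s \<omega>)))"
proof -
  have Bt [measurable]: "B t \<in> borel_measurable M" using t by (intro random_variable) auto
  let ?f = "\<lambda>s \<omega>. killing_weight \<kappa> s \<omega> * F (B t \<omega>)"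
  have fb: "\<bar>?f s \<omega>\<bar> \<le> K * C" for s \<omega> by (rule weight_abs_le[OF \<kappa> Fb])
  have m: "case_prod ?f \<in> borel_measurable (lborel \<Otimes>\<^sub>M M)" by measurable
  have i1: "integrable M (\<lambda>\<omega>. F (B t \<omega>))" using Fb by (intro integrable_const_bound[where B = C]) auto
  have mi: "(\<lambda>\<omega>. LINT s:{0<..<t}|lborel. ?f s \<omega>) \<in> borel_measurable M"
    by (rule set_integral_borel_measurable(1)) measurable
  have i2: "integrable M (\<lambda>\<omega>. LINT s:{0<..<t}|lborel. ?f s \<omega>)"
  proof (rule integrable_const_bound[where B = "t * (K * C)", OF _ mi])
    show "AE \<omega> in M. norm (LINT s:{0<..<t}|lborel. ?f s \<omega>) \<le> t * (K * C)"
    proof (intro AE_I2)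
      fix \<omega> assume \<omega>: "\<omega> \<in> space M"
      show "norm (LINT s:{0<..<t}|lborel. ?f s \<omega>) \<le> t * (K * C)"
        using set_integral_Ioo_bound[of 0 t "\<lambda>s. ?f s \<omega>" "K * C"] t fb \<omega> by simp
    qed
  qed
  have "expectation (\<lambda>\<omega>. exp (- \<kappa> * occupation V t \<omega>) * F (B t \<omega>)) =
      expectation (\<lambda>\<omega>. F (B t \<omega>) - \<kappa> * (LINT s:{0<..<t}|lborel. ?f s \<omega>))"
    using t by (intro Bochner_Integration.integral_cong refl)
      (simp only: exp_occupation_FTC[OF less_imp_le[OF t]], simp add: algebra_simps)
  also have "\<dots> = heat t F x - \<kappa> * expectation (\<lambda>\<omega>. LINT s:{0<..<t}|lborel. ?f s \<omega>)"
    using i1 i2 by (simp add: expectation_heat[OF t F])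
  also have "expectation (\<lambda>\<omega>. LINT s:{0<..<t}|lborel. ?f s \<omega>) = (LINT \<omega>:space M|M. (LINT s:{0<..<t}|lborel. ?f s \<omega>))"
    unfolding set_lebesgue_integral_def[of M] by (intro Bochner_Integration.integral_cong) auto
  also have "\<dots> = (LINT s:{0<..<t}|lborel. (LINT \<omega>:space M|M. ?f s \<omega>))"
    using t fb m by (intro Fubini_rectangle[symmetric, where K = "K * C"])
      (auto simp: emeasure_space_1 intro!: prob_space_imp_sigma_finite lborel.sigma_finite_measure_axioms prob_space_axioms)
  also have "\<dots> = (LINT s:{0<..<t}|lborel. expectation (\<lambda>\<omega>. killing_weight \<kappa> s \<omega> * heat (t - s) F (BB s \<omega>)))"
  proof (intro set_lebesgue_integral_cong ballI allI impI)
    fix s assume s: "s \<in> {0<..<t}"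
    have "(LINT \<omega>:space M|M. ?f s \<omega>) = expectation (?f s)"
      unfolding set_lebesgue_integral_def[of M] by (intro Bochner_Integration.integral_cong) auto
    also have "\<dots> = expectation (\<lambda>\<omega>. killing_weight \<kappa> s \<omega> * heat (t - s) F (B s \<omega>))"
      using s by (intro markov[where K = K and C = C] killing_weight_past killing_weight_abs \<kappa> Fb) auto
    finally show "(LINT \<omega>:space M|M. ?f s \<omega>) = expectation (\<lambda>\<omega>. killing_weight \<kappa> s \<omega> * heat (t - s) F (BB s \<omega>))"
      using s by simp
  qed simp
  finally show ?thesis .
qed

text \<open>Duhamel's formula is applied to \<open>F\<close> and, at every intermediate time, to \<open>V\<close> itself. When
  \<open>V\<close> approximates the delta function at \<open>0\<close> and \<open>a\<close> is the boundary value of the Robin solution,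
  \<open>v\<close> approximates that solution and the integrand on the right is small, since the weight forces
  \<open>BB s\<close> to be near \<open>0\<close>.\<close>

lemma feynman_kac_comparison:
  assumes \<kappa>_pos: "\<kappa> > 0" and t: "t > 0" and F [measurable]: "F \<in> borel_measurable borel" and Fb: "\<And>y. \<bar>F y\<bar> \<le> C"
    and a [measurable]: "a \<in> borel_measurable borel" and ab: "\<And>s. \<bar>a s\<bar> \<le> D"
  defines "v \<equiv> \<lambda>\<tau> y. heat \<tau> F y - \<kappa> * (LINT \<sigma>:{0<..<\<tau>}|lborel. a (\<tau> - \<sigma>) * heat \<sigma> V y)"
  shows "expectation (\<lambda>\<omega>. exp (- \<kappa> * occupation V t \<omega>) * F (B t \<omega>)) = v t x +
    \<kappa> * (LINT s:{0<..<t}|lborel. expectation (\<lambda>\<omega>. killing_weight \<kappa> s \<omega> * (a (t - s) - v (t - s) (BB s \<omega>))))"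
proof -
  have \<kappa>: "\<kappa> \<ge> 0" using \<kappa>_pos by simp
  have D: "D \<ge> 0" using ab[of 0] by simp
  have C: "C \<ge> 0" using Fb[of 0] by simp
  note K = K_nonneg
  have hF: "\<bar>heat \<tau> F y\<bar> \<le> C" for \<tau> y by (rule heat_bound[OF F Fb])
  have hV: "\<bar>heat \<tau> V y\<bar> \<le> K" for \<tau> y by (rule heat_bound[OF V_measurable V_abs])
  have ahV: "\<bar>a r * heat \<tau> V y\<bar> \<le> D * K" for r \<tau> y
    unfolding abs_mult using ab hV D by (intro mult_mono) auto
  define I where "I \<tau> y = (LINT \<sigma>:{0<..<\<tau>}|lborel. a (\<tau> - \<sigma>) * heat \<sigma> V y)" for \<tau> y
  have I_meas [measurable (raw)]: "(\<lambda>y. I (f y) (g y)) \<in> borel_measurable N"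
    if [measurable]: "f \<in> borel_measurable N" "g \<in> borel_measurable N" for f g and N :: "'z measure"
    unfolding I_def by (rule set_integral_borel_measurable(1)) measurable
  have Ib: "\<bar>I \<tau> y\<bar> \<le> t * (D * K)" if \<tau>: "0 < \<tau>" "\<tau> \<le> t" for \<tau> y
  proof -
    have "\<bar>I \<tau> y\<bar> \<le> \<tau> * (D * K)"
      unfolding I_def using set_integral_Ioo_bound[of 0 \<tau> "\<lambda>\<sigma>. a (\<tau> - \<sigma>) * heat \<sigma> V y" "D * K"] \<tau> ahV by simp
    also have "\<dots> \<le> t * (D * K)" using \<tau> D K by (intro mult_right_mono) auto
    finally show ?thesis .
  qed
  define P where "P \<sigma> = expectation (\<lambda>\<omega>. killing_weight \<kappa> \<sigma> \<omega>)" for \<sigma>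
  define Q where "Q s \<sigma> = expectation (\<lambda>\<omega>. killing_weight \<kappa> s \<omega> * heat (\<sigma> - s) V (BB s \<omega>))" for s \<sigma>
  define R where "R s = expectation (\<lambda>\<omega>. killing_weight \<kappa> s \<omega> * heat (t - s) F (BB s \<omega>))" for s
  define S where "S s = expectation (\<lambda>\<omega>. killing_weight \<kappa> s \<omega> * I (t - s) (BB s \<omega>))" for s
  have wK: "\<bar>killing_weight \<kappa> s \<omega>\<bar> \<le> K" for s \<omega> by (rule killing_weight_abs[OF \<kappa>])
  have Pm [measurable]: "P \<in> borel_measurable borel" unfolding P_def[abs_def] by measurable
  have Qm [measurable]: "case_prod Q \<in> borel_measurable (borel \<Otimes>\<^sub>M borel)"
    unfolding Q_def[abs_def] by measurable
  have Rm [measurable]: "R \<in> borel_measurable borel" unfolding R_def[abs_def] by measurable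
  have Sm [measurable]: "S \<in> borel_measurable borel" unfolding S_def[abs_def] by measurable
  have Pb: "\<bar>P s\<bar> \<le> K" for s unfolding P_def using wK by (intro expectation_abs_le) auto
  have Qb: "\<bar>Q s \<sigma>\<bar> \<le> K * K" for s \<sigma> unfolding Q_def using hV by (intro expectation_abs_le weight_abs_le \<kappa>) auto
  have Rb: "\<bar>R s\<bar> \<le> K * C" for s unfolding R_def using hF by (intro expectation_abs_le weight_abs_le \<kappa>) auto
  have Sb: "\<bar>S s\<bar> \<le> K * (t * (D * K))" if "s \<in> {0<..<t}" for s
  proof -
    have "\<bar>I (t - s) y\<bar> \<le> t * (D * K)" for y using Ib[of "t - s"] that by auto
    then show ?thesis
      unfolding S_def by (intro expectation_abs_le weight_abs_le[of \<kappa> "I (t - s)"] \<kappa>) measurable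
  qed
  have aQ: "\<bar>a r * Q s \<sigma>\<bar> \<le> D * (K * K)" for r s \<sigma>
    unfolding abs_mult using ab Qb D by (intro mult_mono) auto
  \<comment> \<open>For F = V the left side of Duhamel's formula is the expected killing weight
    itself.\<close>
  have P_eq: "P \<sigma> = heat \<sigma> V x - \<kappa> * (LINT s:{0<..<\<sigma>}|lborel. Q s \<sigma>)" if "\<sigma> \<in> {0<..<t}" for \<sigma>
    using that feynman_kac_duhamel[OF \<kappa> _ V_measurable V_abs, of \<sigma>]
    by (simp add: P_def Q_def killing_weight_def)
  have iI: "set_integrable lborel {0<..<t} (\<lambda>\<sigma>. a (t - \<sigma>) * heat \<sigma> V x)"
    using t ahV by (intro set_integrable_bounded[where K = "D * K"]) auto
  have iaP: "set_integrable lborel {0<..<t} (\<lambda>\<sigma>. a (t - \<sigma>) * P \<sigma>)"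
  proof (rule set_integrable_bounded[where K = "D * K"])
    show "\<bar>a (t - \<sigma>) * P \<sigma>\<bar> \<le> D * K" for \<sigma>
      unfolding abs_mult using ab Pb D by (intro mult_mono) auto
  qed (use t in auto)
  have iR: "set_integrable lborel {0<..<t} R"
    using t Rb by (intro set_integrable_bounded[where K = "K * C"]) auto
  have iS: "set_integrable lborel {0<..<t} S"
    using t Sb by (intro set_integrable_bounded[where K = "K * (t * (D * K))"]) auto
  \<comment> \<open>The order of integration is exchanged on the triangle s < \<sigma> < t, written
    as a square with a cut-off so that \<open>Fubini_rectangle\<close> applies.\<close>
  have "(LINT \<sigma>:{0<..<t}|lborel. a (t - \<sigma>) * (LINT s:{0<..<\<sigma>}|lborel. Q s \<sigma>)) =
      (LINT \<sigma>:{0<..<t}|lborel. (LINT s:{0<..<t}|lborel. (if s < \<sigma> then a (t - \<sigma>) * Q s \<sigma> else 0)))"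
  proof (intro set_lebesgue_integral_cong allI impI)
    fix \<sigma> assume \<sigma>: "\<sigma> \<in> {0<..<t}"
    have "a (t - \<sigma>) * (LINT s:{0<..<\<sigma>}|lborel. Q s \<sigma>) = (LINT s:{0<..<\<sigma>}|lborel. a (t - \<sigma>) * Q s \<sigma>)"
      by simp
    also have "\<dots> = (LINT s:{0<..<t}|lborel. (if s < \<sigma> then a (t - \<sigma>) * Q s \<sigma> else 0))"
      unfolding set_lebesgue_integral_def using \<sigma>
      by (intro Bochner_Integration.integral_cong) (auto split: split_indicator)
    finally show "a (t - \<sigma>) * (LINT s:{0<..<\<sigma>}|lborel. Q s \<sigma>) =
        (LINT s:{0<..<t}|lborel. (if s < \<sigma> then a (t - \<sigma>) * Q s \<sigma> else 0))" .
  qed simp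
  also have "\<dots> = (LINT s:{0<..<t}|lborel. (LINT \<sigma>:{0<..<t}|lborel. (if s < \<sigma> then a (t - \<sigma>) * Q s \<sigma> else 0)))"
  proof (rule Fubini_rectangle[where K = "D * (K * K)"])
    show "(\<lambda>(\<sigma>, s). if s < \<sigma> then a (t - \<sigma>) * Q s \<sigma> else 0) \<in> borel_measurable (lborel \<Otimes>\<^sub>M lborel)"
      by measurable
    show "\<bar>if s < \<sigma> then a (t - \<sigma>) * Q s \<sigma> else 0\<bar> \<le> D * (K * K)" for \<sigma> s
      using aQ[of "t - \<sigma>" s \<sigma>] D K by auto
  qed (use t in \<open>auto intro: lborel.sigma_finite_measure_axioms\<close>)
  also have "\<dots> = (LINT s:{0<..<t}|lborel. S s)"
  proof (intro set_lebesgue_integral_cong allI impI)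
    fix s assume s: "s \<in> {0<..<t}"
    \<comment> \<open>Shifting \<sigma> by s turns a (t - \<sigma>) into a ((t - s) - \<sigma>), so
      the integral over \<sigma> reproduces I (t - s) at the current position.\<close>
    let ?g = "\<lambda>\<sigma> \<omega>. a (t - s - \<sigma>) * (killing_weight \<kappa> s \<omega> * heat \<sigma> V (BB s \<omega>))"
    have gb: "\<bar>?g \<sigma> \<omega>\<bar> \<le> D * (K * K)" for \<sigma> \<omega>
      unfolding abs_mult[of "a _"] using ab D hV by (intro mult_mono weight_abs_le \<kappa>) auto
    have "(LINT \<sigma>:{0<..<t}|lborel. (if s < \<sigma> then a (t - \<sigma>) * Q s \<sigma> else 0)) =
        (LINT \<sigma>:{0<..<t - s}|lborel. a (t - s - \<sigma>) * Q s (s + \<sigma>))"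
      unfolding set_lebesgue_integral_def using s
      by (subst lborel_integral_real_affine[of 1 _ s])
         (auto intro!: Bochner_Integration.integral_cong simp: algebra_simps split: split_indicator)
    also have "\<dots> = (LINT \<sigma>:{0<..<t - s}|lborel. (LINT \<omega>:space M|M. ?g \<sigma> \<omega>))"
      unfolding Q_def set_lebesgue_integral_def[of M]
      by (intro set_lebesgue_integral_cong allI impI) (auto simp: algebra_simps intro!: Bochner_Integration.integral_cong simp flip: integral_mult_right_zero)
    also have "\<dots> = (LINT \<omega>:space M|M. (LINT \<sigma>:{0<..<t - s}|lborel. ?g \<sigma> \<omega>))"
    proof (rule Fubini_rectangle[where K = "D * (K * K)"])
      show "(\<lambda>(\<sigma>, \<omega>). ?g \<sigma> \<omega>) \<in> borel_measurable (lborel \<Otimes>\<^sub>M M)" by measurable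
    qed (use s gb in \<open>auto simp: emeasure_space_1 intro!: prob_space_imp_sigma_finite lborel.sigma_finite_measure_axioms prob_space_axioms\<close>)
    also have "\<dots> = S s"
      unfolding S_def I_def set_lebesgue_integral_def[of M]
      by (intro Bochner_Integration.integral_cong) (auto simp flip: set_integral_mult_right simp: mult_ac)
    finally show "(LINT \<sigma>:{0<..<t}|lborel. (if s < \<sigma> then a (t - \<sigma>) * Q s \<sigma> else 0)) = S s" .
  qed simp
  finally have swap: "(LINT \<sigma>:{0<..<t}|lborel. a (t - \<sigma>) * (LINT s:{0<..<\<sigma>}|lborel. Q s \<sigma>)) = (LINT s:{0<..<t}|lborel. S s)" .
  \<comment> \<open>\<open>P_eq\<close> expresses \<kappa> times this function as a difference of
    two integrable ones; positivity of \<kappa> permits the division.\<close>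
  have iQ: "set_integrable lborel {0<..<t} (\<lambda>\<sigma>. a (t - \<sigma>) * (LINT s:{0<..<\<sigma>}|lborel. Q s \<sigma>))"
  proof -
    have "set_integrable lborel {0<..<t} (\<lambda>\<sigma>. a (t - \<sigma>) * heat \<sigma> V x - a (t - \<sigma>) * P \<sigma>)"
      by (intro set_integral_diff iI iaP)
    then have "set_integrable lborel {0<..<t} (\<lambda>\<sigma>. \<kappa> * (a (t - \<sigma>) * (LINT s:{0<..<\<sigma>}|lborel. Q s \<sigma>)))"
      by (rule set_integrable_cong[THEN iffD1, rotated -1]) (auto simp: P_eq algebra_simps)
    then show ?thesis using \<kappa>_pos by simp
  qed
  have "(LINT \<sigma>:{0<..<t}|lborel. a (t - \<sigma>) * P \<sigma>) =
      (LINT \<sigma>:{0<..<t}|lborel. a (t - \<sigma>) * heat \<sigma> V x - \<kappa> * (a (t - \<sigma>) * (LINT s:{0<..<\<sigma>}|lborel. Q s \<sigma>)))"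
    by (intro set_lebesgue_integral_cong) (auto simp: P_eq algebra_simps)
  also have "\<dots> = I t x - \<kappa> * (LINT s:{0<..<t}|lborel. S s)"
    unfolding swap[symmetric] I_def using iI iQ
    by (simp only: set_integral_diff set_integrable_mult_right set_integral_mult_right)
  finally have aP: "(LINT \<sigma>:{0<..<t}|lborel. a (t - \<sigma>) * P \<sigma>) = I t x - \<kappa> * (LINT s:{0<..<t}|lborel. S s)" .
  have "(LINT s:{0<..<t}|lborel. expectation (\<lambda>\<omega>. killing_weight \<kappa> s \<omega> * (a (t - s) - v (t - s) (BB s \<omega>)))) =
      (LINT s:{0<..<t}|lborel. a (t - s) * P s - R s + \<kappa> * S s)"
  proof (intro set_lebesgue_integral_cong allI impI)
    fix s assume s: "s \<in> {0<..<t}"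
    have 1: "integrable M (\<lambda>\<omega>. killing_weight \<kappa> s \<omega>)"
      using wK by (intro integrable_const_bound[where B = K]) auto
    have 2: "integrable M (\<lambda>\<omega>. killing_weight \<kappa> s \<omega> * heat (t - s) F (BB s \<omega>))"
      using weight_abs_le[of \<kappa> "heat (t - s) F", OF \<kappa> hF] by (intro integrable_const_bound[where B = "K * C"]) auto
    have 3: "integrable M (\<lambda>\<omega>. killing_weight \<kappa> s \<omega> * I (t - s) (BB s \<omega>))"
      using weight_abs_le[of \<kappa> "I (t - s)", OF \<kappa> Ib[of "t - s"]] s
      by (intro integrable_const_bound[where B = "K * (t * (D * K))"]) (auto simp del: BB_eq)
    have "expectation (\<lambda>\<omega>. killing_weight \<kappa> s \<omega> * (a (t - s) - v (t - s) (BB s \<omega>))) =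
       expectation (\<lambda>\<omega>. a (t - s) * killing_weight \<kappa> s \<omega> - killing_weight \<kappa> s \<omega> * heat (t - s) F (BB s \<omega>)
          + \<kappa> * (killing_weight \<kappa> s \<omega> * I (t - s) (BB s \<omega>)))"
      unfolding v_def I_def[symmetric] by (simp add: algebra_simps)
    also have "\<dots> = a (t - s) * P s - R s + \<kappa> * S s"
      using 1 2 3 by (simp add: P_def R_def S_def)
    finally show "expectation (\<lambda>\<omega>. killing_weight \<kappa> s \<omega> * (a (t - s) - v (t - s) (BB s \<omega>))) =
       a (t - s) * P s - R s + \<kappa> * S s" .
  qed simp
  also have "\<dots> = I t x - \<kappa> * (LINT s:{0<..<t}|lborel. S s) - (LINT s:{0<..<t}|lborel. R s) + \<kappa> * (LINT s:{0<..<t}|lborel. S s)"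
    unfolding aP[symmetric] using iaP iR iS
    by (simp only: set_integral_add set_integral_diff set_integrable_mult_right set_integral_mult_right)
  finally have E: "(LINT s:{0<..<t}|lborel. expectation (\<lambda>\<omega>. killing_weight \<kappa> s \<omega> * (a (t - s) - v (t - s) (BB s \<omega>)))) =
      I t x - (LINT s:{0<..<t}|lborel. R s)" by simp
  have "expectation (\<lambda>\<omega>. exp (- \<kappa> * occupation V t \<omega>) * F (B t \<omega>)) = heat t F x - \<kappa> * (LINT s:{0<..<t}|lborel. R s)"
    using feynman_kac_duhamel[OF \<kappa> t F Fb] by (simp add: R_def)
  then show ?thesis
    unfolding E by (simp add: v_def I_def algebra_simps)
qed

end

section \<open>Local time at zero\<close>

text \<open>With u = \<bar>z\<bar> / sqrt s the derivative has size u * exp (- u^2 / 2) / sqrt s,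
  and u <= 1 + u^2 / 2 <= exp (u^2 / 2).\<close>

lemma exp_square_Lipschitz:
  fixes a b :: real
  assumes s: "s > 0"
  shows "\<bar>exp (- a\<^sup>2 / (2 * s)) - exp (- b\<^sup>2 / (2 * s))\<bar> \<le> \<bar>a - b\<bar> / sqrt s"
proof -
  have "norm (exp (- a\<^sup>2 / (2 * s)) - exp (- b\<^sup>2 / (2 * s))) \<le> (1 / sqrt s) * norm (a - b)"
  proof (rule field_differentiable_bound[of UNIV _ "\<lambda>z. - (z / s) * exp (- z\<^sup>2 / (2 * s))"])
    fix z :: real
    show "((\<lambda>a. exp (- a\<^sup>2 / (2 * s))) has_field_derivative - (z / s) * exp (- z\<^sup>2 / (2 * s))) (at z within UNIV)"
      using s by (auto intro!: derivative_eq_intros simp: field_simps)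
    define u where "u = \<bar>z\<bar> / sqrt s"
    have "u \<le> 1 + u\<^sup>2 / 2"
      using zero_le_power2[of "u - 1"] by (simp add: power2_eq_square algebra_simps)
    also have "\<dots> \<le> exp (u\<^sup>2 / 2)" by (rule exp_ge_add_one_self)
    finally have "u * exp (- (u\<^sup>2 / 2)) \<le> 1"
      by (simp add: exp_minus field_simps)
    moreover have "- (u\<^sup>2 / 2) = - z\<^sup>2 / (2 * s)" using s by (simp add: u_def power_divide)
    ultimately have "\<bar>z\<bar> / sqrt s * exp (- z\<^sup>2 / (2 * s)) \<le> 1"
      by (simp only: u_def)
    then have "\<bar>z\<bar> / sqrt s * exp (- z\<^sup>2 / (2 * s)) / sqrt s \<le> 1 / sqrt s"
      using s by (intro divide_right_mono) auto
    then show "norm (- (z / s) * exp (- z\<^sup>2 / (2 * s))) \<le> 1 / sqrt s"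
      using s by (simp add: abs_mult mult_ac)
  qed auto
  then show ?thesis by simp
qed

text \<open>Interpolates between the trivial bound and the Lipschitz bound. The full Lipschitz
  estimate would cost 1 / s, which is not integrable at 0; the exponent 1/2 in space leaves s to the
  power -3/4, which is.\<close>

lemma gauss_Hoelder:
  assumes s: "s > 0"
  shows "\<bar>gauss s a - gauss s b\<bar> \<le> sqrt \<bar>a - b\<bar> * (1 / (sqrt s * sqrt (sqrt s)))"
proof -
  define d where "d = \<bar>exp (- a\<^sup>2 / (2 * s)) - exp (- b\<^sup>2 / (2 * s))\<bar>"
  have d0: "0 \<le> d" by (simp add: d_def)
  have "d \<le> 1"
  proof -
    have "0 < exp (- a\<^sup>2 / (2 * s))" "exp (- a\<^sup>2 / (2 * s)) \<le> 1" "0 < exp (- b\<^sup>2 / (2 * s))" "exp (- b\<^sup>2 / (2 * s)) \<le> 1"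
      using s by auto
    then show ?thesis unfolding d_def by linarith
  qed
  then have "d * d \<le> d * 1" using d0 by (intro mult_left_mono)
  also have "\<dots> \<le> \<bar>a - b\<bar> / sqrt s" unfolding d_def using exp_square_Lipschitz[OF s] by simp
  finally have "sqrt (d * d) \<le> sqrt (\<bar>a - b\<bar> / sqrt s)" by (rule real_sqrt_le_mono)
  then have d: "d \<le> sqrt \<bar>a - b\<bar> / sqrt (sqrt s)" using d0 by (simp add: real_sqrt_divide)
  have "sqrt s \<le> sqrt (2 * pi * s)"
    using s pi_ge_two by (intro real_sqrt_le_mono) (simp add: mult_le_cancel_right1)
  then have "d / sqrt (2 * pi * s) \<le> d / sqrt s"
    using d0 s by (intro divide_left_mono) auto
  also have "\<dots> \<le> sqrt \<bar>a - b\<bar> / sqrt (sqrt s) / sqrt s"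
    using d s by (intro divide_right_mono) auto
  finally show ?thesis
    using s by (simp add: gauss_def d_def mult_ac flip: diff_divide_distrib)
qed

lemma inverse_sqrt_integral:
  assumes t: "t > 0"
  shows "set_integrable lborel {0<..<t} (\<lambda>s. 1 / sqrt s)"
    and "(LINT s:{0<..<t}|lborel. 1 / sqrt s) = 2 * sqrt t"
proof -
  have 0: "ereal 0 < ereal t" using t by simp
  have 1: "((\<lambda>s. 2 * sqrt s) has_real_derivative 1 / sqrt s) (at s)" "isCont (\<lambda>s. 1 / sqrt s) s"
    if "ereal 0 < ereal s" "ereal s < ereal t" for s
    using that by (auto intro!: derivative_eq_intros continuous_intros simp: field_simps)
  have 2: "AE s in lborel. ereal 0 < ereal s \<longrightarrow> ereal s < ereal t \<longrightarrow> 0 \<le> 1 / sqrt s" by auto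
  have 3: "(((\<lambda>s. 2 * sqrt s) \<circ> real_of_ereal) \<longlongrightarrow> 2 * sqrt 0) (at_right (ereal 0))"
    "(((\<lambda>s. 2 * sqrt s) \<circ> real_of_ereal) \<longlongrightarrow> 2 * sqrt t) (at_left (ereal t))"
    unfolding ereal_tendsto_simps by (intro tendsto_intros)+
  show "set_integrable lborel {0<..<t} (\<lambda>s. 1 / sqrt s)"
    and "(LINT s:{0<..<t}|lborel. 1 / sqrt s) = 2 * sqrt t"
    using interval_integral_FTC_nonneg[OF 0 1 2 3] t by (simp_all add: interval_lebesgue_integral_def)
qed

lemma inverse_three_quarters_integral:
  assumes t: "r < t"
  shows "set_integrable lborel {r<..<t} (\<lambda>s. 1 / (sqrt (s - r) * sqrt (sqrt (s - r))))"
    and "(LINT s:{r<..<t}|lborel. 1 / (sqrt (s - r) * sqrt (sqrt (s - r)))) = 4 * sqrt (sqrt (t - r))"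
proof -
  let ?f = "\<lambda>s. 1 / (sqrt (s - r) * sqrt (sqrt (s - r)))" and ?F = "\<lambda>s. 4 * sqrt (sqrt (s - r))"
  have 0: "ereal r < ereal t" using t by simp
  have 1: "(?F has_real_derivative ?f s) (at s)" "isCont ?f s"
    if "ereal r < ereal s" "ereal s < ereal t" for s
    using that by (auto intro!: derivative_eq_intros continuous_intros simp: field_simps)
  have 2: "AE s in lborel. ereal r < ereal s \<longrightarrow> ereal s < ereal t \<longrightarrow> 0 \<le> ?f s" by auto
  have 3: "((?F \<circ> real_of_ereal) \<longlongrightarrow> 4 * sqrt (sqrt (r - r))) (at_right (ereal r))"
    "((?F \<circ> real_of_ereal) \<longlongrightarrow> 4 * sqrt (sqrt (t - r))) (at_left (ereal t))"
    unfolding ereal_tendsto_simps by (intro tendsto_intros)+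
  show "set_integrable lborel {r<..<t} ?f" and "(LINT s:{r<..<t}|lborel. ?f s) = 4 * sqrt (sqrt (t - r))"
    using interval_integral_FTC_nonneg[OF 0 1 2 3] t by (simp_all add: interval_lebesgue_integral_def)
qed

section \<open>Occupation functionals of bumps and their mean square distance\<close>

text \<open>A bounded probability density on {- \<epsilon>..\<epsilon>}. The class contains the box
  of the local time as well as the continuous tent, so that a single mean square estimate compares
  all of them.\<close>

definition bump :: "real \<Rightarrow> (real \<Rightarrow> real) \<Rightarrow> bool" where
  "bump \<epsilon> \<psi> \<longleftrightarrow> \<psi> \<in> borel_measurable borel \<and> (\<forall>y. 0 \<le> \<psi> y) \<and> (\<exists>K. \<forall>y. \<psi> y \<le> K) \<and>
     integrable lborel \<psi> \<and> (\<integral>y. \<psi> y \<partial>lborel) = 1 \<and> (\<forall>y. \<epsilon> < \<bar>y\<bar> \<longrightarrow> \<psi> y = 0)"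

lemma bumpD:
  assumes "bump \<epsilon> \<psi>"
  shows "\<psi> \<in> borel_measurable borel" "\<And>y. 0 \<le> \<psi> y" "integrable lborel \<psi>" "(\<integral>y. \<psi> y \<partial>lborel) = 1"
    "\<And>y. \<epsilon> < \<bar>y\<bar> \<Longrightarrow> \<psi> y = 0"
  using assms by (auto simp: bump_def)

lemma bump_bounded:
  assumes "bump \<epsilon> \<psi>"
  shows "\<exists>K. \<forall>y. \<bar>\<psi> y\<bar> \<le> K"
proof -
  obtain K where K: "\<And>y. \<psi> y \<le> K" using assms by (auto simp: bump_def)
  have "\<bar>\<psi> y\<bar> \<le> K" for y using K[of y] bumpD(2)[OF assms, of y] by simp
  then show ?thesis by blast
qed

lemma heat_bump_le:
  assumes \<psi>: "bump \<epsilon> \<psi>" and s: "s > 0"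
  shows "heat s \<psi> y \<le> 1 / sqrt s"
proof -
  obtain K where K: "\<And>y. \<bar>\<psi> y\<bar> \<le> K" using bump_bounded[OF \<psi>] by blast
  have "heat s \<psi> y \<le> (\<integral>z. \<psi> z * (1 / sqrt s) \<partial>lborel)"
    unfolding heat_eq_gauss[OF s]
  proof (rule integral_mono)
    show "integrable lborel (\<lambda>z. \<psi> z * gauss s (y - z))" by (rule heat_integrable[OF s bumpD(1)[OF \<psi>] K])
    show "integrable lborel (\<lambda>z. \<psi> z * (1 / sqrt s))" by (rule integrable_mult_left[OF bumpD(3)[OF \<psi>]])
    show "\<psi> z * gauss s (y - z) \<le> \<psi> z * (1 / sqrt s)" for z
      by (rule mult_left_mono[OF gauss_le[OF s] bumpD(2)[OF \<psi>]])
  qed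
  then show ?thesis using bumpD(4)[OF \<psi>] by simp
qed

text \<open>The bump averages gauss s (y - z) over shifts of size at most \<epsilon>, so
  \<open>gauss_Hoelder\<close> bounds the error.\<close>

lemma heat_bump_approx:
  assumes \<psi>: "bump \<epsilon> \<psi>" and s: "s > 0"
  shows "\<bar>heat s \<psi> y - gauss s y\<bar> \<le> sqrt \<epsilon> * (1 / (sqrt s * sqrt (sqrt s)))"
proof -
  let ?w = "1 / (sqrt s * sqrt (sqrt s))"
  obtain K where K: "\<And>y. \<bar>\<psi> y\<bar> \<le> K" using bump_bounded[OF \<psi>] by blast
  note i1 = heat_integrable[OF s bumpD(1)[OF \<psi>] K, of y] and i2 = integrable_mult_left[OF bumpD(3)[OF \<psi>], of "gauss s y"]
  have "heat s \<psi> y - gauss s y = (\<integral>z. \<psi> z * gauss s (y - z) - \<psi> z * gauss s y \<partial>lborel)"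
    using i1 i2 bumpD(4)[OF \<psi>] by (simp add: heat_eq_gauss[OF s])
  also have "\<bar>\<dots>\<bar> \<le> (\<integral>z. \<psi> z * (sqrt \<epsilon> * ?w) \<partial>lborel)"
  proof (intro order_trans[OF integral_abs_bound integral_mono] integrable_abs Bochner_Integration.integrable_diff i1 i2)
    show "integrable lborel (\<lambda>z. \<psi> z * (sqrt \<epsilon> * ?w))" by (intro integrable_mult_left bumpD(3)[OF \<psi>])
    fix z
    show "\<bar>\<psi> z * gauss s (y - z) - \<psi> z * gauss s y\<bar> \<le> \<psi> z * (sqrt \<epsilon> * ?w)"
    proof (cases "\<epsilon> < \<bar>z\<bar>")
      case False
      have "\<bar>gauss s (y - z) - gauss s y\<bar> \<le> sqrt \<bar>z\<bar> * ?w"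
        using gauss_Hoelder[OF s, of "y - z" y] by simp
      also have "\<dots> \<le> sqrt \<epsilon> * ?w" using False s by (intro mult_right_mono) auto
      finally have "\<psi> z * \<bar>gauss s (y - z) - gauss s y\<bar> \<le> \<psi> z * (sqrt \<epsilon> * ?w)"
        using bumpD(2)[OF \<psi>] by (intro mult_left_mono) auto
      then show ?thesis using bumpD(2)[OF \<psi>, of z] by (simp add: abs_mult flip: right_diff_distrib)
    qed (simp add: bumpD(5)[OF \<psi>])
  qed
  also have "\<dots> = sqrt \<epsilon> * ?w" using bumpD(4)[OF \<psi>] by simp
  finally show ?thesis .
qed

lemma heat_diff:
  assumes "F \<in> borel_measurable borel" "\<And>y. \<bar>F y\<bar> \<le> C" "G \<in> borel_measurable borel" "\<And>y. \<bar>G y\<bar> \<le> D"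
    and s: "s > 0"
  shows "heat s (\<lambda>y. F y - G y) y = heat s F y - heat s G y"
  unfolding heat_eq_gauss[OF s]
  using heat_integrable[OF s assms(1,2), of y] heat_integrable[OF s assms(3,4), of y]
  by (simp add: left_diff_distrib)

context brownian_motion
begin

lemma occupation_eq_Ioo: "occupation V t \<omega> = (LINT s:{0<..<t}|lborel. V (BB s \<omega>))"
  unfolding occupation_def by (rule set_integral_discrete_difference[where X = "{0, t}"]) auto

lemma occupation_set_integrable:
  assumes V: "V \<in> borel_measurable borel" and K: "\<And>y. \<bar>V y\<bar> \<le> K" and t: "0 \<le> t" and \<omega>: "\<omega> \<in> space M"
  shows "set_integrable lborel {0<..<t} (\<lambda>s. V (BB s \<omega>))"
    "\<bar>occupation V t \<omega>\<bar> \<le> t * K"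
proof -
  have [measurable]: "V \<in> borel_measurable borel" by fact
  have m: "(\<lambda>s. V (BB s \<omega>)) \<in> borel_measurable lborel"
    using \<omega> by measurable
  show "set_integrable lborel {0<..<t} (\<lambda>s. V (BB s \<omega>))"
    using t K m by (intro set_integrable_bounded[where K = K]) auto
  show "\<bar>occupation V t \<omega>\<bar> \<le> t * K"
    unfolding occupation_eq_Ioo using set_integral_Ioo_bound[of 0 t "\<lambda>s. V (BB s \<omega>)" K] t K m by simp
qed

lemma expectation_bump_le:
  assumes \<psi>: "bump \<epsilon> \<psi>" and r: "r > 0"
  shows "expectation (\<lambda>\<omega>. \<psi> (BB r \<omega>)) \<le> 1 / sqrt r"
  using expectation_heat[OF r bumpD(1)[OF \<psi>]] heat_bump_le[OF \<psi> r, of x] r by simp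

text \<open>The square is a double integral of E (\<phi> (B r) * \<phi> (B s)). By the Markov
  property at r < s the second factor becomes heat (s - r) \<phi>, which is small because the two
  bumps nearly cancel, while the mean of \<bar>\<phi> (B r)\<bar> is at most 2 / sqrt r. The
  constant 32 is 2 for the symmetry, 2 for the two bumps, and 4 and 2 from the time
  integrals.\<close>

lemma occupation_L2:
  assumes \<psi>1: "bump \<epsilon> \<psi>1" and \<psi>2: "bump \<delta> \<psi>2" and t: "t > 0" and \<epsilon>: "\<epsilon> \<ge> 0" "\<delta> \<ge> 0"
  shows "expectation (\<lambda>\<omega>. (occupation \<psi>1 t \<omega> - occupation \<psi>2 t \<omega>)\<^sup>2) \<le> 32 * (sqrt t * sqrt (sqrt t)) * (sqrt \<epsilon> + sqrt \<delta>)"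
proof -
  obtain K1 where K1: "\<And>y. \<bar>\<psi>1 y\<bar> \<le> K1" using bump_bounded[OF \<psi>1] by blast
  obtain K2 where K2: "\<And>y. \<bar>\<psi>2 y\<bar> \<le> K2" using bump_bounded[OF \<psi>2] by blast
  note [measurable] = bumpD(1)[OF \<psi>1] bumpD(1)[OF \<psi>2]
  define \<phi> where "\<phi> y = \<psi>1 y - \<psi>2 y" for y
  define K where "K = K1 + K2"
  have [measurable]: "\<phi> \<in> borel_measurable borel" unfolding \<phi>_def[abs_def] by measurable
  have \<phi>K: "\<bar>\<phi> y\<bar> \<le> K" for y using K1[of y] K2[of y] unfolding \<phi>_def K_def by linarith
  have K: "0 \<le> K" using \<phi>K[of 0] by simp
  define c where "c = sqrt \<epsilon> + sqrt \<delta>"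
  have c: "c \<ge> 0" using \<epsilon> by (simp add: c_def)
  have h\<phi>: "\<bar>heat s \<phi> y\<bar> \<le> c * (1 / (sqrt s * sqrt (sqrt s)))" if s: "s > 0" for s y
  proof -
    have "heat s \<phi> y = heat s \<psi>1 y - heat s \<psi>2 y"
      unfolding \<phi>_def by (rule heat_diff[OF _ K1 _ K2 s]) measurable
    then show ?thesis
      using heat_bump_approx[OF \<psi>1 s, of y] heat_bump_approx[OF \<psi>2 s, of y]
      unfolding c_def distrib_right by linarith
  qed
  define e where "e r s = expectation (\<lambda>\<omega>. \<phi> (BB r \<omega>) * \<phi> (BB s \<omega>))" for r s
  have \<phi>\<phi>: "\<bar>\<phi> y * \<phi> z\<bar> \<le> K * K" for y z
    unfolding abs_mult using \<phi>K K by (intro mult_mono) auto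
  have em [measurable]: "case_prod e \<in> borel_measurable (borel \<Otimes>\<^sub>M borel)"
    unfolding e_def[abs_def] by measurable
  have eK: "\<bar>e r s\<bar> \<le> K * K" for r s
    unfolding e_def using \<phi>\<phi> by (intro expectation_abs_le) auto
  have e_sym: "e r s = e s r" for r s by (simp add: e_def mult.commute)
  define D where "D \<omega> = (LINT s:{0<..<t}|lborel. \<phi> (BB s \<omega>))" for \<omega>
  have Dm [measurable]: "D \<in> borel_measurable M"
    unfolding D_def[abs_def] by (rule set_integral_borel_measurable(1)) measurable
  have DK: "\<bar>D \<omega>\<bar> \<le> t * K" if "\<omega> \<in> space M" for \<omega>
  proof -
    have "(\<lambda>s. \<phi> (BB s \<omega>)) \<in> borel_measurable lborel" using that by measurable
    then show ?thesis
      unfolding D_def using set_integral_Ioo_bound[of 0 t "\<lambda>s. \<phi> (BB s \<omega>)" K] t \<phi>K by simp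
  qed
  have sf: "sigma_finite_measure M" by (rule prob_space_imp_sigma_finite) (rule prob_space_axioms)
  have set_space: "(LINT \<omega>:space M|M. f \<omega>) = expectation f" for f :: "'w \<Rightarrow> real"
    unfolding set_lebesgue_integral_def by (intro Bochner_Integration.integral_cong) auto
  have "expectation (\<lambda>\<omega>. (D \<omega>)\<^sup>2) = (LINT \<omega>:space M|M. (LINT r:{0<..<t}|lborel. \<phi> (BB r \<omega>) * D \<omega>))"
    unfolding set_space by (simp add: power2_eq_square) (simp add: D_def)
  also have "\<dots> = (LINT r:{0<..<t}|lborel. (LINT \<omega>:space M|M. \<phi> (BB r \<omega>) * D \<omega>))"
  proof (rule Fubini_rectangle[symmetric, where K = "K * (t * K)"])
    show "(\<lambda>(r, \<omega>). \<phi> (BB r \<omega>) * D \<omega>) \<in> borel_measurable (lborel \<Otimes>\<^sub>M M)" by measurable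
    show "\<bar>\<phi> (BB r \<omega>) * D \<omega>\<bar> \<le> K * (t * K)" if "\<omega> \<in> space M" for r \<omega>
      unfolding abs_mult using \<phi>K DK[OF that] K by (intro mult_mono) auto
  qed (use t sf in \<open>auto simp: emeasure_space_1 intro: lborel.sigma_finite_measure_axioms\<close>)
  also have "\<dots> = (LINT r:{0<..<t}|lborel. (LINT s:{0<..<t}|lborel. e r s))"
  proof (intro set_lebesgue_integral_cong allI impI)
    fix r
    have "(LINT \<omega>:space M|M. \<phi> (BB r \<omega>) * D \<omega>) = (LINT \<omega>:space M|M. (LINT s:{0<..<t}|lborel. \<phi> (BB r \<omega>) * \<phi> (BB s \<omega>)))"
      by (simp add: D_def)
    also have "\<dots> = (LINT s:{0<..<t}|lborel. (LINT \<omega>:space M|M. \<phi> (BB r \<omega>) * \<phi> (BB s \<omega>)))"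
    proof (rule Fubini_rectangle[symmetric, where K = "K * K"])
      show "(\<lambda>(s, \<omega>). \<phi> (BB r \<omega>) * \<phi> (BB s \<omega>)) \<in> borel_measurable (lborel \<Otimes>\<^sub>M M)" by measurable
    qed (use t sf \<phi>\<phi> in \<open>auto simp: emeasure_space_1 intro: lborel.sigma_finite_measure_axioms\<close>)
    finally show "(LINT \<omega>:space M|M. \<phi> (BB r \<omega>) * D \<omega>) = (LINT s:{0<..<t}|lborel. e r s)"
      by (simp add: set_space e_def)
  qed simp
  \<comment> \<open>The square is cut along the diagonal; by the symmetry of e both triangles
    contribute the same amount.\<close>
  also have "\<dots> = (LINT r:{0<..<t}|lborel. (LINT s:{r<..<t}|lborel. e r s) + (LINT s:{0<..<t}|lborel. (if s < r then e r s else 0)))"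
  proof (intro set_lebesgue_integral_cong allI impI)
    fix r assume r: "r \<in> {0<..<t}"
    have "(LINT s:{0<..<t}|lborel. e r s) = (LINT s:{0<..<t}|lborel. (if r \<le> s then e r s else 0) + (if s < r then e r s else 0))"
      by (intro set_lebesgue_integral_cong) auto
    also have "\<dots> = (LINT s:{0<..<t}|lborel. (if r \<le> s then e r s else 0)) + (LINT s:{0<..<t}|lborel. (if s < r then e r s else 0))"
      using eK K t by (intro set_integral_add set_integrable_bounded[where K = "K * K"]) auto
    also have "(LINT s:{0<..<t}|lborel. (if r \<le> s then e r s else 0)) = (LINT s:{r..<t}|lborel. e r s)"
      unfolding set_lebesgue_integral_def using r by (intro Bochner_Integration.integral_cong) (auto split: split_indicator)
    also have "\<dots> = (LINT s:{r<..<t}|lborel. e r s)"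
      by (rule set_integral_discrete_difference[where X = "{r}"]) auto
    finally show "(LINT s:{0<..<t}|lborel. e r s) = (LINT s:{r<..<t}|lborel. e r s) + (LINT s:{0<..<t}|lborel. (if s < r then e r s else 0))" .
  qed simp
  also have "\<dots> = (LINT r:{0<..<t}|lborel. (LINT s:{r<..<t}|lborel. e r s)) + (LINT r:{0<..<t}|lborel. (LINT s:{0<..<t}|lborel. (if s < r then e r s else 0)))"
  proof (rule set_integral_add)
    have *: "(\<lambda>r. LINT s:{r<..<t}|lborel. e r s) = (\<lambda>r. LINT s:{0<..<t - r}|lborel. e r (s + r))"
    proof
      fix r
      show "(LINT s:{r<..<t}|lborel. e r s) = (LINT s:{0<..<t - r}|lborel. e r (s + r))"
        unfolding set_lebesgue_integral_def
        by (subst lborel_integral_real_affine[of 1 _ r])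
           (auto intro!: Bochner_Integration.integral_cong simp: algebra_simps split: split_indicator)
    qed
    have m1: "(\<lambda>r. LINT s:{r<..<t}|lborel. e r s) \<in> borel_measurable borel"
      unfolding * by (rule set_integral_borel_measurable(1)) measurable
    show "set_integrable lborel {0<..<t} (\<lambda>r. LINT s:{r<..<t}|lborel. e r s)"
    proof (rule set_integrable_bounded[where K = "t * (K * K)"])
      fix r assume r: "r \<in> {0<..<t}"
      have "\<bar>LINT s:{r<..<t}|lborel. e r s\<bar> \<le> (t - r) * (K * K)"
        using r eK by (intro set_integral_Ioo_bound) auto
      also have "\<dots> \<le> t * (K * K)" using r K by (intro mult_right_mono) auto
      finally show "\<bar>LINT s:{r<..<t}|lborel. e r s\<bar> \<le> t * (K * K)" .
    qed (use m1 t in auto)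
    have m2: "(\<lambda>r. LINT s:{0<..<t}|lborel. (if s < r then e r s else 0)) \<in> borel_measurable borel"
      by (rule set_integral_borel_measurable(1)) measurable
    show "set_integrable lborel {0<..<t} (\<lambda>r. LINT s:{0<..<t}|lborel. (if s < r then e r s else 0))"
    proof (rule set_integrable_bounded[where K = "t * (K * K)"])
      fix r assume r: "r \<in> {0<..<t}"
      show "\<bar>LINT s:{0<..<t}|lborel. (if s < r then e r s else 0)\<bar> \<le> t * (K * K)"
        using set_integral_Ioo_bound[of 0 t "\<lambda>s. if s < r then e r s else 0" "K * K"] t eK K by auto
    qed (use m2 t in auto)
  qed
  also have "(LINT r:{0<..<t}|lborel. (LINT s:{0<..<t}|lborel. (if s < r then e r s else 0))) =
      (LINT s:{0<..<t}|lborel. (LINT r:{0<..<t}|lborel. (if s < r then e r s else 0)))"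
    using t eK K by (intro Fubini_rectangle[where K = "K * K"]) (auto intro: lborel.sigma_finite_measure_axioms)
  also have "\<dots> = (LINT r:{0<..<t}|lborel. (LINT s:{r<..<t}|lborel. e r s))"
  proof (intro set_lebesgue_integral_cong allI impI)
    fix r assume r: "r \<in> {0<..<t}"
    show "(LINT s:{0<..<t}|lborel. (if r < s then e s r else 0)) = (LINT s:{r<..<t}|lborel. e r s)"
      unfolding set_lebesgue_integral_def e_sym[of _ r] using r
      by (intro Bochner_Integration.integral_cong) (auto split: split_indicator)
  qed simp
  finally have ED: "expectation (\<lambda>\<omega>. (D \<omega>)\<^sup>2) = 2 * (LINT r:{0<..<t}|lborel. (LINT s:{r<..<t}|lborel. e r s))" by simp
  have e_bound: "\<bar>e r s\<bar> \<le> (2 * c / sqrt r) * (1 / (sqrt (s - r) * sqrt (sqrt (s - r))))" if r: "0 < r" and rs: "r < s" for r s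
  proof -
    let ?w = "1 / (sqrt (s - r) * sqrt (sqrt (s - r)))"
    have [measurable]: "B r \<in> borel_measurable M" using r by (intro random_variable) auto
    have i1: "integrable M (\<lambda>\<omega>. \<psi>1 (B r \<omega>))" using K1 by (intro integrable_const_bound[where B = K1]) auto
    have i2: "integrable M (\<lambda>\<omega>. \<psi>2 (B r \<omega>))" using K2 by (intro integrable_const_bound[where B = K2]) auto
    have "e r s = expectation (\<lambda>\<omega>. \<phi> (B r \<omega>) * \<phi> (B s \<omega>))" using r rs by (simp add: e_def)
    also have "\<dots> = expectation (\<lambda>\<omega>. \<phi> (B r \<omega>) * heat (s - r) \<phi> (B r \<omega>))"
    proof (rule markov[OF r rs _ \<phi>K _ \<phi>K])
      show "(\<lambda>\<omega>. \<phi> (B r \<omega>)) \<in> borel_measurable (past r)"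
        by (rule measurable_compose[OF past_measurable_self]) measurable
    qed measurable
    also have "\<bar>\<dots>\<bar> \<le> expectation (\<lambda>\<omega>. (\<psi>1 (B r \<omega>) + \<psi>2 (B r \<omega>)) * (c * ?w))"
    proof (intro order_trans[OF integral_abs_bound integral_mono] integrable_abs)
      fix \<omega>
      have "\<bar>\<phi> (B r \<omega>)\<bar> \<le> \<psi>1 (B r \<omega>) + \<psi>2 (B r \<omega>)"
        using bumpD(2)[OF \<psi>1, of "B r \<omega>"] bumpD(2)[OF \<psi>2, of "B r \<omega>"] by (simp add: \<phi>_def)
      then show "\<bar>\<phi> (B r \<omega>) * heat (s - r) \<phi> (B r \<omega>)\<bar> \<le> (\<psi>1 (B r \<omega>) + \<psi>2 (B r \<omega>)) * (c * ?w)"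
        unfolding abs_mult using h\<phi>[of "s - r"] rs by (intro mult_mono) auto
    next
      have "\<bar>\<phi> y * heat (s - r) \<phi> z\<bar> \<le> K * K" for y z
        unfolding abs_mult using \<phi>K K heat_bound[of \<phi> K "s - r" z] by (intro mult_mono) auto
      then show "integrable M (\<lambda>\<omega>. \<phi> (B r \<omega>) * heat (s - r) \<phi> (B r \<omega>))"
        by (intro integrable_const_bound[where B = "K * K"]) auto
      show "integrable M (\<lambda>\<omega>. (\<psi>1 (B r \<omega>) + \<psi>2 (B r \<omega>)) * (c * ?w))"
        by (intro integrable_mult_left Bochner_Integration.integrable_add i1 i2)
    qed
    also have "\<dots> = (expectation (\<lambda>\<omega>. \<psi>1 (B r \<omega>)) + expectation (\<lambda>\<omega>. \<psi>2 (B r \<omega>))) * (c * ?w)"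
      using i1 i2 by simp
    also have "\<dots> \<le> (1 / sqrt r + 1 / sqrt r) * (c * ?w)"
      using expectation_bump_le[OF \<psi>1 r] expectation_bump_le[OF \<psi>2 r] r rs c by (intro mult_right_mono add_mono) auto
    finally show ?thesis by (simp add: field_simps)
  qed
  have inner: "(LINT s:{r<..<t}|lborel. e r s) \<le> 8 * c * sqrt (sqrt t) * (1 / sqrt r)" if r: "r \<in> {0<..<t}" for r
  proof -
    have rt: "r < t" using r by simp
    have "(LINT s:{r<..<t}|lborel. e r s) \<le> (LINT s:{r<..<t}|lborel. (2 * c / sqrt r) * (1 / (sqrt (s - r) * sqrt (sqrt (s - r)))))"
    proof (rule set_integral_mono)
      show "set_integrable lborel {r<..<t} (\<lambda>s. e r s)"
        using rt eK by (intro set_integrable_bounded[where K = "K * K"]) auto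
      show "set_integrable lborel {r<..<t} (\<lambda>s. (2 * c / sqrt r) * (1 / (sqrt (s - r) * sqrt (sqrt (s - r)))))"
        by (intro set_integrable_mult_right inverse_three_quarters_integral rt)
    qed (use e_bound r in \<open>force dest: abs_le_D1\<close>)
    also have "\<dots> = (2 * c / sqrt r) * (4 * sqrt (sqrt (t - r)))"
      by (simp only: set_integral_mult_right inverse_three_quarters_integral(2)[OF rt])
    also have "\<dots> \<le> (2 * c / sqrt r) * (4 * sqrt (sqrt t))"
      using r c by (intro mult_left_mono) auto
    finally show ?thesis by (simp add: mult_ac)
  qed
  have "(LINT r:{0<..<t}|lborel. (LINT s:{r<..<t}|lborel. e r s)) \<le> (LINT r:{0<..<t}|lborel. 8 * c * sqrt (sqrt t) * (1 / sqrt r))"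
  proof (cases "set_integrable lborel {0<..<t} (\<lambda>r. LINT s:{r<..<t}|lborel. e r s)")
    case True
    then show ?thesis
      by (rule set_integral_mono) (use inner set_integrable_mult_right[OF inverse_sqrt_integral(1)[OF t], of "8 * c * sqrt (sqrt t)"] in auto)
  next
    \<comment> \<open>A function that is not integrable has integral 0, which is below the
      nonnegative right side.\<close>
    case False
    then have "(LINT r:{0<..<t}|lborel. (LINT s:{r<..<t}|lborel. e r s)) = 0"
      unfolding set_integrable_def set_lebesgue_integral_def by (rule not_integrable_integral_eq)
    moreover have "0 \<le> (LINT r:{0<..<t}|lborel. 8 * c * sqrt (sqrt t) * (1 / sqrt r))"
      unfolding set_integral_mult_right inverse_sqrt_integral(2)[OF t] using c t by simp
    ultimately show ?thesis by simp
  qed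
  also have "\<dots> = 16 * c * (sqrt t * sqrt (sqrt t))"
    unfolding set_integral_mult_right inverse_sqrt_integral(2)[OF t] by simp
  finally have "expectation (\<lambda>\<omega>. (D \<omega>)\<^sup>2) \<le> 32 * (sqrt t * sqrt (sqrt t)) * c"
    unfolding ED by (simp add: mult_ac)
  moreover have "expectation (\<lambda>\<omega>. (D \<omega>)\<^sup>2) = expectation (\<lambda>\<omega>. (occupation \<psi>1 t \<omega> - occupation \<psi>2 t \<omega>)\<^sup>2)"
  proof (intro Bochner_Integration.integral_cong refl)
    fix \<omega> assume "\<omega> \<in> space M"
    then have "D \<omega> = occupation \<psi>1 t \<omega> - occupation \<psi>2 t \<omega>"
      unfolding D_def \<phi>_def occupation_eq_Ioo
      using occupation_set_integrable(1)[OF bumpD(1)[OF \<psi>1] K1, of t] occupation_set_integrable(1)[OF bumpD(1)[OF \<psi>2] K2, of t] t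
      by (intro set_integral_diff) auto
    then show "(D \<omega>)\<^sup>2 = (occupation \<psi>1 t \<omega> - occupation \<psi>2 t \<omega>)\<^sup>2" by simp
  qed
  ultimately show ?thesis by (simp add: c_def)
qed

end

text \<open>The bound \<bar>D\<bar> <= m^2 * D^2 + 1 / m^2 with m = n + 1 makes the first moments of
  order 1 / m^2. Hence the sum of all \<bar>D n\<bar> has finite expectation and is finite almost
  surely.\<close>

lemma (in prob_space) AE_summable_of_L2:
  fixes D :: "nat \<Rightarrow> 'a \<Rightarrow> real"
  assumes [measurable]: "\<And>n. D n \<in> borel_measurable M" and b: "\<And>n \<omega>. \<omega> \<in> space M \<Longrightarrow> \<bar>D n \<omega>\<bar> \<le> K n"
    and L2: "\<And>n. expectation (\<lambda>\<omega>. (D n \<omega>)\<^sup>2) \<le> C / real (Suc n) ^ 4"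
  shows "AE \<omega> in M. summable (\<lambda>n. D n \<omega>)"
proof -
  have i1: "integrable M (D n)" for n
    using b by (intro integrable_const_bound[where B = "K n"]) auto
  have i2: "integrable M (\<lambda>\<omega>. (D n \<omega>)\<^sup>2)" for n
  proof (rule integrable_const_bound[where B = "(K n)\<^sup>2"])
    show "AE \<omega> in M. norm ((D n \<omega>)\<^sup>2) \<le> (K n)\<^sup>2"
      using b by (intro AE_I2) (simp add: abs_le_square_iff[symmetric] order_trans[OF b abs_ge_self])
  qed simp
  have E: "expectation (\<lambda>\<omega>. \<bar>D n \<omega>\<bar>) \<le> (C + 1) * (1 / real (Suc n) ^ 2)" for n
  proof -
    define m where "m = real (Suc n)"
    have m: "m > 0" by (simp add: m_def)
    have "expectation (\<lambda>\<omega>. \<bar>D n \<omega>\<bar>) \<le> expectation (\<lambda>\<omega>. m\<^sup>2 * (D n \<omega>)\<^sup>2 + 1 / m\<^sup>2)"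
    proof (intro integral_mono integrable_abs i1 Bochner_Integration.integrable_add integrable_mult_right i2)
      fix \<omega>
      have "0 \<le> (m * \<bar>D n \<omega>\<bar> - 1 / m)\<^sup>2" by simp
      also have "\<dots> = m\<^sup>2 * (D n \<omega>)\<^sup>2 + 1 / m\<^sup>2 - 2 * \<bar>D n \<omega>\<bar>"
        using m by (simp add: power2_diff power_mult_distrib power_divide)
      finally show "\<bar>D n \<omega>\<bar> \<le> m\<^sup>2 * (D n \<omega>)\<^sup>2 + 1 / m\<^sup>2" by linarith
    qed simp
    also have "\<dots> = m\<^sup>2 * expectation (\<lambda>\<omega>. (D n \<omega>)\<^sup>2) + 1 / m\<^sup>2"
      using i2[of n] by (simp add: prob_space)
    also have "\<dots> \<le> m\<^sup>2 * (C / m ^ 4) + 1 / m\<^sup>2"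
      using L2[of n] by (intro add_right_mono mult_left_mono) (auto simp: m_def)
    also have "\<dots> = (C + 1) * (1 / m\<^sup>2)" using m by (simp add: field_simps eval_nat_numeral)
    finally show ?thesis by (simp add: m_def)
  qed
  have C: "0 \<le> C"
  proof -
    have "0 \<le> expectation (\<lambda>\<omega>. (D 0 \<omega>)\<^sup>2)" by simp
    from order_trans[OF this L2[of 0]] show ?thesis by simp
  qed
  have sum: "summable (\<lambda>n. (C + 1) * (1 / real (Suc n) ^ 2))"
    using inverse_power_summable[of 2, where ?'a = real] by (intro summable_mult) (subst summable_Suc_iff, simp add: inverse_eq_divide)
  have "(\<integral>\<^sup>+\<omega>. (\<Sum>n. ennreal \<bar>D n \<omega>\<bar>) \<partial>M) = (\<Sum>n. \<integral>\<^sup>+\<omega>. ennreal \<bar>D n \<omega>\<bar> \<partial>M)"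
    by (rule nn_integral_suminf) measurable
  also have "\<dots> \<le> (\<Sum>n. ennreal ((C + 1) * (1 / real (Suc n) ^ 2)))"
    using E i1 by (intro suminf_le) (auto simp: nn_integral_eq_integral intro: ennreal_leI)
  also have "\<dots> < \<infinity>"
    using sum C by (subst suminf_ennreal2) auto
  finally have "(\<integral>\<^sup>+\<omega>. (\<Sum>n. ennreal \<bar>D n \<omega>\<bar>) \<partial>M) \<noteq> \<infinity>" by simp
  then have "AE \<omega> in M. (\<Sum>n. ennreal \<bar>D n \<omega>\<bar>) \<noteq> \<infinity>"
    by (intro nn_integral_noteq_infinite) auto
  then show ?thesis
  proof eventually_elim
    fix \<omega> assume "(\<Sum>n. ennreal \<bar>D n \<omega>\<bar>) \<noteq> \<infinity>"
    then have "summable (\<lambda>n. \<bar>D n \<omega>\<bar>)" by (intro summable_suminf_not_top) auto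
    then show "summable (\<lambda>n. D n \<omega>)" by (rule summable_rabs_cancel)
  qed
qed

text \<open>If f is not integrable its integral is 0 by convention and the bound holds as well. This
  allows estimates such as those in \<open>feynman_kac_error\<close> without a separate
  integrability proof for f.\<close>

lemma integral_abs_le:
  fixes f g :: "'a \<Rightarrow> real"
  assumes g: "integrable M g" and fg: "\<And>x. x \<in> space M \<Longrightarrow> \<bar>f x\<bar> \<le> g x"
  shows "\<bar>\<integral>x. f x \<partial>M\<bar> \<le> (\<integral>x. g x \<partial>M)"
proof (cases "integrable M f")
  case True
  then show ?thesis
    by (rule order_trans[OF integral_abs_bound integral_mono[OF integrable_abs g fg]])
next
  case False
  have "0 \<le> (\<integral>x. g x \<partial>M)"
    by (rule Bochner_Integration.integral_nonneg) (use fg in \<open>force intro: order_trans[OF abs_ge_zero]\<close>)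
  then show ?thesis by (simp add: not_integrable_integral_eq[OF False])
qed

lemma set_integral_abs_le:
  fixes f g :: "'a \<Rightarrow> real"
  assumes g: "set_integrable M A g" and fg: "\<And>x. x \<in> A \<Longrightarrow> \<bar>f x\<bar> \<le> g x"
  shows "\<bar>LINT x:A|M. f x\<bar> \<le> (LINT x:A|M. g x)"
  unfolding set_lebesgue_integral_def
  using assms by (intro integral_abs_le) (auto simp: set_integrable_def split: split_indicator)

section \<open>Existence of the local time\<close>

text \<open>For \<epsilon> between e (Suc n) and e n, monotonicity squeezes A \<epsilon> / (2 *
  \<epsilon>) between A (e (Suc n)) / (2 * e n) and A (e n) / (2 * e (Suc n)). As consecutive ratios
  tend to 1, both bounds tend to L.\<close>

lemma scaled_mono_tendsto_iff:
  fixes A :: "real \<Rightarrow> real" and e :: "nat \<Rightarrow> real"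
  assumes mono: "\<And>\<epsilon> \<delta>. 0 < \<epsilon> \<Longrightarrow> \<epsilon> \<le> \<delta> \<Longrightarrow> A \<epsilon> \<le> A \<delta>" and nonneg: "\<And>\<epsilon>. 0 < \<epsilon> \<Longrightarrow> 0 \<le> A \<epsilon>"
    and e: "\<And>n. 0 < e n" "decseq e" "e \<longlonglongrightarrow> 0" "(\<lambda>n. e n / e (Suc n)) \<longlonglongrightarrow> 1"
  shows "((\<lambda>\<epsilon>. A \<epsilon> / (2 * \<epsilon>)) \<longlongrightarrow> L) (at_right 0) \<longleftrightarrow> (\<lambda>n. A (e n) / (2 * e n)) \<longlonglongrightarrow> L"
proof
  assume "((\<lambda>\<epsilon>. A \<epsilon> / (2 * \<epsilon>)) \<longlongrightarrow> L) (at_right 0)"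
  moreover have "filterlim e (at_right 0) sequentially"
    using e by (intro tendsto_imp_filterlim_at_right) auto
  ultimately show "(\<lambda>n. A (e n) / (2 * e n)) \<longlonglongrightarrow> L"
    by (rule filterlim_compose)
next
  assume X: "(\<lambda>n. A (e n) / (2 * e n)) \<longlonglongrightarrow> L"
  have "(\<lambda>n. A (e n) / (2 * e n) * (e n / e (Suc n))) \<longlonglongrightarrow> L * 1"
    by (intro tendsto_intros X e)
  moreover have "(\<lambda>n. A (e n) / (2 * e n) * (e n / e (Suc n))) = (\<lambda>n. A (e n) / (2 * e (Suc n)))"
    using e(1) by (auto simp: field_simps less_imp_neq[symmetric])
  ultimately have U: "(\<lambda>n. A (e n) / (2 * e (Suc n))) \<longlonglongrightarrow> L" by simp
  have "(\<lambda>n. A (e (Suc n)) / (2 * e (Suc n)) / (e n / e (Suc n))) \<longlonglongrightarrow> L / 1"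
    by (intro tendsto_intros LIMSEQ_Suc[OF X] e) auto
  moreover have "(\<lambda>n. A (e (Suc n)) / (2 * e (Suc n)) / (e n / e (Suc n))) = (\<lambda>n. A (e (Suc n)) / (2 * e n))"
    using e(1) by (auto simp: field_simps less_imp_neq[symmetric])
  ultimately have D: "(\<lambda>n. A (e (Suc n)) / (2 * e n)) \<longlonglongrightarrow> L" by simp
  show "((\<lambda>\<epsilon>. A \<epsilon> / (2 * \<epsilon>)) \<longlongrightarrow> L) (at_right 0)"
  proof (rule tendstoI)
    fix \<eta> :: real assume "0 < \<eta>"
    then have "\<forall>\<^sub>F n in sequentially. dist (A (e n) / (2 * e (Suc n))) L < \<eta> \<and> dist (A (e (Suc n)) / (2 * e n)) L < \<eta>"
      using tendstoD[OF U] tendstoD[OF D] by (intro eventually_conj) auto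
    then obtain N where N: "\<And>n. n \<ge> N \<Longrightarrow> dist (A (e n) / (2 * e (Suc n))) L < \<eta>"
        "\<And>n. n \<ge> N \<Longrightarrow> dist (A (e (Suc n)) / (2 * e n)) L < \<eta>"
      by (auto simp: eventually_sequentially)
    have "dist (A \<epsilon> / (2 * \<epsilon>)) L < \<eta>" if \<epsilon>: "0 < \<epsilon>" "\<epsilon> < e N" for \<epsilon>
    proof -
      have ex: "\<exists>n. e (Suc n) < \<epsilon>"
        using order_tendstoD(2)[OF LIMSEQ_Suc[OF e(3)] \<epsilon>(1)] by (auto simp: eventually_sequentially)
      \<comment> \<open>Minimality gives \<epsilon> <= e n for positive n; for n = 0 this comes from
        \<epsilon> < e N and monotonicity.\<close>
      define n where "n = (LEAST n. e (Suc n) < \<epsilon>)"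
      have n1: "e (Suc n) < \<epsilon>" unfolding n_def using ex by (rule LeastI_ex)
      have n2: "\<epsilon> \<le> e n"
      proof (cases n)
        case 0
        then show ?thesis using \<epsilon> decseqD[OF e(2), of 0 N] by simp
      next
        case (Suc m)
        then show ?thesis using not_less_Least[of m "\<lambda>n. e (Suc n) < \<epsilon>"] by (simp add: n_def not_less)
      qed
      have "N \<le> n"
      proof (rule ccontr)
        assume "\<not> N \<le> n"
        then have "e N \<le> e (Suc n)" by (intro decseqD[OF e(2)]) auto
        then show False using n1 \<epsilon> by simp
      qed
      note N = N[OF this]
      have "A \<epsilon> / (2 * \<epsilon>) \<le> A (e n) / (2 * e (Suc n))"
        using \<epsilon> n1 n2 e(1)[of "Suc n"] nonneg[OF e(1)] by (intro frac_le mono) auto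
      moreover have "A (e (Suc n)) / (2 * e n) \<le> A \<epsilon> / (2 * \<epsilon>)"
        using \<epsilon> n1 n2 e(1)[of "Suc n"] nonneg[OF \<epsilon>(1)] by (intro frac_le mono) auto
      ultimately show ?thesis using N by (simp add: dist_real_def)
    qed
    then show "\<forall>\<^sub>F \<epsilon> in at_right 0. dist (A \<epsilon> / (2 * \<epsilon>)) L < \<eta>"
      using eventually_at_right_real[OF e(1)[of N]] by (auto elim!: eventually_mono)
  qed
qed

text \<open>The box is the one in the definition of the local time; the tent has the same limit and is
  continuous, so that its occupation functional is continuously differentiable in time.\<close>

definition box_bump :: "real \<Rightarrow> real \<Rightarrow> real" where
  "box_bump \<epsilon> y = indicator {- \<epsilon><..<\<epsilon>} y / (2 * \<epsilon>)"

definition tent_bump :: "real \<Rightarrow> real \<Rightarrow> real" where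
  "tent_bump \<epsilon> y = max 0 (1 - \<bar>y\<bar> / \<epsilon>) / \<epsilon>"

lemma bump_box:
  assumes "\<epsilon> > 0"
  shows "bump \<epsilon> (box_bump \<epsilon>)"
  unfolding bump_def
proof (intro conjI allI)
  show "\<exists>K. \<forall>y. box_bump \<epsilon> y \<le> K"
    using assms by (intro exI[of _ "1 / (2 * \<epsilon>)"]) (auto simp: box_bump_def split: split_indicator)
  show "integrable lborel (box_bump \<epsilon>)" "(\<integral>y. box_bump \<epsilon> y \<partial>lborel) = 1"
    unfolding box_bump_def[abs_def] using assms by simp_all
qed (use assms in \<open>auto simp: box_bump_def[abs_def] split: split_indicator\<close>)

lemma tent_bump_continuous: "\<epsilon> > 0 \<Longrightarrow> continuous_on UNIV (tent_bump \<epsilon>)"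
  unfolding tent_bump_def[abs_def] by (intro continuous_intros) auto

lemma tent_bump_bounds:
  assumes "\<epsilon> > 0"
  shows "0 \<le> tent_bump \<epsilon> y" "tent_bump \<epsilon> y \<le> 1 / \<epsilon>"
  using assms by (auto simp: tent_bump_def intro!: divide_right_mono)

lemma bump_tent:
  assumes \<epsilon>: "\<epsilon> > 0"
  shows "bump \<epsilon> (tent_bump \<epsilon>)"
proof -
  have m [measurable]: "tent_bump \<epsilon> \<in> borel_measurable borel"
    using tent_bump_continuous[OF \<epsilon>] by (rule borel_measurable_continuous_onI)
  have out: "tent_bump \<epsilon> y = 0" if "\<epsilon> \<le> \<bar>y\<bar>" for y
    using that \<epsilon> by (simp add: tent_bump_def)
  have tent_minus: "tent_bump \<epsilon> (- y) = tent_bump \<epsilon> y" for y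
    by (simp add: tent_bump_def)
  have supp: "(\<lambda>y. indicator {-\<epsilon>..\<epsilon>} y *\<^sub>R tent_bump \<epsilon> y) = tent_bump \<epsilon>"
  proof
    fix y
    show "indicator {-\<epsilon>..\<epsilon>} y *\<^sub>R tent_bump \<epsilon> y = tent_bump \<epsilon> y"
      using out[of y] by (auto split: split_indicator)
  qed
  have "set_integrable lborel {-\<epsilon>..\<epsilon>} (tent_bump \<epsilon>)"
    by (rule borel_integrable_atLeastAtMost'[OF continuous_on_subset[OF tent_bump_continuous[OF \<epsilon>] subset_UNIV]])
  then have int: "integrable lborel (tent_bump \<epsilon>)"
    unfolding set_integrable_def supp .
  have "(LINT y:{0..}|lborel. tent_bump \<epsilon> y) = (\<integral>y. indicator {0..\<epsilon>} y *\<^sub>R ((1 - y / \<epsilon>) / \<epsilon>) \<partial>lborel)"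
    unfolding set_lebesgue_integral_def
    using \<epsilon> by (intro Bochner_Integration.integral_cong) (auto simp: tent_bump_def split: split_indicator)
  also have "\<dots> = (\<epsilon> / \<epsilon> - \<epsilon>\<^sup>2 / (2 * \<epsilon>\<^sup>2)) - (0 / \<epsilon> - 0\<^sup>2 / (2 * \<epsilon>\<^sup>2))"
    using \<epsilon>
    by (intro integral_FTC_atLeastAtMost[where F = "\<lambda>y. y / \<epsilon> - y\<^sup>2 / (2 * \<epsilon>\<^sup>2)"])
       (auto intro!: continuous_intros derivative_eq_intros simp: field_simps power2_eq_square
         simp flip: has_real_derivative_iff_has_vector_derivative)
  also have "\<dots> = 1 / 2" using \<epsilon> by simp
  finally have "(\<integral>y. tent_bump \<epsilon> y \<partial>lborel) = 1"
    using tent_minus by (simp add: integral_half_lines[OF int])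
  then show ?thesis
    unfolding bump_def using m int out tent_bump_bounds[OF \<epsilon>] by (auto intro!: exI[of _ "1 / \<epsilon>"])
qed

text \<open>The power 8 makes \<open>sqrt (eps_seq n)\<close> decay fast enough for \<open>AE_summable_of_L2\<close>, and
  consecutive terms still have ratio tending to 1.\<close>

definition eps_seq :: "nat \<Rightarrow> real" where
  "eps_seq n = 1 / real (Suc n) ^ 8"

lemma eps_seq_pos: "eps_seq n > 0"
  by (simp add: eps_seq_def)

lemma eps_seq_decseq: "decseq eps_seq"
  unfolding eps_seq_def decseq_def by (auto intro!: divide_left_mono power_mono)

lemma sqrt_eps_seq: "sqrt (eps_seq n) = 1 / real (Suc n) ^ 4"
proof -
  have "eps_seq n = (1 / real (Suc n) ^ 4)\<^sup>2"
    by (simp add: eps_seq_def power_divide flip: power_mult)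
  then show ?thesis by (simp add: real_sqrt_abs)
qed

lemma eps_seq_lim: "eps_seq \<longlonglongrightarrow> 0"
proof -
  have "(\<lambda>n. (1 / real (Suc n)) ^ 8) \<longlonglongrightarrow> 0 ^ 8"
    by (intro tendsto_power LIMSEQ_Suc[OF lim_1_over_n])
  then show ?thesis by (simp add: eps_seq_def[abs_def] power_divide)
qed

lemma eps_seq_ratio: "(\<lambda>n. eps_seq n / eps_seq (Suc n)) \<longlonglongrightarrow> 1"
proof -
  have "(\<lambda>n. (1 + 1 / real (Suc n)) ^ 8) \<longlonglongrightarrow> (1 + 0) ^ 8"
    by (intro tendsto_intros LIMSEQ_Suc[OF lim_1_over_n])
  moreover have "(1 + 1 / real (Suc n)) ^ 8 = eps_seq n / eps_seq (Suc n)" for n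
  proof -
    have "1 + 1 / real (Suc n) = real (Suc (Suc n)) / real (Suc n)" by (simp add: field_simps)
    then show ?thesis by (simp only: eps_seq_def power_divide) simp
  qed
  ultimately show ?thesis by simp
qed

context brownian_motion
begin

text \<open>This holds for every path: if the limit does not exist, both sides are \<open>THE l. False\<close>. Hence
  the local time is measurable although \<open>M\<close> need not be complete.\<close>

lemma local_time_eq_lim:
  assumes t: "t \<ge> 0" and \<omega>: "\<omega> \<in> space M"
  shows "local_time B t \<omega> = lim (\<lambda>n. occupation (box_bump (eps_seq n)) t \<omega>)"
proof -
  define A where "A \<epsilon> = (LINT s:{0..t}|lborel. indicator {-\<epsilon><..<\<epsilon>} (B s \<omega>) :: real)" for \<epsilon>
  have A_BB: "A \<epsilon> = (LINT s:{0..t}|lborel. indicator {-\<epsilon><..<\<epsilon>} (BB s \<omega>))" for \<epsilon>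
    unfolding A_def by (intro set_lebesgue_integral_cong) auto
  have i: "set_integrable lborel {0..t} (\<lambda>s. indicator {-\<epsilon><..<\<epsilon>} (BB s \<omega>) :: real)" for \<epsilon>
  proof (rule set_integrable_bounded[where K = 1])
    have "(\<lambda>s. BB s \<omega>) \<in> borel_measurable lborel" using \<omega> by measurable
    then show "(\<lambda>s. indicator {-\<epsilon><..<\<epsilon>} (BB s \<omega>) :: real) \<in> borel_measurable lborel" by measurable
  qed (use t in auto)
  have "((\<lambda>\<epsilon>. A \<epsilon> / (2 * \<epsilon>)) \<longlongrightarrow> L) (at_right 0) \<longleftrightarrow> (\<lambda>n. A (eps_seq n) / (2 * eps_seq n)) \<longlonglongrightarrow> L" for L
  proof (rule scaled_mono_tendsto_iff[OF _ _ eps_seq_pos eps_seq_decseq eps_seq_lim eps_seq_ratio])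
    show "A \<epsilon> \<le> A \<delta>" if "0 < \<epsilon>" "\<epsilon> \<le> \<delta>" for \<epsilon> \<delta>
      unfolding A_BB using that by (intro set_integral_mono i) (auto split: split_indicator)
    show "0 \<le> A \<epsilon>" for \<epsilon>
      unfolding A_def set_lebesgue_integral_def by (intro Bochner_Integration.integral_nonneg) auto
  qed
  moreover have "A (eps_seq n) / (2 * eps_seq n) = occupation (box_bump (eps_seq n)) t \<omega>" for n
    unfolding A_BB occupation_def box_bump_def by simp
  moreover have "local_time B t \<omega> = Lim (at_right 0) (\<lambda>\<epsilon>. A \<epsilon> / (2 * \<epsilon>))"
    unfolding local_time_def A_def by simp
  ultimately show ?thesis
    unfolding lim_def t2_space_class.Lim_def by simp
qed

lemma local_time_measurable:
  assumes "t \<ge> 0"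
  shows "local_time B t \<in> borel_measurable M"
proof -
  have "(\<lambda>\<omega>. lim (\<lambda>n. occupation (box_bump (eps_seq n)) t \<omega>)) \<in> borel_measurable M"
    using bumpD(1)[OF bump_box[OF eps_seq_pos]] by measurable
  then show ?thesis
    using local_time_eq_lim[OF assms] by (simp cong: measurable_cong)
qed

text \<open>Consecutive boxes, and box and tent of the same width, have almost surely summable
  differences. So the boxes converge, their limit is the local time by
  \<open>local_time_eq_lim\<close>, and the tents share it.\<close>

lemma AE_local_time:
  assumes t: "t > 0"
  shows "AE \<omega> in M. 0 \<le> local_time B t \<omega> \<and> (\<lambda>n. occupation (tent_bump (eps_seq n)) t \<omega>) \<longlonglongrightarrow> local_time B t \<omega>"
proof -
  let ?X = "\<lambda>n. occupation (box_bump (eps_seq n)) t" and ?Y = "\<lambda>n. occupation (tent_bump (eps_seq n)) t"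
  \<comment> \<open>Twice the constant of \<open>occupation_L2\<close>, as the sum of the two square
    roots is at most twice the larger one.\<close>
  define c where "c = 64 * (sqrt t * sqrt (sqrt t))"
  have c: "0 \<le> c" using t by (simp add: c_def)
  note bb = bump_box[OF eps_seq_pos] and bt = bump_tent[OF eps_seq_pos]
  have [measurable]: "box_bump (eps_seq n) \<in> borel_measurable borel" "tent_bump (eps_seq n) \<in> borel_measurable borel" for n
    by (rule bumpD(1)[OF bb], rule bumpD(1)[OF bt])
  have bounded: "\<exists>K. \<forall>\<omega>\<in>space M. \<bar>occupation \<psi>1 t \<omega> - occupation \<psi>2 t \<omega>\<bar> \<le> K"
    if \<psi>1: "bump \<epsilon> \<psi>1" and \<psi>2: "bump \<delta> \<psi>2" for \<psi>1 \<psi>2 \<epsilon> \<delta>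
  proof -
    obtain K1 where K1: "\<And>y. \<bar>\<psi>1 y\<bar> \<le> K1" using bump_bounded[OF \<psi>1] by blast
    obtain K2 where K2: "\<And>y. \<bar>\<psi>2 y\<bar> \<le> K2" using bump_bounded[OF \<psi>2] by blast
    have "\<bar>occupation \<psi>1 t \<omega> - occupation \<psi>2 t \<omega>\<bar> \<le> t * K1 + t * K2" if "\<omega> \<in> space M" for \<omega>
      using occupation_set_integrable(2)[OF bumpD(1)[OF \<psi>1] K1 less_imp_le[OF t] that]
        occupation_set_integrable(2)[OF bumpD(1)[OF \<psi>2] K2 less_imp_le[OF t] that] by linarith
    then show ?thesis by blast
  qed
  have s4: "sqrt (eps_seq n) + sqrt (eps_seq m) \<le> 2 * (1 / real (Suc n) ^ 4)" if "n \<le> m" for n m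
  proof -
    have "sqrt (eps_seq m) \<le> sqrt (eps_seq n)" using decseqD[OF eps_seq_decseq that] by simp
    then show ?thesis by (simp add: sqrt_eps_seq)
  qed
  have L2: "expectation (\<lambda>\<omega>. (occupation \<psi>1 t \<omega> - occupation \<psi>2 t \<omega>)\<^sup>2) \<le> c / real (Suc n) ^ 4"
    if \<psi>1: "bump (eps_seq n) \<psi>1" and \<psi>2: "bump (eps_seq m) \<psi>2" and nm: "n \<le> m" for \<psi>1 \<psi>2 n m
  proof -
    have "expectation (\<lambda>\<omega>. (occupation \<psi>1 t \<omega> - occupation \<psi>2 t \<omega>)\<^sup>2) \<le>
        32 * (sqrt t * sqrt (sqrt t)) * (sqrt (eps_seq n) + sqrt (eps_seq m))"
      by (rule occupation_L2[OF \<psi>1 \<psi>2 t]) (auto intro: less_imp_le eps_seq_pos)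
    also have "\<dots> \<le> 32 * (sqrt t * sqrt (sqrt t)) * (2 * (1 / real (Suc n) ^ 4))"
      using s4[OF nm] t by (intro mult_left_mono) auto
    finally show ?thesis by (simp add: c_def)
  qed
  have "\<exists>K. \<forall>n. \<forall>\<omega>\<in>space M. \<bar>?X (Suc n) \<omega> - ?X n \<omega>\<bar> \<le> K n"
    by (intro choice allI bounded[OF bb bb])
  then obtain K1 where K1: "\<And>n \<omega>. \<omega> \<in> space M \<Longrightarrow> \<bar>?X (Suc n) \<omega> - ?X n \<omega>\<bar> \<le> K1 n" by blast
  have SX: "AE \<omega> in M. summable (\<lambda>n. ?X (Suc n) \<omega> - ?X n \<omega>)"
  proof (rule AE_summable_of_L2[OF _ K1])
    show "expectation (\<lambda>\<omega>. (?X (Suc n) \<omega> - ?X n \<omega>)\<^sup>2) \<le> c / real (Suc n) ^ 4" for n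
      using L2[OF bb bb, of n "Suc n"] by (simp add: power2_commute)
  qed measurable
  have "\<exists>K. \<forall>n. \<forall>\<omega>\<in>space M. \<bar>?X n \<omega> - ?Y n \<omega>\<bar> \<le> K n"
    by (intro choice allI bounded[OF bb bt])
  then obtain K2 where K2: "\<And>n \<omega>. \<omega> \<in> space M \<Longrightarrow> \<bar>?X n \<omega> - ?Y n \<omega>\<bar> \<le> K2 n" by blast
  have SY: "AE \<omega> in M. summable (\<lambda>n. ?X n \<omega> - ?Y n \<omega>)"
    by (rule AE_summable_of_L2[OF _ K2]) (measurable, rule L2[OF bb bt order_refl])
  show ?thesis
    using SX SY AE_space
  proof eventually_elim
    fix \<omega> assume s: "summable (\<lambda>n. ?X (Suc n) \<omega> - ?X n \<omega>)" "summable (\<lambda>n. ?X n \<omega> - ?Y n \<omega>)" and \<omega>: "\<omega> \<in> space M"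
    have "convergent (\<lambda>n. \<Sum>i<n. ?X (Suc i) \<omega> - ?X i \<omega>)"
      using s(1) by (simp add: summable_iff_convergent)
    then have "convergent (\<lambda>n. (?X n \<omega> - ?X 0 \<omega>) + ?X 0 \<omega>)"
      unfolding sum_lessThan_telescope[of "\<lambda>n. ?X n \<omega>"] by (intro convergent_add convergent_const)
    then have "convergent (\<lambda>n. ?X n \<omega>)" by simp
    then have X: "(\<lambda>n. ?X n \<omega>) \<longlonglongrightarrow> local_time B t \<omega>"
      unfolding local_time_eq_lim[OF less_imp_le[OF t] \<omega>] by (simp add: convergent_LIMSEQ_iff)
    have "(\<lambda>n. ?X n \<omega> - (?X n \<omega> - ?Y n \<omega>)) \<longlonglongrightarrow> local_time B t \<omega> - 0"
      by (intro tendsto_diff X summable_LIMSEQ_zero s)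
    then have Y: "(\<lambda>n. ?Y n \<omega>) \<longlonglongrightarrow> local_time B t \<omega>" by simp
    have "0 \<le> ?Y n \<omega>" for n
      unfolding occupation_def set_lebesgue_integral_def
      using tent_bump_bounds(1)[OF eps_seq_pos] by (intro Bochner_Integration.integral_nonneg) auto
    then have "0 \<le> local_time B t \<omega>"
      by (intro LIMSEQ_le_const[OF Y]) auto
    then show "0 \<le> local_time B t \<omega> \<and> (\<lambda>n. ?Y n \<omega>) \<longlonglongrightarrow> local_time B t \<omega>" using Y by simp
  qed
qed

section \<open>Identification of the Robin solution with the killed expectation\<close>

text \<open>Replacing the Gaussian by a tent in the Duhamel formula of the Robin solution costs c *
  sqrt \<epsilon>: 3 * C bounds the boundary value, and 4 * sqrt (sqrt t) integrates s to the power
  -3/4. The killing weight lives on \<bar>BB s \<omega>\<bar> <= \<epsilon>, where \<eta> bounds the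
  oscillation of the solution; its mean is at most 1 / sqrt s, with integral 2 * sqrt t.\<close>

lemma feynman_kac_error:
  assumes "robin \<kappa> h C" and t: "t > 0" and \<epsilon>: "\<epsilon> > 0"
    and \<eta>: "\<And>\<tau> y. 0 < \<tau> \<Longrightarrow> \<tau> < t \<Longrightarrow> \<bar>y\<bar> \<le> \<epsilon> \<Longrightarrow> \<bar>heat \<tau> (robin_ext \<kappa> h) 0 - heat \<tau> (robin_ext \<kappa> h) \<bar>y\<bar>\<bar> \<le> \<eta>"
  defines "c \<equiv> \<kappa> * (3 * C * (4 * sqrt (sqrt t)))"
  shows "\<bar>expectation (\<lambda>\<omega>. exp (- \<kappa> * occupation (tent_bump \<epsilon>) t \<omega>) * h \<bar>B t \<omega>\<bar>) - heat t (robin_ext \<kappa> h) \<bar>x\<bar>\<bar>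
    \<le> c * sqrt \<epsilon> + \<kappa> * ((\<eta> + c * sqrt \<epsilon>) * (2 * sqrt t))"
proof -
  interpret robin \<kappa> h C by fact
  let ?V = "tent_bump \<epsilon>" and ?G = "robin_ext \<kappa> h"
  note bt = bump_tent[OF \<epsilon>]
  interpret killed_brownian_motion M B x ?V "1 / \<epsilon>"
    by unfold_locales (use tent_bump_continuous[OF \<epsilon>] tent_bump_bounds[OF \<epsilon>] in auto)
  have c: "c \<ge> 0" using \<kappa> C_nonneg t by (simp add: c_def)
  define a where "a s = heat s ?G 0" for s
  have [measurable]: "a \<in> borel_measurable borel" unfolding a_def[abs_def] by measurable
  have ab: "\<bar>a s\<bar> \<le> 3 * C" for s
    unfolding a_def by (rule heat_bound[OF robin_ext_measurable robin_ext_bound])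
  have m: "(\<lambda>z. h \<bar>z\<bar>) \<in> borel_measurable borel" by measurable
  define v where "v \<tau> y = heat \<tau> (\<lambda>z. h \<bar>z\<bar>) y - \<kappa> * (LINT \<sigma>:{0<..<\<tau>}|lborel. a (\<tau> - \<sigma>) * heat \<sigma> ?V y)" for \<tau> y
  have v: "\<bar>v \<tau> y - heat \<tau> ?G \<bar>y\<bar>\<bar> \<le> c * sqrt \<epsilon>" if \<tau>: "0 < \<tau>" "\<tau> \<le> t" for \<tau> y
  proof -
    have ahV: "\<bar>a (\<tau> - \<sigma>) * heat \<sigma> ?V y\<bar> \<le> 3 * C * (1 / \<epsilon>)" for \<sigma>
      unfolding abs_mult using ab C_nonneg heat_bound[OF V_measurable V_abs] by (intro mult_mono) auto
    have i1: "set_integrable lborel {0<..<\<tau>} (\<lambda>\<sigma>. a (\<tau> - \<sigma>) * heat \<sigma> ?V y)"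
      using \<tau> ahV by (intro set_integrable_bounded[where K = "3 * C * (1 / \<epsilon>)"]) auto
    have i2: "set_integrable lborel {0<..<\<tau>} (\<lambda>\<sigma>. a (\<tau> - \<sigma>) * gauss \<sigma> y)"
    proof (rule set_integrable_bound[OF set_integrable_mult_right[OF inverse_sqrt_integral(1)[OF \<tau>(1)], of "3 * C"]])
      show "set_borel_measurable lborel {0<..<\<tau>} (\<lambda>\<sigma>. a (\<tau> - \<sigma>) * gauss \<sigma> y)"
        unfolding set_borel_measurable_def by measurable
      have "\<bar>a (\<tau> - \<sigma>) * gauss \<sigma> y\<bar> \<le> 3 * C * (1 / sqrt \<sigma>)" if "0 < \<sigma>" for \<sigma>
        unfolding abs_mult using ab gauss_le[OF that, of y] C_nonneg that by (intro mult_mono) auto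
      then show "AE \<sigma> in lborel. \<sigma> \<in> {0<..<\<tau>} \<longrightarrow> norm (a (\<tau> - \<sigma>) * gauss \<sigma> y) \<le> norm (3 * C * (1 / sqrt \<sigma>))"
        using C_nonneg by (intro AE_I2) auto
    qed
    have diff: "heat \<tau> ?G \<bar>y\<bar> - v \<tau> y = \<kappa> * (LINT \<sigma>:{0<..<\<tau>}|lborel. a (\<tau> - \<sigma>) * heat \<sigma> ?V y - a (\<tau> - \<sigma>) * gauss \<sigma> y)"
      unfolding robin_duhamel[OF \<tau>(1)] v_def a_def[symmetric] using i1 i2 by (simp add: right_diff_distrib)
    have "\<bar>heat \<tau> ?G \<bar>y\<bar> - v \<tau> y\<bar> \<le> \<kappa> * (LINT \<sigma>:{0<..<\<tau>}|lborel. 3 * C * sqrt \<epsilon> * (1 / (sqrt (\<sigma> - 0) * sqrt (sqrt (\<sigma> - 0)))))"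
      unfolding diff abs_mult[of \<kappa>] abs_of_pos[OF \<kappa>]
    proof (intro mult_left_mono set_integral_abs_le set_integrable_mult_right inverse_three_quarters_integral \<tau>)
      fix \<sigma> assume \<sigma>: "\<sigma> \<in> {0<..<\<tau>}"
      have "\<bar>a (\<tau> - \<sigma>) * (heat \<sigma> ?V y - gauss \<sigma> y)\<bar> \<le> 3 * C * (sqrt \<epsilon> * (1 / (sqrt \<sigma> * sqrt (sqrt \<sigma>))))"
        unfolding abs_mult using \<sigma> ab C_nonneg heat_bump_approx[OF bt] by (intro mult_mono) auto
      then show "\<bar>a (\<tau> - \<sigma>) * heat \<sigma> ?V y - a (\<tau> - \<sigma>) * gauss \<sigma> y\<bar> \<le> 3 * C * sqrt \<epsilon> * (1 / (sqrt (\<sigma> - 0) * sqrt (sqrt (\<sigma> - 0))))"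
        by (simp add: right_diff_distrib)
    qed (use \<kappa> in auto)
    also have "\<dots> = \<kappa> * (3 * C * sqrt \<epsilon> * (4 * sqrt (sqrt \<tau>)))"
      unfolding set_integral_mult_right inverse_three_quarters_integral(2)[OF \<tau>(1)] by simp
    also have "\<dots> \<le> \<kappa> * (3 * C * sqrt \<epsilon> * (4 * sqrt (sqrt t)))"
      using \<tau> \<kappa> C_nonneg \<epsilon> by (intro mult_left_mono mult_nonneg_nonneg real_sqrt_le_mono) auto
    also have "\<dots> = c * sqrt \<epsilon>" by (simp only: c_def mult_ac)
    finally show ?thesis by (simp only: abs_minus_commute)
  qed
  have "\<bar>LINT s:{0<..<t}|lborel. expectation (\<lambda>\<omega>. killing_weight \<kappa> s \<omega> * (a (t - s) - v (t - s) (BB s \<omega>)))\<bar>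
      \<le> (LINT s:{0<..<t}|lborel. (\<eta> + c * sqrt \<epsilon>) * (1 / sqrt s))"
  proof (intro set_integral_abs_le set_integrable_mult_right inverse_sqrt_integral t)
    fix s assume s: "s \<in> {0<..<t}"
    have \<eta>0: "0 \<le> \<eta> + c * sqrt \<epsilon>"
      using order_trans[OF abs_ge_zero \<eta>[of s 0]] s c \<epsilon> by simp
    have i: "integrable M (\<lambda>\<omega>. ?V (BB s \<omega>))"
      using V_abs by (intro integrable_const_bound[where B = "1 / \<epsilon>"]) (auto simp del: BB_eq)
    have "\<bar>expectation (\<lambda>\<omega>. killing_weight \<kappa> s \<omega> * (a (t - s) - v (t - s) (BB s \<omega>)))\<bar> \<le>
        expectation (\<lambda>\<omega>. ?V (BB s \<omega>) * (\<eta> + c * sqrt \<epsilon>))"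
    proof (rule integral_abs_le)
      show "integrable M (\<lambda>\<omega>. ?V (BB s \<omega>) * (\<eta> + c * sqrt \<epsilon>))" using i by (rule integrable_mult_left)
      fix \<omega>
      show "\<bar>killing_weight \<kappa> s \<omega> * (a (t - s) - v (t - s) (BB s \<omega>))\<bar> \<le> ?V (BB s \<omega>) * (\<eta> + c * sqrt \<epsilon>)"
      proof (cases "\<epsilon> < \<bar>BB s \<omega>\<bar>")
        case True
        then show ?thesis using bumpD(5)[OF bt True] by (simp add: killing_weight_def)
      next
        case False
        have "\<bar>a (t - s) - v (t - s) (BB s \<omega>)\<bar> \<le> \<eta> + c * sqrt \<epsilon>"
          using \<eta>[of "t - s" "BB s \<omega>"] v[of "t - s" "BB s \<omega>"] s False unfolding a_def by auto
        then show ?thesis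
          unfolding abs_mult using killing_weight_nonneg killing_weight_le[of \<kappa>] \<kappa> \<eta>0 V_nonneg
          by (intro mult_mono) (auto simp del: BB_eq)
      qed
    qed
    also have "\<dots> = expectation (\<lambda>\<omega>. ?V (BB s \<omega>)) * (\<eta> + c * sqrt \<epsilon>)" by (rule integral_mult_left_zero)
    also have "\<dots> \<le> (1 / sqrt s) * (\<eta> + c * sqrt \<epsilon>)"
      using expectation_bump_le[OF bt, of s] s \<eta>0 by (intro mult_right_mono) auto
    finally show "\<bar>expectation (\<lambda>\<omega>. killing_weight \<kappa> s \<omega> * (a (t - s) - v (t - s) (BB s \<omega>)))\<bar> \<le> (\<eta> + c * sqrt \<epsilon>) * (1 / sqrt s)"
      by (simp add: mult.commute)
  qed
  also have "\<dots> = (\<eta> + c * sqrt \<epsilon>) * (2 * sqrt t)"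
    unfolding set_integral_mult_right inverse_sqrt_integral(2)[OF t] ..
  finally have I: "\<bar>\<kappa> * (LINT s:{0<..<t}|lborel. expectation (\<lambda>\<omega>. killing_weight \<kappa> s \<omega> * (a (t - s) - v (t - s) (BB s \<omega>))))\<bar>
      \<le> \<kappa> * ((\<eta> + c * sqrt \<epsilon>) * (2 * sqrt t))"
    using \<kappa> by (simp add: abs_mult)
  have "expectation (\<lambda>\<omega>. exp (- \<kappa> * occupation ?V t \<omega>) * h \<bar>B t \<omega>\<bar>) = v t x +
      \<kappa> * (LINT s:{0<..<t}|lborel. expectation (\<lambda>\<omega>. killing_weight \<kappa> s \<omega> * (a (t - s) - v (t - s) (BB s \<omega>))))"
    unfolding v_def by (rule feynman_kac_comparison[OF \<kappa> t m h_bound _ ab]) measurable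
  then show ?thesis using I v[OF t order_refl, of x] by linarith
qed

theorem expectation_exp_local_time:
  assumes "robin \<kappa> h C" and t: "t > 0"
  shows "expectation (\<lambda>\<omega>. exp (- \<kappa> * local_time B t \<omega>) * h \<bar>B t \<omega>\<bar>) = heat t (robin_ext \<kappa> h) \<bar>x\<bar>"
proof -
  interpret robin \<kappa> h C by fact
  let ?G = "robin_ext \<kappa> h"
  let ?E = "\<lambda>n. expectation (\<lambda>\<omega>. exp (- \<kappa> * occupation (tent_bump (eps_seq n)) t \<omega>) * h \<bar>B t \<omega>\<bar>)"
  have [measurable]: "B t \<in> borel_measurable M" "local_time B t \<in> borel_measurable M"
    using t by (auto intro: random_variable local_time_measurable)
  have [measurable]: "tent_bump (eps_seq n) \<in> borel_measurable borel" for n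
    by (rule bumpD(1)[OF bump_tent[OF eps_seq_pos]])
  have "?E \<longlonglongrightarrow> expectation (\<lambda>\<omega>. exp (- \<kappa> * local_time B t \<omega>) * h \<bar>B t \<omega>\<bar>)"
  proof (rule integral_dominated_convergence[where w = "\<lambda>_. C"])
    show "AE \<omega> in M. (\<lambda>n. exp (- \<kappa> * occupation (tent_bump (eps_seq n)) t \<omega>) * h \<bar>B t \<omega>\<bar>)
        \<longlonglongrightarrow> exp (- \<kappa> * local_time B t \<omega>) * h \<bar>B t \<omega>\<bar>"
      using AE_local_time[OF t] by eventually_elim (auto intro!: tendsto_intros)
    fix n
    have "0 \<le> occupation (tent_bump (eps_seq n)) t \<omega>" for \<omega>
      unfolding occupation_def set_lebesgue_integral_def
      using tent_bump_bounds(1)[OF eps_seq_pos] by (intro Bochner_Integration.integral_nonneg) auto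
    then have "exp (- \<kappa> * occupation (tent_bump (eps_seq n)) t \<omega>) \<le> 1" for \<omega>
      using \<kappa> by simp
    then have "\<bar>exp (- \<kappa> * occupation (tent_bump (eps_seq n)) t \<omega>) * h \<bar>B t \<omega>\<bar>\<bar> \<le> 1 * C" for \<omega>
      unfolding abs_mult using h_bound by (intro mult_mono) auto
    then show "AE \<omega> in M. norm (exp (- \<kappa> * occupation (tent_bump (eps_seq n)) t \<omega>) * h \<bar>B t \<omega>\<bar>) \<le> C"
      by simp
  qed measurable
  moreover have "?E \<longlonglongrightarrow> heat t ?G \<bar>x\<bar>"
  proof -
    define c where "c = \<kappa> * (3 * C * (4 * sqrt (sqrt t)))"
    \<comment> \<open>The oscillation near the boundary must be small uniformly in \<tau>, also as
      \<tau> tends to 0. This is where continuity of the heat semigroup up to the initial time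
      enters.\<close>
    have uc: "uniformly_continuous_on ({0..t} \<times> {0..1}) (\<lambda>(\<tau>, y). heat \<tau> ?G y)"
      by (intro compact_uniformly_continuous continuous_on_subset[OF heat_continuous[OF robin_ext_cont robin_ext_bound]]
          compact_Times) auto
    show ?thesis
    proof (rule LIMSEQ_I)
      fix r :: real assume r: "0 < r"
      define q where "q = \<kappa> * (2 * sqrt t) + 1"
      define \<eta> where "\<eta> = r / 2 / q"
      have q: "q > 0" unfolding q_def using \<kappa> t by (intro add_nonneg_pos) auto
      have \<eta>: "\<eta> > 0" using r q by (simp add: \<eta>_def)
      from uc \<eta> obtain d where d: "d > 0"
        "\<And>p p'. p \<in> {0..t} \<times> {0..1} \<Longrightarrow> p' \<in> {0..t} \<times> {0..1} \<Longrightarrow> dist p' p < d \<Longrightarrow>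
           dist ((\<lambda>(\<tau>, y). heat \<tau> ?G y) p') ((\<lambda>(\<tau>, y). heat \<tau> ?G y) p) < \<eta>"
        unfolding uniformly_continuous_on_def by metis
      have "(\<lambda>n. c * sqrt (eps_seq n) + \<kappa> * ((c * sqrt (eps_seq n)) * (2 * sqrt t))) \<longlonglongrightarrow> c * sqrt 0 + \<kappa> * ((c * sqrt 0) * (2 * sqrt t))"
        by (intro tendsto_intros eps_seq_lim)
      then have "\<forall>\<^sub>F n in sequentially. c * sqrt (eps_seq n) + \<kappa> * ((c * sqrt (eps_seq n)) * (2 * sqrt t)) < r / 2"
        by (rule order_tendstoD) (use r in simp)
      moreover have "\<forall>\<^sub>F n in sequentially. eps_seq n < min d 1"
        by (rule order_tendstoD[OF eps_seq_lim]) (use d in simp)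
      ultimately obtain N where N: "\<And>n. n \<ge> N \<Longrightarrow> c * sqrt (eps_seq n) + \<kappa> * ((c * sqrt (eps_seq n)) * (2 * sqrt t)) < r / 2"
          "\<And>n. n \<ge> N \<Longrightarrow> eps_seq n < min d 1"
        by (auto simp: eventually_sequentially) (metis nat_le_linear order_trans)
      have "norm (?E n - heat t ?G \<bar>x\<bar>) < r" if n: "n \<ge> N" for n
      proof -
        have "\<bar>?E n - heat t ?G \<bar>x\<bar>\<bar> \<le> c * sqrt (eps_seq n) + \<kappa> * ((\<eta> + c * sqrt (eps_seq n)) * (2 * sqrt t))"
          unfolding c_def
        proof (rule feynman_kac_error[OF assms eps_seq_pos])
          fix \<tau> y assume *: "0 < \<tau>" "\<tau> < t" "\<bar>y\<bar> \<le> eps_seq n"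
          have "dist (\<tau>, 0) (\<tau>, \<bar>y\<bar>) < d" using * N(2)[OF n] by (simp add: dist_Pair_Pair dist_real_def)
          then show "\<bar>heat \<tau> ?G 0 - heat \<tau> ?G \<bar>y\<bar>\<bar> \<le> \<eta>"
            using d(2)[of "(\<tau>, \<bar>y\<bar>)" "(\<tau>, 0)"] * N(2)[OF n] by (simp add: dist_real_def)
        qed
        also have "\<dots> = (c * sqrt (eps_seq n) + \<kappa> * ((c * sqrt (eps_seq n)) * (2 * sqrt t))) + \<eta> * (\<kappa> * (2 * sqrt t))"
          by (simp add: algebra_simps)
        also have "\<eta> * (\<kappa> * (2 * sqrt t)) \<le> \<eta> * q"
          unfolding q_def using \<eta> by (intro mult_left_mono) auto
        also have "\<dots> = r / 2" using q by (simp add: \<eta>_def)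
        finally show ?thesis using N(1)[OF n] by simp
      qed
      then show "\<exists>N. \<forall>n\<ge>N. norm (?E n - heat t ?G \<bar>x\<bar>) < r" by blast
    qed
  qed
  ultimately show ?thesis by (rule LIMSEQ_unique)
qed

end

section \<open>The semigroup of the snapping out Brownian motion\<close>

definition even_datum :: "(bool \<times> real \<Rightarrow> real) \<Rightarrow> real \<Rightarrow> real" where
  "even_datum f r = even_part f (True, \<bar>r\<bar>)"

text \<open>The odd part is stored through its values on the right half-line, as a function of
  \<bar>r\<bar>, and its sign is carried by \<open>half_sign\<close>. This keeps it continuous
  across 0, where the odd part itself may jump.\<close>

definition odd_datum :: "(bool \<times> real \<Rightarrow> real) \<Rightarrow> real \<Rightarrow> real" where
  "odd_datum f r = odd_part f (True, \<bar>r\<bar>)"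

definition half_sign :: "bool \<Rightarrow> real" where
  "half_sign s = (if s then 1 else - 1)"

lemma f_signed:
  assumes "0 \<le> r"
  shows "f (signed s r) = even_datum f r + half_sign s * odd_datum f r"
  using assms by (cases s)
    (simp_all add: signed_def even_datum_def odd_datum_def even_part_def odd_part_def reflect_def half_sign_def field_simps)

lemma half_sign_not: "half_sign (\<not> s) = - half_sign s"
  by (simp add: half_sign_def)

lemma GG_iff: "(s, u) \<in> GG \<longleftrightarrow> 0 \<le> half_sign s * u"
  by (auto simp: GG_def half_sign_def)

lemma GG_signed: "(s, u) \<in> GG \<Longrightarrow> signed s \<bar>u\<bar> = (s, u)"
  by (auto simp: GG_def signed_def)

lemma C0G_bounded:
  assumes "f \<in> C0G"
  shows "\<exists>C\<ge>0. \<forall>p\<in>GG. \<bar>f p\<bar> \<le> C"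
proof -
  from assms obtain C where "\<forall>y\<in>f ` GG. norm y \<le> C" by (auto simp: C0G_def bounded_iff)
  then have C: "\<bar>f p\<bar> \<le> C" if "p \<in> GG" for p using that by auto
  have "(True, 0) \<in> GG" by (simp add: GG_def)
  from order_trans[OF abs_ge_zero C[OF this]] C show ?thesis by blast
qed

lemma C0G_halves:
  assumes f: "f \<in> C0G"
  shows "continuous_on UNIV (\<lambda>r. f (True, \<bar>r\<bar>))" "continuous_on UNIV (\<lambda>r. f (False, - \<bar>r\<bar>))"
    "((\<lambda>r. f (True, \<bar>r\<bar>)) \<longlongrightarrow> 0) at_top" "((\<lambda>r. f (False, - \<bar>r\<bar>)) \<longlongrightarrow> 0) at_top"
proof -
  have c: "continuous_on GG f" using f by (simp add: C0G_def)
  show "continuous_on UNIV (\<lambda>r. f (True, \<bar>r\<bar>))" "continuous_on UNIV (\<lambda>r. f (False, - \<bar>r\<bar>))"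
    by (auto intro!: continuous_on_compose2[OF c] continuous_intros simp: GG_def)
  have ev: "\<forall>\<^sub>F r :: real in at_top. \<bar>r\<bar> = r"
    using eventually_ge_at_top[of 0] by eventually_elim simp
  have "((\<lambda>r. f (True, r)) \<longlongrightarrow> 0) at_top" using f by (simp add: C0G_def)
  then show "((\<lambda>r. f (True, \<bar>r\<bar>)) \<longlongrightarrow> 0) at_top"
    by (rule Lim_transform_eventually) (use ev in eventually_elim, simp)
  have "((\<lambda>r. f (False, - r)) \<longlongrightarrow> 0) at_top"
    using f by (intro filterlim_compose[of "\<lambda>r. f (False, r)", OF _ filterlim_uminus_at_bot_at_top]) (simp add: C0G_def)
  then show "((\<lambda>r. f (False, - \<bar>r\<bar>)) \<longlongrightarrow> 0) at_top"
    by (rule Lim_transform_eventually) (use ev in eventually_elim, simp)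
qed

lemma even_datum_alt: "even_datum f r = (f (True, \<bar>r\<bar>) + f (False, - \<bar>r\<bar>)) / 2"
  and odd_datum_alt: "odd_datum f r = (f (True, \<bar>r\<bar>) - f (False, - \<bar>r\<bar>)) / 2"
  by (simp_all add: even_datum_def odd_datum_def even_part_def odd_part_def reflect_def)

text \<open>Covers the initial time, which \<open>AE_local_time\<close> leaves out: the time
  interval is a null set.\<close>

lemma local_time_0: "local_time X 0 \<omega> = 0"
proof -
  have "(LINT s:{0..0::real}|lborel. g s) = 0" for g :: "real \<Rightarrow> real"
    unfolding set_lebesgue_integral_def
    by (rule integral_eq_zero_AE) (use AE_lborel_singleton[of 0] in eventually_elim, simp)
  then show ?thesis unfolding local_time_def by (simp add: tendsto_Lim)
qed

locale snob =
  fixes \<kappa> :: real and M :: "real \<Rightarrow> 'w measure" and B :: "real \<Rightarrow> real \<Rightarrow> 'w \<Rightarrow> real"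
    and f :: "bool \<times> real \<Rightarrow> real" and C :: real
  assumes \<kappa>: "\<kappa> > 0" and BM: "\<And>x. brownian_motion (M x) (B x) x" and f: "f \<in> C0G"
    and C: "0 \<le> C" "\<And>p. p \<in> GG \<Longrightarrow> \<bar>f p\<bar> \<le> C"
begin

abbreviation "e \<equiv> even_datum f"
abbreviation "d \<equiv> odd_datum f"
abbreviation "G \<equiv> robin_ext \<kappa> d"

lemma e_bound: "\<bar>e r\<bar> \<le> C" and d_bound: "\<bar>d r\<bar> \<le> C"
proof -
  have *: "\<bar>f (True, \<bar>r\<bar>)\<bar> \<le> C" "\<bar>f (False, - \<bar>r\<bar>)\<bar> \<le> C"
    by (auto intro!: C simp: GG_def)
  show "\<bar>e r\<bar> \<le> C" unfolding even_datum_alt using * by (auto simp: abs_le_iff)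
  show "\<bar>d r\<bar> \<le> C" unfolding odd_datum_alt using * by (auto simp: abs_le_iff)
qed

lemma e_cont: "continuous_on UNIV e" and d_cont: "continuous_on UNIV d"
  unfolding even_datum_alt[abs_def] odd_datum_alt[abs_def]
  using C0G_halves(1,2)[OF f] by (auto intro!: continuous_intros)

lemma e_lim: "(e \<longlongrightarrow> 0) at_top" and d_lim: "(d \<longlongrightarrow> 0) at_top"
  unfolding even_datum_alt[abs_def] odd_datum_alt[abs_def]
  by (auto intro!: tendsto_eq_intros C0G_halves(3,4)[OF f])

lemma e_measurable [measurable]: "e \<in> borel_measurable borel" and d_measurable [measurable]: "d \<in> borel_measurable borel"
  using e_cont d_cont by (auto intro: borel_measurable_continuous_onI)

lemma e_minus: "e (- r) = e r" and e_abs [simp]: "e \<bar>r\<bar> = e r" and d_abs [simp]: "d \<bar>r\<bar> = d r"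
  by (simp_all add: even_datum_def odd_datum_def)

sublocale robin \<kappa> d C
  by unfold_locales (use \<kappa> d_cont d_bound d_lim in auto)

text \<open>The two weights have sum 1 and difference exp (- \<kappa> * L). The even part takes the
  same value at both image points and loses the weight; the odd part changes sign and keeps the
  whole exponential.\<close>

lemma semigroup_eq:
  assumes t: "0 \<le> t"
  shows "snob_semigroup \<kappa> M B t f (s, u) = heat t e u + half_sign s * heat t G \<bar>u\<bar>"
proof -
  interpret B: brownian_motion "M u" "B u" u by (rule BM)
  note B.random_variable[OF t, measurable] B.local_time_measurable[OF t, measurable]
  let ?E = "\<lambda>\<omega>. exp (- \<kappa> * local_time (B u) t \<omega>)"
  have meas: "(\<lambda>\<omega>. f (signed s' \<bar>B u t \<omega>\<bar>)) \<in> borel_measurable (M u)" for s'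
    by (simp add: f_signed)
  have local: "AE \<omega> in M u. 0 \<le> local_time (B u) t \<omega>"
  proof (cases "t = 0")
    case True
    then show ?thesis by (simp add: local_time_0)
  next
    case False
    then show ?thesis using B.AE_local_time[of t] t by auto
  qed
  \<comment> \<open>The values c = 1 and c = - 1 give the two weights of the semigroup.\<close>
  have int: "integrable (M u) (\<lambda>\<omega>. (1 + c * ?E \<omega>) / 2 * f (signed s' \<bar>B u t \<omega>\<bar>))" if "\<bar>c\<bar> = 1" for s' c
  proof (rule B.integrable_const_bound[where B = C])
    show "AE \<omega> in M u. norm ((1 + c * ?E \<omega>) / 2 * f (signed s' \<bar>B u t \<omega>\<bar>)) \<le> C"
      using local
    proof eventually_elim
      fix \<omega> assume "0 \<le> local_time (B u) t \<omega>"
      then have "?E \<omega> \<le> 1" using \<kappa> by simp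
      then have "\<bar>(1 + c * ?E \<omega>) / 2\<bar> \<le> 1" using that exp_gt_zero[of "- \<kappa> * local_time (B u) t \<omega>"]
        by (cases "c \<ge> 0") (auto simp: abs_le_iff simp del: exp_gt_zero)
      moreover have "\<bar>f (signed s' \<bar>B u t \<omega>\<bar>)\<bar> \<le> C"
        by (intro C) (auto simp: signed_def GG_def)
      ultimately have "\<bar>(1 + c * ?E \<omega>) / 2\<bar> * \<bar>f (signed s' \<bar>B u t \<omega>\<bar>)\<bar> \<le> 1 * C"
        by (intro mult_mono) auto
      then show "norm ((1 + c * ?E \<omega>) / 2 * f (signed s' \<bar>B u t \<omega>\<bar>)) \<le> C" by (simp only: real_norm_def abs_mult mult_1)
    qed
    show "(\<lambda>\<omega>. (1 + c * ?E \<omega>) / 2 * f (signed s' \<bar>B u t \<omega>\<bar>)) \<in> borel_measurable (M u)"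
      using meas[of s'] by measurable
  qed
  have "snob_semigroup \<kappa> M B t f (s, u) = B.expectation (\<lambda>\<omega>. (1 + ?E \<omega>) / 2 * f (signed s \<bar>B u t \<omega>\<bar>) + (1 - ?E \<omega>) / 2 * f (signed (\<not> s) \<bar>B u t \<omega>\<bar>))"
    using int[of 1 s] int[of "- 1" "\<not> s"] by (simp add: snob_semigroup_def)
  also have "\<dots> = B.expectation (\<lambda>\<omega>. e (B u t \<omega>) + half_sign s * (?E \<omega> * d \<bar>B u t \<omega>\<bar>))"
    by (intro Bochner_Integration.integral_cong refl) (simp add: f_signed half_sign_not field_simps)
  also have "\<dots> = heat t e u + half_sign s * heat t G \<bar>u\<bar>"
  proof (cases "t = 0")
    case True
    have "B.expectation (\<lambda>\<omega>. e (B u t \<omega>) + half_sign s * (?E \<omega> * d \<bar>B u t \<omega>\<bar>)) = B.expectation (\<lambda>\<omega>. e u + half_sign s * d u)"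
    proof (rule integral_cong_AE)
      show "AE \<omega> in M u. e (B u t \<omega>) + half_sign s * (?E \<omega> * d \<bar>B u t \<omega>\<bar>) = e u + half_sign s * d u"
        using B.start by eventually_elim (simp add: True local_time_0)
    qed measurable
    then show ?thesis using True by (simp add: B.prob_space)
  next
    case False
    then have t: "0 < t" using t by simp
    have 1: "integrable (M u) (\<lambda>\<omega>. e (B u t \<omega>))"
      using e_bound by (intro B.integrable_const_bound[where B = C]) auto
    have 2: "integrable (M u) (\<lambda>\<omega>. ?E \<omega> * d \<bar>B u t \<omega>\<bar>)"
    proof (rule B.integrable_const_bound[where B = C])
      show "AE \<omega> in M u. norm (?E \<omega> * d \<bar>B u t \<omega>\<bar>) \<le> C"
        using local
      proof eventually_elim
        fix \<omega> assume "0 \<le> local_time (B u) t \<omega>"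
        then have "\<bar>?E \<omega>\<bar> * \<bar>d \<bar>B u t \<omega>\<bar>\<bar> \<le> 1 * C" using \<kappa> d_bound by (intro mult_mono) auto
        then show "norm (?E \<omega> * d \<bar>B u t \<omega>\<bar>) \<le> C" by (simp only: real_norm_def abs_mult mult_1)
      qed
    qed measurable
    have "B.expectation (\<lambda>\<omega>. ?E \<omega> * d \<bar>B u t \<omega>\<bar>) = heat t G \<bar>u\<bar>"
      by (rule B.expectation_exp_local_time[OF _ t]) (rule robin_axioms)
    then show ?thesis
      using 1 2 B.expectation_heat[OF t e_measurable] by simp
  qed
  finally show ?thesis .
qed

lemma heat_e_minus: "heat t e (- u) = heat t e u"
  by (rule heat_even) (rule e_minus)

lemma half_sign_continuous: "continuous_on A (\<lambda>p. half_sign (g p))" if "continuous_on A g" for g :: "'a::topological_space \<Rightarrow> bool"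
  by (rule continuous_on_compose2[of UNIV half_sign]) (auto intro: continuous_on_discrete that)

lemma heat_e_continuous: "continuous_on UNIV (\<lambda>(t, x). heat t e x)"
  and heat_G_continuous: "continuous_on UNIV (\<lambda>(t, x). heat t G x)"
  by (rule heat_continuous[OF e_cont e_bound], rule heat_continuous[OF robin_ext_cont robin_ext_bound])

lemma semigroup_continuous: "continuous_on ({0..} \<times> GG) (\<lambda>(t, p). snob_semigroup \<kappa> M B t f p)"
proof -
  have "continuous_on ({0..} \<times> GG) (\<lambda>q. heat (fst q) e (snd (snd q)) + half_sign (fst (snd q)) * heat (fst q) G \<bar>snd (snd q)\<bar>)"
  proof (intro continuous_on_add continuous_on_mult half_sign_continuous)
    have "continuous_on ({0..} \<times> GG) (\<lambda>q. (fst q, snd (snd q)))" "continuous_on ({0..} \<times> GG) (\<lambda>q. (fst q, \<bar>snd (snd q)\<bar>))"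
      by (intro continuous_intros)+
    from continuous_on_compose2[OF heat_e_continuous this(1)] continuous_on_compose2[OF heat_G_continuous this(2)]
    show "continuous_on ({0..} \<times> GG) (\<lambda>q. heat (fst q) e (snd (snd q)))"
      "continuous_on ({0..} \<times> GG) (\<lambda>q. heat (fst q) G \<bar>snd (snd q)\<bar>)"
      by simp_all
  qed (intro continuous_intros)
  then show ?thesis
    by (rule continuous_on_eq) (auto simp: semigroup_eq)
qed

text \<open>C comes from the even part and 3 * C from \<open>robin_ext_bound\<close>.\<close>

lemma semigroup_bound: "0 \<le> t \<Longrightarrow> \<bar>snob_semigroup \<kappa> M B t f p\<bar> \<le> 4 * C"
  using heat_bound[OF e_measurable e_bound, of t "snd p"] heat_bound[OF robin_ext_measurable robin_ext_bound, of t "\<bar>snd p\<bar>"]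
  by (cases p) (auto simp: semigroup_eq half_sign_def abs_if split: if_splits)

lemma semigroup_C0G:
  assumes t: "0 \<le> t"
  shows "snob_semigroup \<kappa> M B t f \<in> C0G"
  unfolding C0G_def
proof (intro CollectI conjI)
  show "continuous_on GG (snob_semigroup \<kappa> M B t f)"
  proof -
    have "continuous_on GG (\<lambda>p. (t, p))" by (intro continuous_intros)
    from continuous_on_compose2[OF semigroup_continuous this] show ?thesis using t by auto
  qed
  show "bounded (snob_semigroup \<kappa> M B t f ` GG)"
    unfolding bounded_iff using semigroup_bound[OF t] by (intro exI[of _ "4 * C"]) auto
  have e: "(heat t e \<longlongrightarrow> 0) at_top" by (rule heat_tendsto_0[OF e_cont e_bound e_lim])
  have G: "(heat t G \<longlongrightarrow> 0) at_top" by (rule heat_tendsto_0[OF robin_ext_cont robin_ext_bound robin_ext_lim])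
  have "((\<lambda>u. heat t e u + heat t G u) \<longlongrightarrow> 0 + 0) at_top" by (intro tendsto_intros e G)
  moreover have "\<forall>\<^sub>F u in at_top. heat t e u + heat t G u = snob_semigroup \<kappa> M B t f (True, u)"
    using eventually_ge_at_top[of 0] by eventually_elim (simp add: semigroup_eq[OF t] half_sign_def)
  ultimately show "((\<lambda>u. snob_semigroup \<kappa> M B t f (True, u)) \<longlongrightarrow> 0) at_top"
    using Lim_transform_eventually by fastforce
  have "((\<lambda>u. heat t e (- u) - heat t G (- u)) \<longlongrightarrow> 0 - 0) at_bot"
    by (intro tendsto_diff filterlim_compose[OF e] filterlim_compose[OF G] filterlim_uminus_at_top_at_bot)
  moreover have "\<forall>\<^sub>F u in at_bot. heat t e (- u) - heat t G (- u) = snob_semigroup \<kappa> M B t f (False, u)"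
    using eventually_le_at_bot[of 0] by eventually_elim (simp add: semigroup_eq[OF t] half_sign_def heat_e_minus)
  ultimately show "((\<lambda>u. snob_semigroup \<kappa> M B t f (False, u)) \<longlongrightarrow> 0) at_bot"
    using Lim_transform_eventually by fastforce
qed

section \<open>The heat equation and the transmission condition\<close>

definition Dx :: "real \<Rightarrow> (real \<Rightarrow> real) \<Rightarrow> real \<Rightarrow> real" where
  "Dx t F x = - heat_moment t F 1 x / (t * sqrt (2 * pi * t))"

definition Dxx :: "real \<Rightarrow> (real \<Rightarrow> real) \<Rightarrow> real \<Rightarrow> real" where
  "Dxx t F x = (heat_moment t F 2 x / t - heat_moment t F 0 x) / (t * sqrt (2 * pi * t))"

lemmas e_Dx = DERIV_heat_x[OF e_measurable e_bound, folded Dx_def]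
  and e_Dxx = DERIV_heat_xx[OF e_measurable e_bound, folded Dx_def Dxx_def]
  and e_Dt = DERIV_heat_t[OF e_measurable e_bound, folded Dxx_def]
  and G_Dx = DERIV_heat_x[OF robin_ext_measurable robin_ext_bound, folded Dx_def]
  and G_Dxx = DERIV_heat_xx[OF robin_ext_measurable robin_ext_bound, folded Dx_def Dxx_def]
  and G_Dt = DERIV_heat_t[OF robin_ext_measurable robin_ext_bound, folded Dxx_def]

lemma half_sign_sq [simp]: "half_sign s * half_sign s = 1" "half_sign s * (half_sign s * z) = z"
  by (simp_all add: half_sign_def)

text \<open>Removing the absolute value extends each branch smoothly across 0, so that the one-sided
  derivatives at the boundary are restrictions of two-sided ones.\<close>

lemma semigroup_GG:
  assumes "0 \<le> t" "(s, u) \<in> GG"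
  shows "snob_semigroup \<kappa> M B t f (s, u) = heat t e u + half_sign s * heat t G (half_sign s * u)"
  using assms by (auto simp: semigroup_eq GG_def half_sign_def)

lemma semigroup_half_Dx:
  assumes t: "0 < t"
  shows "((\<lambda>v. heat t e v + half_sign s * heat t G (half_sign s * v)) has_real_derivative Dx t e v + Dx t G (half_sign s * v)) (at v)"
proof -
  have "((\<lambda>v. heat t G (half_sign s * v)) has_real_derivative Dx t G (half_sign s * v) * half_sign s) (at v)"
    by (rule DERIV_chain2[where g = "\<lambda>v. half_sign s * v", OF G_Dx[OF t] DERIV_cmult_Id])
  from DERIV_add[OF e_Dx[OF t] DERIV_cmult[OF this, of "half_sign s"]]
  show ?thesis by (simp add: mult.commute[of "Dx t G _"])
qed

lemma semigroup_half_Dxx: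
  assumes t: "0 < t"
  shows "((\<lambda>v. Dx t e v + Dx t G (half_sign s * v)) has_real_derivative Dxx t e v + half_sign s * Dxx t G (half_sign s * v)) (at v)"
proof -
  have "((\<lambda>v. Dx t G (half_sign s * v)) has_real_derivative Dxx t G (half_sign s * v) * half_sign s) (at v)"
    by (rule DERIV_chain2[where g = "\<lambda>v. half_sign s * v", OF G_Dxx[OF t] DERIV_cmult_Id])
  from DERIV_add[OF e_Dxx[OF t] this]
  show ?thesis by (simp add: mult.commute[of "Dxx t G _"])
qed

end

text \<open>The explicit expression is valid on one branch only; openness of S carries the equality
  over to \<open>deriv \<phi>\<close> near u and so to the second derivative.\<close>

lemma deriv_deriv_local:
  fixes \<phi> \<psi> \<psi>' :: "real \<Rightarrow> real"
  assumes S: "open S" "u \<in> S" and eq: "\<And>v. v \<in> S \<Longrightarrow> \<phi> v = \<psi> v"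
    and 1: "\<And>v. v \<in> S \<Longrightarrow> (\<psi> has_real_derivative \<psi>' v) (at v)"
    and 2: "(\<psi>' has_real_derivative d2) (at u)"
  shows "\<phi> differentiable (at u)" "(deriv \<phi> has_real_derivative d2) (at u)"
proof -
  have d: "(\<phi> has_real_derivative \<psi>' v) (at v)" if "v \<in> S" for v
    using has_field_derivative_transform_within_open[OF 1[OF that] S(1) that] eq by simp
  show "\<phi> differentiable (at u)" using d[OF S(2)] by (auto simp: real_differentiable_def)
  show "(deriv \<phi> has_real_derivative d2) (at u)"
    by (rule has_field_derivative_transform_within_open[OF 2 S]) (simp add: DERIV_imp_deriv[OF d])
qed

context snob
begin

lemma semigroup_solution: "snob_solution \<kappa> f (\<lambda>t. snob_semigroup \<kappa> M B t f)"
  unfolding snob_solution_def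
proof (intro conjI allI impI ballI)
  show "continuous_on ({0..} \<times> GG) (\<lambda>(t, p). snob_semigroup \<kappa> M B t f p)"
    by (rule semigroup_continuous)
  show "bounded ((\<lambda>(t, p). snob_semigroup \<kappa> M B t f p) ` ({0..T} \<times> GG))" for T
    unfolding bounded_iff using semigroup_bound by (intro exI[of _ "4 * C"]) auto
next
  fix t :: real and s u assume t: "0 < t" and su: "(s, u) \<in> GG \<and> u \<noteq> 0"
  let ?S = "{v. 0 < half_sign s * v}"
  have u: "u \<in> ?S" using su by (auto simp: GG_iff half_sign_def split: if_splits)
  have S: "open ?S" by (intro open_Collect_less continuous_intros)
  have eq: "snob_semigroup \<kappa> M B t f (s, v) = heat t e v + half_sign s * heat t G (half_sign s * v)" if "v \<in> ?S" for v
    using that t by (intro semigroup_GG) (auto simp: GG_iff)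
  note D = deriv_deriv_local[where \<phi> = "\<lambda>v. snob_semigroup \<kappa> M B t f (s, v)", OF S u eq semigroup_half_Dx[OF t] semigroup_half_Dxx[OF t]]
  show "(\<lambda>v. snob_semigroup \<kappa> M B t f (s, v)) differentiable at u" by (rule D(1))
  show "deriv (\<lambda>v. snob_semigroup \<kappa> M B t f (s, v)) differentiable at u"
    using D(2) by (auto simp: real_differentiable_def)
  have "((\<lambda>r. heat r e u + half_sign s * heat r G (half_sign s * u)) has_real_derivative
      1 / 2 * (Dxx t e u + half_sign s * Dxx t G (half_sign s * u))) (at t)"
    by (auto intro!: derivative_eq_intros e_Dt[OF t] G_Dt[OF t] simp: field_simps)
  then have "((\<lambda>r. snob_semigroup \<kappa> M B r f (s, u)) has_real_derivative
      1 / 2 * (Dxx t e u + half_sign s * Dxx t G (half_sign s * u))) (at t)"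
    by (rule has_field_derivative_transform_within_open[where S = "{0<..}"]) (use t su in \<open>auto simp: semigroup_GG\<close>)
  then show "((\<lambda>r. snob_semigroup \<kappa> M B r f (s, u)) has_real_derivative
      1 / 2 * deriv (deriv (\<lambda>v. snob_semigroup \<kappa> M B t f (s, v))) u) (at t)"
    by (simp only: DERIV_imp_deriv[OF D(2)])
next
  fix t :: real assume t: "0 < t"
  \<comment> \<open>The even part stays even, so its slope at 0 vanishes and only the Robin part
    contributes to the flux.\<close>
  have e0: "Dx t e 0 = 0"
  proof -
    have "((\<lambda>v. heat t e (- v)) has_real_derivative - Dx t e 0) (at 0)"
      using DERIV_chain2[where g = uminus and x = "0 :: real" and s = UNIV and Db = "- 1", OF e_Dx[OF t]]
      by (simp add: DERIV_minus)
    then have "(heat t e has_real_derivative - Dx t e 0) (at 0)" by (simp only: heat_e_minus)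
    from DERIV_unique[OF this e_Dx[OF t]] show ?thesis by simp
  qed
  have G0: "Dx t G 0 = \<kappa> * heat t G 0"
    by (rule DERIV_unique[OF G_Dx[OF t] robin_boundary[OF t]])
  have "((\<lambda>v. heat t e v + half_sign s * heat t G (half_sign s * v)) has_real_derivative \<kappa> * heat t G 0) (at 0)" for s
    using semigroup_half_Dx[OF t, of s 0] by (simp add: e0 G0)
  then have *: "((\<lambda>v. snob_semigroup \<kappa> M B t f (s, v)) has_real_derivative \<kappa> * heat t G 0) (at 0 within {v. 0 \<le> half_sign s * v})" for s
    by (rule has_field_derivative_transform_within[OF has_field_derivative_at_within, where d = 1])
       (use t in \<open>auto simp: semigroup_GG GG_iff\<close>)
  \<comment> \<open>In the jump the even part cancels and the odd part counts twice, which turns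
    \<kappa> / 2 into the Robin coefficient \<kappa>.\<close>
  have k: "\<kappa> / 2 * (snob_semigroup \<kappa> M B t f (True, 0) - snob_semigroup \<kappa> M B t f (False, 0)) = \<kappa> * heat t G 0"
    using t by (simp add: semigroup_eq half_sign_def)
  show "((\<lambda>v. snob_semigroup \<kappa> M B t f (True, v)) has_real_derivative
      \<kappa> / 2 * (snob_semigroup \<kappa> M B t f (True, 0) - snob_semigroup \<kappa> M B t f (False, 0))) (at_right 0)"
    unfolding k by (rule DERIV_subset[OF *]) (auto simp: half_sign_def)
  show "((\<lambda>v. snob_semigroup \<kappa> M B t f (False, v)) has_real_derivative
      \<kappa> / 2 * (snob_semigroup \<kappa> M B t f (True, 0) - snob_semigroup \<kappa> M B t f (False, 0))) (at_left 0)"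
    unfolding k by (rule DERIV_subset[OF *]) (auto simp: half_sign_def)
next
  fix p assume p: "p \<in> GG"
  obtain s u where su: "p = (s, u)" by (cases p)
  have "snob_semigroup \<kappa> M B 0 f p = f (signed s \<bar>u\<bar>)"
    unfolding su by (simp add: semigroup_eq f_signed)
  then show "snob_semigroup \<kappa> M B 0 f p = f p"
    using GG_signed p su by simp
qed

section \<open>The explicit formulas\<close>

lemma e_of_nonzero: "y \<noteq> 0 \<Longrightarrow> e y = even_part f (of_nonzero y)"
  by (cases "0 < y")
     (auto simp: even_datum_alt of_nonzero_def even_part_def reflect_def abs_if add.commute)

lemma heat_e_eq:
  assumes t: "0 < t"
  shows "heat t e u = 1 / sqrt (2 * pi * t) * (LINT y|lborel. exp (- (u - y)\<^sup>2 / (2 * t)) * even_part f (of_nonzero y))"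
proof -
  have "heat t e u = (\<integral>y. 1 / sqrt (2 * pi * t) * (exp (- (u - y)\<^sup>2 / (2 * t)) * e y) \<partial>lborel)"
    unfolding heat_eq_gauss[OF t] gauss_def by (simp add: mult_ac)
  also have "\<dots> = 1 / sqrt (2 * pi * t) * (\<integral>y. exp (- (u - y)\<^sup>2 / (2 * t)) * e y \<partial>lborel)"
    by (rule integral_mult_right_zero)
  also have "(\<integral>y. exp (- (u - y)\<^sup>2 / (2 * t)) * e y \<partial>lborel) =
      (\<integral>y. exp (- (u - y)\<^sup>2 / (2 * t)) * even_part f (of_nonzero y) \<partial>lborel)"
  proof -
    \<comment> \<open>A correction by a multiple of the indicator of {0} gives measurability
      whatever the convention at 0.\<close>
    have "(\<lambda>y. even_part f (of_nonzero y)) = (\<lambda>y. e y + indicator {0} y * (even_part f (of_nonzero 0) - e 0))"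
    proof
      fix y show "even_part f (of_nonzero y) = e y + indicator {0} y * (even_part f (of_nonzero 0) - e 0)"
        using e_of_nonzero[of y] by (auto split: split_indicator)
    qed
    also have "\<dots> \<in> borel_measurable lborel" by measurable
    finally have m: "(\<lambda>y. even_part f (of_nonzero y)) \<in> borel_measurable lborel" .
    have "AE y in lborel. exp (- (u - y)\<^sup>2 / (2 * t)) * e y = exp (- (u - y)\<^sup>2 / (2 * t)) * even_part f (of_nonzero y)"
      using AE_lborel_singleton[of 0] by eventually_elim (simp add: e_of_nonzero)
    then show ?thesis using m by (intro integral_cong_AE) auto
  qed
  finally show ?thesis .
qed

lemma heat_G_eq:
  assumes t: "0 < t"
  shows "heat t G u = 1 / sqrt (2 * pi * t) * (exp (\<kappa> * u) * (LINT z:{u..}|lborel. exp (- \<kappa> * z) *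
            (LINT y:{0..}|lborel.
               ((z - y + \<kappa> * t) / t * exp (- (z - y)\<^sup>2 / (2 * t)) +
                (z + y - \<kappa> * t) / t * exp (- (z + y)\<^sup>2 / (2 * t)))
               * odd_part f (of_nonzero y))))"
proof -
  let ?c = "1 / sqrt (2 * pi * t)"
  let ?Q = "\<lambda>z y. ((z - y + \<kappa> * t) / t * exp (- (z - y)\<^sup>2 / (2 * t)) +
                (z + y - \<kappa> * t) / t * exp (- (z + y)\<^sup>2 / (2 * t)))"
  have alg: "(a1 * (E1 / c) + a2 * (E2 / c)) * b = 1 / c * ((a1 * E1 + a2 * E2) * b)" for a1 a2 b c E1 E2 :: real
    by (simp add: algebra_simps add_divide_distrib)
  have inner: "(LINT y:{0..}|lborel. ((z - y + \<kappa> * t) / t * gauss t (z - y) + (z + y - \<kappa> * t) / t * gauss t (z + y)) * d y)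
      = ?c * (LINT y:{0..}|lborel. ?Q z y * odd_part f (of_nonzero y))" for z
  proof -
    have "(LINT y:{0..}|lborel. ((z - y + \<kappa> * t) / t * gauss t (z - y) + (z + y - \<kappa> * t) / t * gauss t (z + y)) * d y)
       = (LINT y:{0<..}|lborel. ?c * (?Q z y * odd_part f (of_nonzero y)))"
      unfolding set_integral_Ici_eq_Ioi
    proof (intro set_lebesgue_integral_cong allI impI)
      fix y :: real assume y: "y \<in> {0<..}"
      then have "d y = odd_part f (of_nonzero y)" by (simp add: odd_datum_def of_nonzero_def)
      then show "((z - y + \<kappa> * t) / t * gauss t (z - y) + (z + y - \<kappa> * t) / t * gauss t (z + y)) * d y =
          ?c * (?Q z y * odd_part f (of_nonzero y))"
        unfolding gauss_def by (simp only: alg)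
    qed simp
    also have "\<dots> = ?c * (LINT y:{0<..}|lborel. ?Q z y * odd_part f (of_nonzero y))"
      by (rule set_integral_mult_right)
    finally show ?thesis unfolding set_integral_Ici_eq_Ioi .
  qed
  have "heat t G u = exp (\<kappa> * u) * (LINT z:{u..}|lborel. ?c * (exp (- \<kappa> * z) * (LINT y:{0..}|lborel. ?Q z y * odd_part f (of_nonzero y))))"
    unfolding robin_formula[OF t] inner by (simp only: mult.left_commute)
  also have "\<dots> = ?c * (exp (\<kappa> * u) * (LINT z:{u..}|lborel. exp (- \<kappa> * z) * (LINT y:{0..}|lborel. ?Q z y * odd_part f (of_nonzero y))))"
    unfolding set_integral_mult_right by (rule mult.left_commute)
  finally show ?thesis .
qed

end

section \<open>Uniqueness of the solution\<close>

text \<open>The first derivative vanishes at the maximum; a positive second derivative would make it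
  positive just to the right, and \<phi> would increase there.\<close>

lemma DERIV2_local_max:
  fixes \<phi> \<phi>' :: "real \<Rightarrow> real"
  assumes r: "0 < r" and 1: "\<And>v. \<bar>v - u\<bar> < r \<Longrightarrow> (\<phi> has_real_derivative \<phi>' v) (at v)"
    and 2: "(\<phi>' has_real_derivative d2) (at u)" and max: "\<And>v. \<bar>v - u\<bar> < r \<Longrightarrow> \<phi> v \<le> \<phi> u"
  shows "d2 \<le> 0"
proof (rule ccontr)
  assume "\<not> d2 \<le> 0"
  then obtain \<delta> where \<delta>: "\<delta> > 0" "\<And>k. 0 < k \<Longrightarrow> k < \<delta> \<Longrightarrow> \<phi>' u < \<phi>' (u + k)"
    using DERIV_pos_inc_right[OF 2] by force
  have u0: "\<phi>' u = 0"
    using max by (intro DERIV_local_max[OF 1 r]) (auto simp: r abs_minus_commute)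
  define k where "k = min \<delta> r / 2"
  have k: "0 < k" "k < \<delta>" "k < r" using \<delta> r by (auto simp: k_def)
  obtain z where z: "u < z" "z < u + k" "\<phi> (u + k) - \<phi> u = (u + k - u) * \<phi>' z"
    using MVT2[of u "u + k" \<phi> \<phi>'] k 1 by (auto simp: abs_less_iff)
  have "0 < \<phi>' z" using \<delta>(2)[of "z - u"] z k u0 by simp
  then have "\<phi> u < \<phi> (u + k)" using z k by (simp add: algebra_simps)
  then show False using max[of "u + k"] k by simp
qed

text \<open>Maximum principle with the barrier \<open>(\<bar>u\<bar> - 1)\<^sup>2 + 2 * t\<close>: it is a strict supersolution, it is
  coercive, and its slope at \<open>0\<^sup>\<plusminus>\<close> excludes a maximum of the difference there.\<close>

lemma snob_solution_comparison:
  assumes \<rho>1: "snob_solution \<kappa> f \<rho>1" and \<rho>2: "snob_solution \<kappa> f \<rho>2" and \<kappa>: "\<kappa> > 0"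
    and T: "0 \<le> T" and p0: "p0 \<in> GG"
  shows "\<rho>1 T p0 \<le> \<rho>2 T p0"
proof (rule ccontr)
  assume neg: "\<not> \<rho>1 T p0 \<le> \<rho>2 T p0"
  define w where "w t p = \<rho>1 t p - \<rho>2 t p" for t p
  have pos: "0 < w T p0" using neg by (simp add: w_def)
  have w0: "w 0 p = 0" if "p \<in> GG" for p
    using \<rho>1 \<rho>2 that by (simp add: w_def snob_solution_def)
  have wc: "continuous_on ({0..} \<times> GG) (\<lambda>(t, p). w t p)"
    using \<rho>1 \<rho>2 unfolding snob_solution_def w_def case_prod_beta by (intro continuous_on_diff) auto
  obtain C where C: "\<And>t p. 0 \<le> t \<Longrightarrow> t \<le> T \<Longrightarrow> p \<in> GG \<Longrightarrow> w t p \<le> C"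
  proof -
    have "bounded ((\<lambda>(t, p). \<rho>1 t p) ` ({0..T} \<times> GG))" "bounded ((\<lambda>(t, p). \<rho>2 t p) ` ({0..T} \<times> GG))"
      using \<rho>1 \<rho>2 T by (auto simp: snob_solution_def)
    then obtain C1 C2 where "\<forall>q\<in>{0..T} \<times> GG. \<bar>(\<lambda>(t, p). \<rho>1 t p) q\<bar> \<le> C1" "\<forall>q\<in>{0..T} \<times> GG. \<bar>(\<lambda>(t, p). \<rho>2 t p) q\<bar> \<le> C2"
      unfolding bounded_iff by auto
    then have "w t p \<le> C1 + C2" if "0 \<le> t" "t \<le> T" "p \<in> GG" for t p
      using that unfolding w_def by (force dest!: bspec[of _ _ "(t, p)"])
    then show thesis by (rule that)
  qed
  define b where "b t p = (\<bar>snd p\<bar> - 1)\<^sup>2 + 2 * t" for t :: real and p :: "bool \<times> real"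
  have b_nonneg: "0 \<le> b t p" if "0 \<le> t" for t p using that by (simp add: b_def)
  \<comment> \<open>The barrier term then takes at most half of w T p0, so g stays positive at (T,
    p0). The summand 1 matters when b T p0 is 0.\<close>
  define \<eta> where "\<eta> = w T p0 / (2 * (b T p0 + 1))"
  have \<eta>: "0 < \<eta>" using pos b_nonneg[OF T, of p0] by (simp add: \<eta>_def)
  have \<eta>b: "\<eta> * b T p0 < w T p0"
  proof -
    have "\<eta> * b T p0 \<le> \<eta> * (b T p0 + 1)" using \<eta> by (intro mult_left_mono) auto
    also have "\<dots> = w T p0 / 2" using b_nonneg[OF T, of p0] by (simp add: \<eta>_def field_simps)
    also have "\<dots> < w T p0" using pos by simp
    finally show ?thesis .
  qed
  define g where "g t p = w t p - \<eta> * b t p" for t p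
  \<comment> \<open>Beyond R the barrier exceeds the bound C of w, so a positive maximum over the
    compact part is one over all of \<open>GG\<close>; R is also large enough to include p0.\<close>
  define R where "R = max \<bar>snd p0\<bar> (1 + sqrt (\<bar>C\<bar> / \<eta>))"
  have R: "g t p \<le> 0" if "0 \<le> t" "t \<le> T" "p \<in> GG" "R \<le> \<bar>snd p\<bar>" for t p
  proof -
    have "sqrt (\<bar>C\<bar> / \<eta>) \<le> \<bar>snd p\<bar> - 1" using that by (simp add: R_def)
    then have "(sqrt (\<bar>C\<bar> / \<eta>))\<^sup>2 \<le> (\<bar>snd p\<bar> - 1)\<^sup>2" using \<eta> by (intro power_mono) auto
    then have "\<bar>C\<bar> / \<eta> \<le> b t p" using \<eta> that by (simp add: b_def)
    then have "\<bar>C\<bar> \<le> \<eta> * b t p" using \<eta> by (simp add: field_simps)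
    then show ?thesis using C[OF that(1-3)] by (simp add: g_def)
  qed
  define Q where "Q = {True} \<times> {0..R} \<union> {False} \<times> {-R..0}"
  have Q: "compact Q" "Q \<subseteq> GG" "p0 \<in> Q"
    using p0 unfolding Q_def by (auto simp: GG_def R_def intro!: compact_Un compact_Times)
  have gc: "continuous_on ({0..T} \<times> Q) (\<lambda>q. g (fst q) (snd q))"
    unfolding g_def b_def using wc Q(2)
    by (intro continuous_intros) (auto simp: case_prod_beta intro: continuous_on_subset)
  have "compact ({0..T} \<times> Q)" "{0..T} \<times> Q \<noteq> {}" using Q T by (auto intro: compact_Times)
  from continuous_attains_sup[OF this gc] obtain ts ps where
    tps: "0 \<le> ts" "ts \<le> T" "ps \<in> Q" and supQ: "\<And>t p. 0 \<le> t \<Longrightarrow> t \<le> T \<Longrightarrow> p \<in> Q \<Longrightarrow> g t p \<le> g ts ps"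
    by fastforce
  have gpos: "0 < g ts ps" using supQ[OF T order_refl Q(3)] \<eta>b by (simp add: g_def)
  have sup: "g t p \<le> g ts ps" if "0 \<le> t" "t \<le> T" "p \<in> GG" for t p
  proof (cases "R \<le> \<bar>snd p\<bar>")
    case True
    then show ?thesis using R[OF that True] gpos by simp
  next
    case False
    then have "p \<in> Q" using that(3) by (auto simp: Q_def GG_def)
    then show ?thesis using supQ that by simp
  qed
  have psG: "ps \<in> GG" using tps Q by auto
  have ts: "0 < ts"
  proof (rule ccontr)
    assume "\<not> 0 < ts"
    then have "ts = 0" using tps by simp
    then have "g ts ps \<le> 0" using w0[OF psG] b_nonneg[of 0 ps] \<eta> by (simp add: g_def)
    then show False using gpos by simp
  qed
  obtain s u where su: "ps = (s, u)" by (cases ps)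
  have bs: "b t (s, v) = (half_sign s * v - 1)\<^sup>2 + 2 * t" if "(s, v) \<in> GG" for t v
    using that by (auto simp: b_def GG_def half_sign_def)
  show False
  proof (cases "u = 0")
    case False
    let ?S = "{v. 0 < half_sign s * v}"
    have uS: "u \<in> ?S" using psG su False by (auto simp: GG_iff half_sign_def split: if_splits)
    define r where "r = half_sign s * u"
    have r: "0 < r" using uS by (simp add: r_def)
    have inS: "v \<in> ?S" if "\<bar>v - u\<bar> < r" for v
      using that by (auto simp: r_def half_sign_def abs_less_iff split: if_splits)
    have SG: "(s, v) \<in> GG \<and> v \<noteq> 0" if "v \<in> ?S" for v using that by (auto simp: GG_iff)
    let ?d = "\<lambda>\<rho> v. deriv (\<lambda>v. \<rho> ts (s, v)) v"
    have d1: "((\<lambda>v. \<rho> ts (s, v)) has_real_derivative ?d \<rho> v) (at v)"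
      if "snob_solution \<kappa> f \<rho>" "v \<in> ?S" for \<rho> v
      using that SG[OF that(2)] ts unfolding snob_solution_def by (intro DERIV_deriv_iff_real_differentiable[THEN iffD2]) blast
    have d2: "(?d \<rho> has_real_derivative deriv (?d \<rho>) u) (at u)" if "snob_solution \<kappa> f \<rho>" for \<rho>
      using that SG[OF uS] ts unfolding snob_solution_def by (intro DERIV_deriv_iff_real_differentiable[THEN iffD2]) blast
    have dt: "((\<lambda>r. \<rho> r (s, u)) has_real_derivative 1 / 2 * deriv (?d \<rho>) u) (at ts)" if "snob_solution \<kappa> f \<rho>" for \<rho>
      using that SG[OF uS] ts unfolding snob_solution_def by blast
    define W where "W = deriv (?d \<rho>1) u - deriv (?d \<rho>2) u"
    \<comment> \<open>The second-order condition in space gives W <= 2 * \<eta>; the first-order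
      condition in time below, through the heat equation, gives W >= 4 * \<eta>.\<close>
    have "W - \<eta> * 2 \<le> 0"
    proof (rule DERIV2_local_max[OF r])
      fix v assume v: "\<bar>v - u\<bar> < r"
      show "((\<lambda>v. \<rho>1 ts (s, v) - \<rho>2 ts (s, v) - \<eta> * ((half_sign s * v - 1)\<^sup>2 + 2 * ts)) has_real_derivative
          ?d \<rho>1 v - ?d \<rho>2 v - \<eta> * (2 * (half_sign s * v - 1) * half_sign s)) (at v)"
        by (auto intro!: derivative_eq_intros d1[OF \<rho>1 inS[OF v]] d1[OF \<rho>2 inS[OF v]])
      show "\<rho>1 ts (s, v) - \<rho>2 ts (s, v) - \<eta> * ((half_sign s * v - 1)\<^sup>2 + 2 * ts) \<le>
          \<rho>1 ts (s, u) - \<rho>2 ts (s, u) - \<eta> * ((half_sign s * u - 1)\<^sup>2 + 2 * ts)"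
        using sup[of ts "(s, v)"] SG[OF inS[OF v]] SG[OF uS] bs tps su by (simp add: g_def w_def)
    next
      have "half_sign s * half_sign s = 1" by (simp add: half_sign_def)
      then show "((\<lambda>v. ?d \<rho>1 v - ?d \<rho>2 v - \<eta> * (2 * (half_sign s * v - 1) * half_sign s)) has_real_derivative W - \<eta> * 2) (at u)"
        unfolding W_def by (auto intro!: derivative_eq_intros d2[OF \<rho>1] d2[OF \<rho>2] simp: mult_ac)
    qed
    moreover have "0 \<le> 1 / 2 * W - \<eta> * 2"
    \<comment> \<open>Only earlier times are compared, because ts may be the final time T.\<close>
    proof (rule ccontr)
      define h where "h r = \<rho>1 r (s, u) - \<rho>2 r (s, u) - \<eta> * ((half_sign s * u - 1)\<^sup>2 + 2 * r)" for r
      have dh: "(h has_real_derivative 1 / 2 * W - \<eta> * 2) (at ts)"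
        unfolding W_def h_def[abs_def] by (auto intro!: derivative_eq_intros dt[OF \<rho>1] dt[OF \<rho>2] simp: algebra_simps)
      assume "\<not> 0 \<le> 1 / 2 * W - \<eta> * 2"
      then have "1 / 2 * W - \<eta> * 2 < 0" by simp
      from DERIV_neg_dec_left[OF dh this] obtain \<delta>
        where \<delta>: "\<delta> > 0" "\<And>k. 0 < k \<Longrightarrow> k < \<delta> \<Longrightarrow> h ts < h (ts - k)" by blast
      define k where "k = min \<delta> ts / 2"
      have k: "0 < k" "k < \<delta>" "k < ts" using \<delta> ts by (auto simp: k_def)
      have "h (ts - k) \<le> h ts"
        using sup[of "ts - k" "(s, u)"] SG[OF uS] bs tps su k by (simp add: g_def w_def h_def)
      then show False using \<delta>(2)[OF k(1,2)] by simp
    qed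
    ultimately show False using \<eta> by linarith
  next
    case True
    define J where "J = w ts (True, 0) - w ts (False, 0)"
    have G0: "(True, 0) \<in> GG" "(False, 0) \<in> GG" by (auto simp: GG_def)
    have bd: "((\<lambda>v. \<rho> ts (True, v)) has_real_derivative \<kappa> / 2 * (\<rho> ts (True, 0) - \<rho> ts (False, 0))) (at_right 0)"
      "((\<lambda>v. \<rho> ts (False, v)) has_real_derivative \<kappa> / 2 * (\<rho> ts (True, 0) - \<rho> ts (False, 0))) (at_left 0)"
      if "snob_solution \<kappa> f \<rho>" for \<rho>
      using that ts unfolding snob_solution_def by blast+
    show False
    proof (cases s)
      case True
      \<comment> \<open>The barrier agrees at both copies of 0, so a maximum at
        \<open>0\<^sup>+\<close> forces a nonnegative jump of w. The transmission condition and the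
        slope of the barrier then make the difference strictly increasing into the
        half-line.\<close>
      have J: "0 \<le> J" using sup[OF tps(1,2) G0(2)] su \<open>u = 0\<close> True by (simp add: g_def b_def J_def)
      define h where "h v = \<rho>1 ts (True, v) - \<rho>2 ts (True, v) - \<eta> * ((v - 1)\<^sup>2 + 2 * ts)" for v
      have dh: "(h has_real_derivative \<kappa> / 2 * J + 2 * \<eta>) (at_right 0)"
        unfolding J_def w_def h_def[abs_def] by (auto intro!: derivative_eq_intros bd[OF \<rho>1] bd[OF \<rho>2] simp: algebra_simps)
      have "0 < \<kappa> / 2 * J + 2 * \<eta>" using J \<kappa> \<eta> by (intro add_nonneg_pos) auto
      from has_real_derivative_pos_inc_right[OF dh this] obtain \<delta>
        where \<delta>: "\<delta> > 0" "\<And>k. 0 < k \<Longrightarrow> 0 + k \<in> {0<..} \<Longrightarrow> k < \<delta> \<Longrightarrow> h 0 < h (0 + k)" by blast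
      have "h (\<delta> / 2) \<le> h 0"
        using sup[OF tps(1,2), of "(True, \<delta> / 2)"] su \<open>u = 0\<close> True \<delta>(1) by (simp add: g_def b_def w_def GG_def h_def)
      then show False using \<delta>(2)[of "\<delta> / 2"] \<delta>(1) by simp
    next
      case False
      have J: "J \<le> 0" using sup[OF tps(1,2) G0(1)] su \<open>u = 0\<close> False by (simp add: g_def b_def J_def)
      define h where "h v = \<rho>1 ts (False, v) - \<rho>2 ts (False, v) - \<eta> * ((- v - 1)\<^sup>2 + 2 * ts)" for v
      have dh: "(h has_real_derivative \<kappa> / 2 * J - 2 * \<eta>) (at_left 0)"
        unfolding J_def w_def h_def[abs_def] by (auto intro!: derivative_eq_intros bd[OF \<rho>1] bd[OF \<rho>2] simp: algebra_simps)
      have "\<kappa> / 2 * J - 2 * \<eta> < 0" using mult_nonneg_nonpos[of "\<kappa> / 2" J] J \<kappa> \<eta> by simp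
      from has_real_derivative_neg_dec_left[OF dh this] obtain \<delta>
        where \<delta>: "\<delta> > 0" "\<And>k. 0 < k \<Longrightarrow> 0 - k \<in> {..<0} \<Longrightarrow> k < \<delta> \<Longrightarrow> h 0 < h (0 - k)" by blast
      have "h (- (\<delta> / 2)) \<le> h 0"
        using sup[OF tps(1,2), of "(False, - (\<delta> / 2))"] su \<open>u = 0\<close> False \<delta>(1) by (simp add: g_def b_def w_def GG_def h_def)
      then show False using \<delta>(2)[of "\<delta> / 2"] \<delta>(1) by simp
    qed
  qed
qed

theorem proposition2p3:
  fixes \<kappa> :: real
    and M :: "real \<Rightarrow> 'w measure"
    and B :: "real \<Rightarrow> real \<Rightarrow> 'w \<Rightarrow> real"
    and f :: "bool \<times> real \<Rightarrow> real"
  assumes "\<kappa> > 0"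
    and "\<And>x. brownian_motion (M x) (B x) x"
    and "f \<in> C0G"
  shows "(\<forall>t\<ge>0. snob_semigroup \<kappa> M B t f \<in> C0G) \<and>
    snob_solution \<kappa> f (\<lambda>t. snob_semigroup \<kappa> M B t f) \<and>
    (\<forall>\<rho>. snob_solution \<kappa> f \<rho> \<longrightarrow>
       (\<forall>t\<ge>0. \<forall>p\<in>GG. \<rho> t p = snob_semigroup \<kappa> M B t f p)) \<and>
    (\<forall>t>0. \<forall>u>0. snob_semigroup \<kappa> M B t f (of_nonzero u) =
       1 / sqrt (2 * pi * t) *
         ((LINT y|lborel. exp (- (u - y)\<^sup>2 / (2 * t)) * even_part f (of_nonzero y)) +
          exp (\<kappa> * u) * (LINT z:{u..}|lborel. exp (- \<kappa> * z) *
            (LINT y:{0..}|lborel.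
               ((z - y + \<kappa> * t) / t * exp (- (z - y)\<^sup>2 / (2 * t)) +
                (z + y - \<kappa> * t) / t * exp (- (z + y)\<^sup>2 / (2 * t)))
               * odd_part f (of_nonzero y))))) \<and>
    (\<forall>t>0. \<forall>u<0. snob_semigroup \<kappa> M B t f (of_nonzero u) =
       1 / sqrt (2 * pi * t) *
         ((LINT y|lborel. exp (- (u - y)\<^sup>2 / (2 * t)) * even_part f (of_nonzero y)) -
          exp (- \<kappa> * u) * (LINT z:{- u..}|lborel. exp (- \<kappa> * z) *
            (LINT y:{0..}|lborel.
               ((z - y + \<kappa> * t) / t * exp (- (z - y)\<^sup>2 / (2 * t)) +
                (z + y - \<kappa> * t) / t * exp (- (z + y)\<^sup>2 / (2 * t)))
               * odd_part f (of_nonzero y)))))"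
proof -
  obtain C where C: "C \<ge> 0" "\<And>p. p \<in> GG \<Longrightarrow> \<bar>f p\<bar> \<le> C"
    using C0G_bounded[OF assms(3)] by blast
  interpret snob \<kappa> M B f C by (rule snob.intro) (fact assms C)+
  show ?thesis
  proof (intro conjI allI impI ballI)
    show "snob_semigroup \<kappa> M B t f \<in> C0G" if "0 \<le> t" for t using that by (rule semigroup_C0G)
    show "snob_solution \<kappa> f (\<lambda>t. snob_semigroup \<kappa> M B t f)" by (rule semigroup_solution)
    show "\<rho> t p = snob_semigroup \<kappa> M B t f p" if "snob_solution \<kappa> f \<rho>" "0 \<le> t" "p \<in> GG" for \<rho> t p
      using snob_solution_comparison[OF that(1) semigroup_solution \<kappa> that(2,3)]
        snob_solution_comparison[OF semigroup_solution that(1) \<kappa> that(2,3)] by simp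
  next
    fix t u :: real assume t: "0 < t" and u: "0 < u"
    have "snob_semigroup \<kappa> M B t f (of_nonzero u) = heat t e u + heat t G u"
      using t u by (simp add: of_nonzero_def semigroup_eq half_sign_def)
    then show "snob_semigroup \<kappa> M B t f (of_nonzero u) =
       1 / sqrt (2 * pi * t) *
         ((LINT y|lborel. exp (- (u - y)\<^sup>2 / (2 * t)) * even_part f (of_nonzero y)) +
          exp (\<kappa> * u) * (LINT z:{u..}|lborel. exp (- \<kappa> * z) *
            (LINT y:{0..}|lborel.
               ((z - y + \<kappa> * t) / t * exp (- (z - y)\<^sup>2 / (2 * t)) +
                (z + y - \<kappa> * t) / t * exp (- (z + y)\<^sup>2 / (2 * t)))
               * odd_part f (of_nonzero y))))"
      unfolding heat_e_eq[OF t] heat_G_eq[OF t] by (simp only: distrib_left)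
  next
    fix t u :: real assume t: "0 < t" and u: "u < 0"
    have "snob_semigroup \<kappa> M B t f (of_nonzero u) = heat t e u - heat t G (- u)"
      using t u by (simp add: of_nonzero_def semigroup_eq half_sign_def)
    then show "snob_semigroup \<kappa> M B t f (of_nonzero u) =
       1 / sqrt (2 * pi * t) *
         ((LINT y|lborel. exp (- (u - y)\<^sup>2 / (2 * t)) * even_part f (of_nonzero y)) -
          exp (- \<kappa> * u) * (LINT z:{- u..}|lborel. exp (- \<kappa> * z) *
            (LINT y:{0..}|lborel.
               ((z - y + \<kappa> * t) / t * exp (- (z - y)\<^sup>2 / (2 * t)) +
                (z + y - \<kappa> * t) / t * exp (- (z + y)\<^sup>2 / (2 * t)))
               * odd_part f (of_nonzero y))))"
      unfolding heat_e_eq[OF t] heat_G_eq[OF t] by (simp only: right_diff_distrib mult_minus_left mult_minus_right)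
  qed
qed

end
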